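(* A field extension $L/K$ is separable if and only if, for all $n\ge1$, the $n$-fold tensor product $L^{\otimes_K n}=L\otimes_K\cdots\otimes_KL$ is reduced. If $L/K$ is finitely generated, then there exists $N$ such that $L/K$ is separable if and only if $L^{\otimes_KN}$ is reduced. If $L/K$ is algebraic, then we can take $N=2$; that is, $L/K$ is separable if and only if $L\otimes_KL$ is reduced.
   Context: A (not necessarily algebraic) field extension $L/K$ is called separable if $L\otimes_KA$ is reduced for every reduced commutative $K$-algebra $A$. *)

theory Defs
  imports "HOL-Algebra.Algebra"
begin

definition reduced_ring :: "('a, 'm) ring_scheme \<Rightarrow> bool"
  where "reduced_ring R \<longleftrightarrow>
    (\<forall>x\<in>carrier R. (\<exists>n::nat. x [^]\<^bsub>R\<^esub> n = \<zero>\<^bsub>R\<^esub>) \<longrightarrow> x = \<zero>\<^bsub>R\<^esub>)"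

text \<open>
  The monoid ring \<open>\<int>[M]\<close>: the free abelian group on the carrier of \<open>M\<close>, with the biadditive
  extension of the multiplication of \<open>M\<close>.
\<close>

definition monoid_ring :: "('a, 'm) monoid_scheme \<Rightarrow> ('a \<Rightarrow>\<^sub>0 int) ring"
  where "monoid_ring M =
    \<lparr>carrier = carrier (free_Abelian_group (carrier M)),
     monoid.mult = (\<lambda>u v. frag_extend (\<lambda>p. frag_extend (\<lambda>q. frag_of (p \<otimes>\<^bsub>M\<^esub> q)) v) u),
     one = frag_of \<one>\<^bsub>M\<^esub>,
     ring.zero = 0,
     ring.add = (+)\<rparr>"

text \<open>
  The tensor product is the usual quotient of the free abelian group on the pairs \<open>(a, b)\<close> by the
  subgroup generated by the relations of biadditivity and \<open>K\<close>-balancedness. This subgroup is an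
  ideal of \<open>\<int>[A \<times> B]\<close>, because the relations are stable under multiplication by pairs, so that
  the quotient carries the multiplication \<open>(a \<otimes> b) (a' \<otimes> b') = a a' \<otimes> b b'\<close>.
\<close>

definition tensor_rels ::
    "('k, 'r) ring_scheme \<Rightarrow> ('k, 'a, 'm) module_scheme \<Rightarrow> ('k, 'b, 'n) module_scheme
      \<Rightarrow> ('a \<times> 'b \<Rightarrow>\<^sub>0 int) set"
  where "tensor_rels K A B =
      {frag_of (a \<oplus>\<^bsub>A\<^esub> a', b) - frag_of (a, b) - frag_of (a', b) | a a' b.
         a \<in> carrier A \<and> a' \<in> carrier A \<and> b \<in> carrier B}
    \<union> {frag_of (a, b \<oplus>\<^bsub>B\<^esub> b') - frag_of (a, b) - frag_of (a, b') | a b b'.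
         a \<in> carrier A \<and> b \<in> carrier B \<and> b' \<in> carrier B}
    \<union> {frag_of (k \<odot>\<^bsub>A\<^esub> a, b) - frag_of (a, k \<odot>\<^bsub>B\<^esub> b) | k a b.
         k \<in> carrier K \<and> a \<in> carrier A \<and> b \<in> carrier B}"

definition tensor_product ::
    "('k, 'r) ring_scheme \<Rightarrow> ('k, 'a, 'm) module_scheme \<Rightarrow> ('k, 'b, 'n) module_scheme
      \<Rightarrow> ('a \<times> 'b \<Rightarrow>\<^sub>0 int) set ring"
  where "tensor_product K A B =
    monoid_ring (A \<times>\<times> B) Quot
      generate (add_monoid (monoid_ring (A \<times>\<times> B))) (tensor_rels K A B)"

text \<open>
  Iterating the binary tensor product changes the type at every step, so the \<open>n\<close>-fold tensor power
  is built in one step from the \<open>n\<close>-tuples, that is, from the extensional functions on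
  \<open>{..<n}\<close>. The relations are additivity in each slot and the passage of scalars between any two
  slots. As the coefficients are integers, this is the tensor power over \<open>K\<close> only for \<open>n \<ge> 1\<close>
  (for \<open>n = 0\<close> it yields \<open>\<int>\<close> instead of \<open>K\<close>).
\<close>

definition tensor_power_rels ::
    "('k, 'r) ring_scheme \<Rightarrow> ('k, 'a, 'm) module_scheme \<Rightarrow> nat \<Rightarrow> ((nat \<Rightarrow> 'a) \<Rightarrow>\<^sub>0 int) set"
  where "tensor_power_rels K A n =
      {frag_of (x(i := a \<oplus>\<^bsub>A\<^esub> b)) - frag_of (x(i := a)) - frag_of (x(i := b)) | x i a b.
         x \<in> (\<Pi>\<^sub>E j\<in>{..<n}. carrier A) \<and> i < n \<and> a \<in> carrier A \<and> b \<in> carrier A}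
    \<union> {frag_of (x(i := k \<odot>\<^bsub>A\<^esub> x i)) - frag_of (x(j := k \<odot>\<^bsub>A\<^esub> x j)) | x i j k.
         x \<in> (\<Pi>\<^sub>E j\<in>{..<n}. carrier A) \<and> i < n \<and> j < n \<and> k \<in> carrier K}"

definition tensor_power ::
    "('k, 'r) ring_scheme \<Rightarrow> ('k, 'a, 'm) module_scheme \<Rightarrow> nat \<Rightarrow> ((nat \<Rightarrow> 'a) \<Rightarrow>\<^sub>0 int) set ring"
  where "tensor_power K A n =
    monoid_ring (product_group {..<n} (\<lambda>_. A)) Quot
      generate (add_monoid (monoid_ring (product_group {..<n} (\<lambda>_. A)))) (tensor_power_rels K A n)"

text \<open>
  A field extension is given by its structure map \<open>k \<mapsto> k \<odot> \<one>\<close>, which need not be a set-theoretic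
  inclusion; \<open>base_field K L\<close> is the copy of \<open>K\<close> inside \<open>L\<close>.
\<close>

definition field_extension :: "('k, 'r) ring_scheme \<Rightarrow> ('k, 'l, 'm) module_scheme \<Rightarrow> bool"
  where "field_extension K L \<longleftrightarrow> field K \<and> field L \<and> algebra K L"

definition base_field :: "('k, 'r) ring_scheme \<Rightarrow> ('k, 'l, 'm) module_scheme \<Rightarrow> 'l set"
  where "base_field K L = (\<lambda>k. k \<odot>\<^bsub>L\<^esub> \<one>\<^bsub>L\<^esub>) ` carrier K"

definition fin_gen_extension :: "('k, 'r) ring_scheme \<Rightarrow> ('k, 'l, 'm) module_scheme \<Rightarrow> bool"
  where "fin_gen_extension K L \<longleftrightarrow>
    (\<exists>S. finite S \<and> S \<subseteq> carrier L \<and> generate_field L (base_field K L \<union> S) = carrier L)"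

definition algebraic_extension :: "('k, 'r) ring_scheme \<Rightarrow> ('k, 'l, 'm) module_scheme \<Rightarrow> bool"
  where "algebraic_extension K L \<longleftrightarrow>
    (\<forall>x\<in>carrier L. (ring.algebraic L over base_field K L) x)"

text \<open>
  Separability quantifies over all reduced commutative \<open>K\<close>-algebras, whereas a HOL formula can only
  quantify over algebras whose elements lie in one given type. That type is \<open>'l list + 'u\<close> here, with
  \<open>'u\<close> arbitrary: the right summand makes room for every algebra with elements in \<open>'u\<close>, and the left
  one ensures that no choice of \<open>'u\<close> is too small. Indeed \<open>'l list\<close> is infinite and at least as large
  as \<open>L\<close> and \<open>K\<close>, so it has room for a copy of every finitely generated \<open>K\<close>-algebra, and an algebra
  violating the condition has a finitely generated subalgebra violating it. In particular the notion
  does not depend on \<open>'u\<close>.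
\<close>

definition separable_extension ::
    "'u itself \<Rightarrow> ('k, 'r) ring_scheme \<Rightarrow> ('k, 'l, 'm) module_scheme \<Rightarrow> bool"
  where "separable_extension (_ :: 'u itself) K L \<longleftrightarrow>
    (\<forall>A :: ('k, 'l list + 'u) module.
       algebra K A \<and> reduced_ring A \<longrightarrow> reduced_ring (tensor_product K L A))"

end

theory Submission
  imports Defs
begin

text \<open>
  In characteristic \<open>p\<close>, all properties in question are compared with Mac Lane's criterion: the \<open>p\<close>-th
  powers of \<open>K\<close>-independent elements of \<open>L\<close> are \<open>K\<close>-independent. If it holds and \<open>A\<close> is reduced, then
  \<open>L \<otimes>\<^sub>K A\<close> is reduced, because \<open>(\<Sum> u\<^sub>i \<otimes> a\<^sub>i)\<^sup>p = \<Sum> u\<^sub>i\<^sup>p \<otimes> a\<^sub>i\<^sup>p\<close>; hence \<open>L\<close> is separable, and the tensor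
  powers are reduced one factor at a time. If it fails, say for \<open>u\<^sub>1, \<dots>, u\<^sub>n\<close>, then \<open>\<Sum> u\<^sub>i \<otimes> a\<^sub>i\<close> is
  nilpotent in \<open>L \<otimes>\<^sub>K K\<^sup>1\<^sup>/\<^sup>p\<close> for suitable \<open>a\<^sub>i\<close>, and the antisymmetrisation of \<open>u\<^sub>1 \<otimes> \<cdots> \<otimes> u\<^sub>n\<close> is a nonzero
  element of the \<open>n\<close>-th tensor power whose \<open>p\<close>-th power is the antisymmetrisation of
  \<open>u\<^sub>1\<^sup>p \<otimes> \<cdots> \<otimes> u\<^sub>n\<^sup>p\<close>, which vanishes. In characteristic \<open>0\<close> everything is reduced, by adjoining the
  elements of \<open>L\<close> one at a time.

  If \<open>L\<close> is algebraic and \<open>x \<notin> K(x\<^sup>p)\<close>, then a multiple of \<open>1 \<otimes> x - x \<otimes> 1\<close> is a nonzero nilpotent of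
  \<open>L \<otimes>\<^sub>K L\<close>; if there is no such \<open>x\<close>, then the \<open>p\<close>-th powers of a basis of a finite subextension span it,
  so that Mac Lane's criterion follows by counting dimensions.
\<close>

section \<open>Quotients of the integral monoid ring\<close>

text \<open>The tensor products are bare quotients of free abelian groups, and only their universal
  property is at hand; no \<open>K\<close>-basis of \<open>L\<close> is used to compute in them.
  Whenever a tensor has to be nonzero, or coefficients have to vanish, the proof takes a linear
  functional \<open>f\<close> on \<open>L\<close>, supplied by Zorn's lemma, and applies the
  contraction \<open>f \<otimes> id\<close>. This is why reducedness is proved for an abstract
  compositum of \<open>L\<close> with a subring \<open>A\<close>: both \<open>L \<otimes> A\<close>
  and each stage of a tensor power admit such contractions, so one theorem serves them all. In
  characteristic 0 the ambient ring stays fixed while generators are adjoined, so the induction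
  cannot replace \<open>K\<close> by a larger field in the tensor product; functionals over an
  intermediate field \<open>F\<close> are contracted over the compositum of \<open>F\<close> and
  \<open>A\<close> instead. Derivatives come from evaluation in dual numbers, with values of
  polynomials in place of formal polynomials. Antisymmetric tensors are suitable witnesses in every
  characteristic: triangular functionals show that they are nonzero on independent tuples, and the
  pairing of even with odd permutations shows that they vanish on dependent ones, without any
  division by factorials.\<close>

lemma frag_extend_plus: "frag_extend (\<lambda>p. f p + g p) u = frag_extend f u + frag_extend g u"
  by (simp add: frag_extend_def frag_cmul_distrib2 sum.distrib)

lemma frag_extend_diff_fun: "frag_extend (\<lambda>p. f p - g p) u = frag_extend f u - frag_extend g u"
  using frag_extend_plus[of "\<lambda>p. f p - g p" g u] by simp

lemma frag_extend_zero_fun [simp]: "frag_extend (\<lambda>p. 0) u = 0"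
  by (simp add: frag_extend_def)

lemmas frag_induct = free_Abelian_group_induct [consumes 1, case_names zero diff frag_of]

lemma monoid_ring_simps:
  "carrier (monoid_ring M) = {u. Poly_Mapping.keys u \<subseteq> carrier M}"
  "u \<otimes>\<^bsub>monoid_ring M\<^esub> v = frag_extend (\<lambda>p. frag_extend (\<lambda>q. frag_of (p \<otimes>\<^bsub>M\<^esub> q)) v) u"
  "\<one>\<^bsub>monoid_ring M\<^esub> = frag_of \<one>\<^bsub>M\<^esub>"
  "\<zero>\<^bsub>monoid_ring M\<^esub> = 0"
  "u \<oplus>\<^bsub>monoid_ring M\<^esub> v = u + v"
  by (auto simp: monoid_ring_def)

lemma add_monoid_monoid_ring: "add_monoid (monoid_ring M) = free_Abelian_group (carrier M)"
  by (simp add: monoid_ring_def free_Abelian_group_def)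

lemma (in comm_monoid) monoid_ring_mult_closed:
  assumes "Poly_Mapping.keys u \<subseteq> carrier G" "Poly_Mapping.keys v \<subseteq> carrier G"
  shows "Poly_Mapping.keys (u \<otimes>\<^bsub>monoid_ring G\<^esub> v) \<subseteq> carrier G"
  unfolding monoid_ring_simps
proof (rule order_trans[OF keys_frag_extend], rule UN_least)
  fix p assume p: "p \<in> Poly_Mapping.keys u"
  show "Poly_Mapping.keys (frag_extend (\<lambda>q. frag_of (p \<otimes> q)) v) \<subseteq> carrier G"
    by (rule order_trans[OF keys_frag_extend]) (use p assms in auto)
qed

text \<open>Commutativity, associativity and the unit law are additive in every argument, so
  induction over the free abelian group reduces them to generators, where they are the laws of the
  monoid.\<close>

lemma (in comm_monoid) monoid_ring_cring: "cring (monoid_ring G)"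
proof -
  let ?Z = "monoid_ring G"
  have ladd: "(u + u') \<otimes>\<^bsub>?Z\<^esub> v = u \<otimes>\<^bsub>?Z\<^esub> v + u' \<otimes>\<^bsub>?Z\<^esub> v" for u u' v
    by (simp add: monoid_ring_simps frag_extend_add)
  have ldiff: "(u - u') \<otimes>\<^bsub>?Z\<^esub> v = u \<otimes>\<^bsub>?Z\<^esub> v - u' \<otimes>\<^bsub>?Z\<^esub> v" for u u' v
    by (simp add: monoid_ring_simps frag_extend_diff)
  have rdiff: "v \<otimes>\<^bsub>?Z\<^esub> (u - u') = v \<otimes>\<^bsub>?Z\<^esub> u - v \<otimes>\<^bsub>?Z\<^esub> u'" for u u' v
    by (simp add: monoid_ring_simps frag_extend_diff frag_extend_diff_fun)
  have zero: "0 \<otimes>\<^bsub>?Z\<^esub> v = 0" "v \<otimes>\<^bsub>?Z\<^esub> 0 = 0" for v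
    by (simp_all add: monoid_ring_simps)
  have of: "frag_of p \<otimes>\<^bsub>?Z\<^esub> frag_of q = frag_of (p \<otimes> q)" for p q
    by (simp add: monoid_ring_simps)
  have comm: "u \<otimes>\<^bsub>?Z\<^esub> v = v \<otimes>\<^bsub>?Z\<^esub> u"
    if u: "Poly_Mapping.keys u \<subseteq> carrier G" and v: "Poly_Mapping.keys v \<subseteq> carrier G" for u v
    using u
  proof (induction u rule: frag_induct)
    case (frag_of a)
    show ?case using v
      by (induction v rule: frag_induct) (auto simp: zero ldiff rdiff of m_comm frag_of)
  qed (auto simp: zero ldiff rdiff)
  have assoc: "(u \<otimes>\<^bsub>?Z\<^esub> v) \<otimes>\<^bsub>?Z\<^esub> w = u \<otimes>\<^bsub>?Z\<^esub> (v \<otimes>\<^bsub>?Z\<^esub> w)"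
    if u: "Poly_Mapping.keys u \<subseteq> carrier G" and v: "Poly_Mapping.keys v \<subseteq> carrier G"
      and w: "Poly_Mapping.keys w \<subseteq> carrier G" for u v w
    using u
  proof (induction u rule: frag_induct)
    case (frag_of a)
    note a = frag_of
    show ?case using v
    proof (induction v rule: frag_induct)
      case (frag_of b)
      show ?case using w
        by (induction w rule: frag_induct)
          (auto simp: zero ldiff rdiff of m_assoc frag_of a)
    qed (auto simp: zero ldiff rdiff)
  qed (auto simp: zero ldiff rdiff)
  have one: "frag_of \<one> \<otimes>\<^bsub>?Z\<^esub> u = u" if u: "Poly_Mapping.keys u \<subseteq> carrier G" for u
    using u by (induction u rule: frag_induct) (auto simp: zero ldiff rdiff of)
  have neg: "Poly_Mapping.keys u \<subseteq> carrier G \<Longrightarrow> \<exists>y. Poly_Mapping.keys y \<subseteq> carrier G \<and> y + u = 0" for u :: "'a \<Rightarrow>\<^sub>0 int"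
    by (rule exI[of _ "- u"]) simp
  have keys_sum: "Poly_Mapping.keys (u + v) \<subseteq> carrier G"
    if "Poly_Mapping.keys u \<subseteq> carrier G" "Poly_Mapping.keys v \<subseteq> carrier G" for u v :: "'a \<Rightarrow>\<^sub>0 int"
    using that keys_add[of u v] by blast
  have mc: "comm_monoid ?Z"
    by (rule comm_monoidI)
      (auto simp: monoid_ring_simps(1,3) intro: comm assoc one
        dest: subsetD[OF monoid_ring_mult_closed, simplified monoid_ring_simps(1)])
  have ag: "abelian_group ?Z"
    by (rule abelian_groupI)
      (use keys_sum neg in \<open>auto simp: monoid_ring_simps(1,3,4,5) algebra_simps\<close>)
  show ?thesis
    by (rule cringI[OF ag mc]) (simp add: monoid_ring_simps(5) ladd)
qed

text \<open>The common shape of \<open>tensor_product\<close> and \<open>tensor_power\<close>. In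
  each case only the behaviour of the relations under multiplication by a generator has to be
  checked; the ideal property, the ring structure and the universal property then follow once for
  both.\<close>

locale monoid_ring_quotient = comm_monoid M for M (structure) +
  fixes S :: "('a \<Rightarrow>\<^sub>0 int) set"
  assumes rels_closed: "s \<in> S \<Longrightarrow> Poly_Mapping.keys s \<subseteq> carrier M"
    and rels_stable: "s \<in> S \<Longrightarrow> m \<in> carrier M \<Longrightarrow> frag_of m \<otimes>\<^bsub>monoid_ring M\<^esub> s \<in> S"
begin

definition rel_ideal :: "('a \<Rightarrow>\<^sub>0 int) set"
  where "rel_ideal = generate (add_monoid (monoid_ring M)) S"

abbreviation quot :: "('a \<Rightarrow>\<^sub>0 int) set ring"
  where "quot \<equiv> monoid_ring M Quot rel_ideal"

definition cls :: "'a \<Rightarrow> ('a \<Rightarrow>\<^sub>0 int) set"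
  where "cls x = rel_ideal +>\<^bsub>monoid_ring M\<^esub> frag_of x"

sublocale Z: cring "monoid_ring M"
  by (rule monoid_ring_cring)

lemma Z_diff:
  assumes "x \<in> carrier (monoid_ring M)" "y \<in> carrier (monoid_ring M)"
  shows "x - y = x \<ominus>\<^bsub>monoid_ring M\<^esub> y"
proof -
  have d: "x - y \<in> carrier (monoid_ring M)"
    using assms keys_diff[of x y] by (auto simp: monoid_ring_simps(1))
  have "(x - y) \<oplus>\<^bsub>monoid_ring M\<^esub> y = x" by (simp add: monoid_ring_simps(5))
  moreover have "x - y = (x - y \<oplus>\<^bsub>monoid_ring M\<^esub> y) \<ominus>\<^bsub>monoid_ring M\<^esub> y"
    using d assms by algebra
  ultimately show ?thesis by simp
qed

lemma S_carrier: "S \<subseteq> carrier (monoid_ring M)"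
  using rels_closed by (auto simp: monoid_ring_simps)

lemma rel_ideal_subgroup: "subgroup rel_ideal (add_monoid (monoid_ring M))"
  unfolding rel_ideal_def using S_carrier by (intro Z.add.generate_is_subgroup) simp

lemma rel_ideal_carrier: "rel_ideal \<subseteq> carrier (monoid_ring M)"
  using subgroup.subset[OF rel_ideal_subgroup] by simp

lemma rel_ideal_cls_mult:
  assumes "s \<in> rel_ideal" "m \<in> carrier M"
  shows "frag_of m \<otimes>\<^bsub>monoid_ring M\<^esub> s \<in> rel_ideal"
proof -
  have fm: "frag_of m \<in> carrier (monoid_ring M)" using assms by (simp add: monoid_ring_simps)
  from assms(1) show ?thesis unfolding rel_ideal_def
  proof (induction rule: generate.induct)
    case one
    then show ?case using fm generate.one by (metis Z.r_null monoid.select_convs(2))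
  next
    case (incl h)
    then show ?case by (intro generate.incl rels_stable assms(2))
  next
    case (inv h)
    then have h: "h \<in> carrier (monoid_ring M)" using S_carrier by blast
    have "frag_of m \<otimes>\<^bsub>monoid_ring M\<^esub> (\<ominus>\<^bsub>monoid_ring M\<^esub> h)
        = \<ominus>\<^bsub>monoid_ring M\<^esub> (frag_of m \<otimes>\<^bsub>monoid_ring M\<^esub> h)"
      using h fm by (simp add: Z.r_minus)
    then show ?case
      using generate.inv[OF rels_stable[OF inv assms(2)]] by (simp add: a_inv_def)
  next
    case (eng h1 h2)
    then have "h1 \<in> carrier (monoid_ring M)" "h2 \<in> carrier (monoid_ring M)"
      using rel_ideal_carrier unfolding rel_ideal_def by blast+
    then show ?case
      using fm generate.eng[OF eng.IH] by (simp add: Z.r_distr)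
  qed
qed

text \<open>Multiplication by a monoid element maps the generators of the subgroup to generators,
  hence the subgroup to itself; by additivity this extends to multiplication by every element of the
  monoid ring.\<close>

lemma rel_ideal_ideal: "ideal rel_ideal (monoid_ring M)"
proof (rule idealI)
  show "ring (monoid_ring M)" by (rule Z.ring_axioms)
  show "subgroup rel_ideal (add_monoid (monoid_ring M))" by (rule rel_ideal_subgroup)
  have *: "x \<otimes>\<^bsub>monoid_ring M\<^esub> a \<in> rel_ideal"
    if a: "a \<in> rel_ideal" and x: "x \<in> carrier (monoid_ring M)" for a x
  proof -
    have ac: "a \<in> carrier (monoid_ring M)" using a rel_ideal_carrier by blast
    have "Poly_Mapping.keys x \<subseteq> carrier M" using x by (simp add: monoid_ring_simps)
    then show ?thesis
    proof (induction x rule: frag_induct)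
      case zero
      have "0 \<otimes>\<^bsub>monoid_ring M\<^esub> a = 0" by (simp add: monoid_ring_simps)
      then show ?case
        using subgroup.one_closed[OF rel_ideal_subgroup] by (simp add: monoid_ring_simps)
    next
      case (diff x y)
      have x: "x \<in> carrier (monoid_ring M)" and y: "y \<in> carrier (monoid_ring M)"
        using diff by (simp_all add: monoid_ring_simps)
      have "x - y = x \<ominus>\<^bsub>monoid_ring M\<^esub> y"
        using x y by (rule Z_diff)
      then have "(x - y) \<otimes>\<^bsub>monoid_ring M\<^esub> a = x \<otimes>\<^bsub>monoid_ring M\<^esub> a \<ominus>\<^bsub>monoid_ring M\<^esub> y \<otimes>\<^bsub>monoid_ring M\<^esub> a"
        using x y ac by algebra
      then show ?case
        using diff subgroup.m_closed[OF rel_ideal_subgroup] subgroup.m_inv_closed[OF rel_ideal_subgroup]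
        by (simp add: a_minus_def a_inv_def)
    next
      case (frag_of m)
      then show ?case using rel_ideal_cls_mult[OF a] by simp
    qed
  qed
  show "x \<otimes>\<^bsub>monoid_ring M\<^esub> a \<in> rel_ideal" "a \<otimes>\<^bsub>monoid_ring M\<^esub> x \<in> rel_ideal"
    if a: "a \<in> rel_ideal" and x: "x \<in> carrier (monoid_ring M)" for a x
    using *[OF a x] a x rel_ideal_carrier Z.m_comm by (simp_all add: subset_iff)
qed

sublocale I: ideal rel_ideal "monoid_ring M"
  by (rule rel_ideal_ideal)

sublocale Q: cring quot
  by (rule I.quotient_is_cring[OF Z.cring_axioms])

lemma coset_hom: "(+>\<^bsub>monoid_ring M\<^esub>) rel_ideal \<in> ring_hom (monoid_ring M) quot"
  by (rule I.rcos_ring_hom)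

lemma coset_carrier: "x \<in> carrier (monoid_ring M) \<Longrightarrow> rel_ideal +>\<^bsub>monoid_ring M\<^esub> x \<in> carrier quot"
  by (rule ring_hom_closed[OF coset_hom])

lemma coset_eq_iff:
  assumes "x \<in> carrier (monoid_ring M)" "y \<in> carrier (monoid_ring M)"
  shows "rel_ideal +>\<^bsub>monoid_ring M\<^esub> x = rel_ideal +>\<^bsub>monoid_ring M\<^esub> y \<longleftrightarrow> x - y \<in> rel_ideal"
  using Z.quotient_eq_iff_same_a_r_cos[OF rel_ideal_ideal assms] Z_diff[OF assms] by simp

lemma frag_of_carrier: "x \<in> carrier M \<Longrightarrow> frag_of x \<in> carrier (monoid_ring M)"
  by (simp add: monoid_ring_simps)

lemma cls_closed [simp, intro]: "x \<in> carrier M \<Longrightarrow> cls x \<in> carrier quot"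
  unfolding cls_def by (intro coset_carrier frag_of_carrier)

lemma cls_one: "cls \<one> = \<one>\<^bsub>quot\<^esub>"
  using ring_hom_one[OF coset_hom] by (simp add: cls_def monoid_ring_simps(3))

lemma cls_mult:
  assumes "x \<in> carrier M" "y \<in> carrier M"
  shows "cls x \<otimes>\<^bsub>quot\<^esub> cls y = cls (x \<otimes> y)"
proof -
  have "frag_of x \<otimes>\<^bsub>monoid_ring M\<^esub> frag_of y = frag_of (x \<otimes> y)" by (simp add: monoid_ring_simps)
  then show ?thesis
    using ring_hom_mult[OF coset_hom frag_of_carrier[OF assms(1)] frag_of_carrier[OF assms(2)]]
    by (simp add: cls_def)
qed

lemma cls_pow:
  fixes n :: nat
  assumes "x \<in> carrier M"
  shows "cls x [^]\<^bsub>quot\<^esub> n = cls (x [^] n)"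
  by (induction n) (use assms in \<open>simp_all add: cls_one cls_mult\<close>)

lemma cls_eqI:
  assumes "frag_of x - frag_of y \<in> S" "x \<in> carrier M" "y \<in> carrier M"
  shows "cls x = cls y"
  unfolding cls_def
  using coset_eq_iff[OF frag_of_carrier[OF assms(2)] frag_of_carrier[OF assms(3)]]
    generate.incl[OF assms(1)] by (simp add: rel_ideal_def)

lemma cls_addI:
  assumes "frag_of z - frag_of x - frag_of y \<in> S" "x \<in> carrier M" "y \<in> carrier M" "z \<in> carrier M"
  shows "cls z = cls x \<oplus>\<^bsub>quot\<^esub> cls y"
proof -
  have c: "frag_of x + frag_of y \<in> carrier (monoid_ring M)"
    using Z.a_closed[OF frag_of_carrier[OF assms(2)] frag_of_carrier[OF assms(3)]]
    by (simp add: monoid_ring_simps(5))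
  have "frag_of z - (frag_of x + frag_of y) \<in> rel_ideal"
    unfolding rel_ideal_def using assms(1) by (intro generate.incl) (simp add: algebra_simps)
  then have "cls z = rel_ideal +>\<^bsub>monoid_ring M\<^esub> (frag_of x + frag_of y)"
    unfolding cls_def using coset_eq_iff[OF frag_of_carrier[OF assms(4)] c] by simp
  then show ?thesis
    using ring_hom_add[OF coset_hom frag_of_carrier[OF assms(2)] frag_of_carrier[OF assms(3)]]
    by (simp add: cls_def monoid_ring_simps(5))
qed

lemma quot_induct [consumes 1, case_names zero add minus cls]:
  assumes "t \<in> carrier quot"
    and "P \<zero>\<^bsub>quot\<^esub>"
    and add: "\<And>s t. s \<in> carrier quot \<Longrightarrow> t \<in> carrier quot \<Longrightarrow> P s \<Longrightarrow> P t \<Longrightarrow> P (s \<oplus>\<^bsub>quot\<^esub> t)"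
    and minus: "\<And>s. s \<in> carrier quot \<Longrightarrow> P s \<Longrightarrow> P (\<ominus>\<^bsub>quot\<^esub> s)"
    and cls: "\<And>x. x \<in> carrier M \<Longrightarrow> P (cls x)"
  shows "P t"
proof -
  have hr: "ring_hom_ring (monoid_ring M) quot ((+>\<^bsub>monoid_ring M\<^esub>) rel_ideal)"
    by (rule I.rcos_ring_hom_ring)
  interpret h: ring_hom_ring "monoid_ring M" quot "(+>\<^bsub>monoid_ring M\<^esub>) rel_ideal"
    by (rule hr)
  obtain u where u: "u \<in> carrier (monoid_ring M)" "t = rel_ideal +>\<^bsub>monoid_ring M\<^esub> u"
    using assms(1) unfolding FactRing_def A_RCOSETS_def' by auto
  have "Poly_Mapping.keys u \<subseteq> carrier M" using u(1) by (simp add: monoid_ring_simps)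
  then have "P (rel_ideal +>\<^bsub>monoid_ring M\<^esub> u)"
  proof (induction u rule: frag_induct)
    case zero
    then show ?case using assms(2) h.hom_zero by (simp add: monoid_ring_simps(4))
  next
    case (diff x y)
    have x: "x \<in> carrier (monoid_ring M)" and y: "y \<in> carrier (monoid_ring M)"
      using diff by (simp_all add: monoid_ring_simps)
    show ?case
      unfolding Z_diff[OF x y] a_minus_def
      using x y diff by (simp add: add minus)
  next
    case (frag_of a)
    then show ?case using cls by (simp add: cls_def)
  qed
  then show ?thesis using u by simp
qed

text \<open>The relations of both tensor products have only the two shapes \<open>z - x - y\<close>
  and \<open>x - y\<close>. A map that respects them extends to the free abelian group and kills
  \<open>rel_ideal\<close>, hence factors through the cosets. The factor is merely additive, because
  contractions with functionals do not respect products.\<close>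

lemma quot_universal:
  assumes G: "abelian_group G" and f: "\<And>x. x \<in> carrier M \<Longrightarrow> f x \<in> carrier G"
    and rels: "\<And>s. s \<in> S \<Longrightarrow>
        (\<exists>x y z. x \<in> carrier M \<and> y \<in> carrier M \<and> z \<in> carrier M \<and>
           s = frag_of z - frag_of x - frag_of y \<and> f z = f x \<oplus>\<^bsub>G\<^esub> f y) \<or>
        (\<exists>x y. x \<in> carrier M \<and> y \<in> carrier M \<and> s = frag_of x - frag_of y \<and> f x = f y)"
  shows "\<exists>T. T \<in> carrier quot \<rightarrow> carrier G \<and>
    (\<forall>s\<in>carrier quot. \<forall>t\<in>carrier quot. T (s \<oplus>\<^bsub>quot\<^esub> t) = T s \<oplus>\<^bsub>G\<^esub> T t) \<and>
    (\<forall>x\<in>carrier M. T (cls x) = f x)"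
proof -
  interpret G: abelian_group G by (rule G)
  obtain h where h: "h \<in> hom (free_Abelian_group (carrier M)) (add_monoid G)"
    "\<And>x. x \<in> carrier M \<Longrightarrow> h (frag_of x) = f x"
    using comm_group.free_Abelian_group_universal[OF G.a_comm_group, of f "carrier M"] f
    by (metis image_subsetI partial_object.select_convs(1))
  have h': "h \<in> hom (add_monoid (monoid_ring M)) (add_monoid G)"
    using h(1) unfolding add_monoid_monoid_ring[symmetric] .
  interpret h: group_hom "add_monoid (monoid_ring M)" "add_monoid G" h
    using h' by unfold_locales
  have hdiff: "h (u - v) = h u \<ominus>\<^bsub>G\<^esub> h v"
    if "u \<in> carrier (monoid_ring M)" "v \<in> carrier (monoid_ring M)" for u v
  proof -
    have "u - v \<in> carrier (monoid_ring M)"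
      unfolding Z_diff[OF that] using that by simp
    then have "h u = h (u - v) \<oplus>\<^bsub>G\<^esub> h v" "h (u - v) \<in> carrier G" "h v \<in> carrier G"
      using h.hom_mult[of "u - v" v] h.hom_closed[of "u - v"] h.hom_closed[of v] that
      by (simp_all add: monoid_ring_simps(5))
    then show ?thesis by (simp add: G.minus_eq G.a_assoc G.r_neg)
  qed
  have hS: "h s = \<zero>\<^bsub>G\<^esub>" if sS: "s \<in> S" for s
  proof -
    consider x y z where "x \<in> carrier M" "y \<in> carrier M" "z \<in> carrier M"
        "s = frag_of z - frag_of x - frag_of y" "f z = f x \<oplus>\<^bsub>G\<^esub> f y"
      | x y where "x \<in> carrier M" "y \<in> carrier M" "s = frag_of x - frag_of y" "f x = f y"
      using rels[OF sS] by blast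
    then show ?thesis
    proof cases
      case 1
      have "frag_of z - frag_of x \<in> carrier (monoid_ring M)"
        using 1 by (simp add: Z_diff frag_of_carrier)
      then have "h s = f z \<ominus>\<^bsub>G\<^esub> f x \<ominus>\<^bsub>G\<^esub> f y"
        using 1 by (simp add: hdiff frag_of_carrier h(2))
      then show ?thesis
        using 1(1,2,5) f[of x] f[of y]
        by (simp add: G.minus_eq G.a_comm[of "f x" "f y"] G.a_assoc G.r_neg)
    next
      case 2
      then show ?thesis using f[of y] by (simp add: hdiff frag_of_carrier h(2) G.minus_eq G.r_neg)
    qed
  qed
  have hI: "h s = \<zero>\<^bsub>G\<^esub>" if "s \<in> rel_ideal" for s
  proof -
    from that have "s \<in> carrier (monoid_ring M) \<and> h s = \<zero>\<^bsub>G\<^esub>"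
      unfolding rel_ideal_def
    proof (induction rule: generate.induct)
      case one
      then show ?case using h.hom_one by simp
    next
      case (incl s)
      then show ?case using hS S_carrier by auto
    next
      case (inv s)
      then have s: "s \<in> carrier (monoid_ring M)" "h s = \<zero>\<^bsub>G\<^esub>" using hS S_carrier by auto
      have inv: "inv\<^bsub>add_monoid (monoid_ring M)\<^esub> s = \<ominus>\<^bsub>monoid_ring M\<^esub> s"
        by (simp only: a_inv_def)
      have "h (\<ominus>\<^bsub>monoid_ring M\<^esub> s) = \<ominus>\<^bsub>G\<^esub> h s"
        using h.hom_inv[of s] s unfolding inv by (simp add: a_inv_def[of G])
      then show ?case unfolding inv using s by simp
    next
      case (eng s t)
      then show ?case using h.hom_mult[of s t] by simp
    qed
    then show ?thesis by simp
  qed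
  \<comment> \<open>The value of \<open>h\<close> at an arbitrary representative of the coset; the
    choice is immaterial because \<open>h\<close> vanishes on \<open>rel_ideal\<close>.\<close>
  define T where "T c = (SOME z. \<exists>u. u \<in> c \<and> z = h u)" for c
  have T: "T (rel_ideal +>\<^bsub>monoid_ring M\<^esub> u) = h u" if u: "u \<in> carrier (monoid_ring M)" for u
  proof -
    have in_c: "u \<in> rel_ideal +>\<^bsub>monoid_ring M\<^esub> u"
      using u by (rule I.a_rcos_self)
    have same: "h v = h u" if v: "v \<in> rel_ideal +>\<^bsub>monoid_ring M\<^esub> u" for v
    proof -
      obtain i where i: "i \<in> rel_ideal" "v = i \<oplus>\<^bsub>monoid_ring M\<^esub> u"
        using v unfolding a_r_coset_def' by auto
      then show ?thesis
        using h.hom_mult[of i u] hI[OF i(1)] u rel_ideal_carrier h.hom_closed[of u] by auto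
    qed
    show ?thesis unfolding T_def
      by (rule someI2[of _ "h u"]) (use in_c same in blast)+
  qed
  have repr: "\<exists>u\<in>carrier (monoid_ring M). c = rel_ideal +>\<^bsub>monoid_ring M\<^esub> u" if "c \<in> carrier quot" for c
    using that unfolding FactRing_def A_RCOSETS_def' by auto
  have "T \<in> carrier quot \<rightarrow> carrier G"
  proof
    fix c assume "c \<in> carrier quot"
    then obtain u where "u \<in> carrier (monoid_ring M)" "c = rel_ideal +>\<^bsub>monoid_ring M\<^esub> u"
      using repr by auto
    then show "T c \<in> carrier G" using T h.hom_closed by simp
  qed
  moreover have "T (c \<oplus>\<^bsub>quot\<^esub> d) = T c \<oplus>\<^bsub>G\<^esub> T d" if cd: "c \<in> carrier quot" "d \<in> carrier quot" for c d
  proof -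
    obtain u where u: "u \<in> carrier (monoid_ring M)" "c = rel_ideal +>\<^bsub>monoid_ring M\<^esub> u"
      using repr[OF cd(1)] by blast
    obtain v where v: "v \<in> carrier (monoid_ring M)" "d = rel_ideal +>\<^bsub>monoid_ring M\<^esub> v"
      using repr[OF cd(2)] by blast
    have "c \<oplus>\<^bsub>quot\<^esub> d = rel_ideal +>\<^bsub>monoid_ring M\<^esub> (u \<oplus>\<^bsub>monoid_ring M\<^esub> v)"
      using ring_hom_add[OF coset_hom u(1) v(1)] u v by simp
    then show ?thesis
      using T[OF u(1)] T[OF v(1)] T[OF Z.a_closed[OF u(1) v(1)]] h.hom_mult[of u v] u v by simp
  qed
  moreover have "\<forall>x\<in>carrier M. T (cls x) = f x"
    using T h(2) frag_of_carrier by (simp add: cls_def)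
  ultimately show ?thesis by blast
qed

end

section \<open>Linear functionals\<close>

text \<open>Functionals are kept as maps of the field into itself, and values in \<open>F\<close>
  are required separately where they matter. In this form they can be applied inside a tensor
  factor.\<close>

definition (in ring) linear_on :: "'a set \<Rightarrow> ('a \<Rightarrow> 'a) \<Rightarrow> bool"
  where "linear_on F f \<longleftrightarrow> f \<in> carrier R \<rightarrow> carrier R \<and>
    (\<forall>x\<in>carrier R. \<forall>y\<in>carrier R. f (x \<oplus> y) = f x \<oplus> f y) \<and>
    (\<forall>k\<in>F. \<forall>x\<in>carrier R. f (k \<otimes> x) = k \<otimes> f x)"

lemma (in ring) linear_onD:
  assumes "linear_on F f"
  shows "x \<in> carrier R \<Longrightarrow> f x \<in> carrier R"
    and "x \<in> carrier R \<Longrightarrow> y \<in> carrier R \<Longrightarrow> f (x \<oplus> y) = f x \<oplus> f y"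
    and "k \<in> F \<Longrightarrow> x \<in> carrier R \<Longrightarrow> f (k \<otimes> x) = k \<otimes> f x"
  using assms by (auto simp: linear_on_def)

lemma (in ring) linear_on_mono: "linear_on F f \<Longrightarrow> K \<subseteq> F \<Longrightarrow> linear_on K f"
  by (auto simp: linear_on_def)

lemma (in ring) subalgebraE:
  assumes "subalgebra F V R"
  shows "V \<subseteq> carrier R" "\<zero> \<in> V"
    and "x \<in> V \<Longrightarrow> y \<in> V \<Longrightarrow> x \<oplus> y \<in> V"
    and "x \<in> V \<Longrightarrow> \<ominus> x \<in> V"
    and "x \<in> V \<Longrightarrow> y \<in> V \<Longrightarrow> x \<ominus> y \<in> V"
    and "k \<in> F \<Longrightarrow> x \<in> V \<Longrightarrow> k \<otimes> x \<in> V"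
  using subgroup.subset[OF subalgebra.axioms(1)[OF assms]]
    subgroup.one_closed[OF subalgebra.axioms(1)[OF assms]]
    subgroup.m_closed[OF subalgebra.axioms(1)[OF assms]]
    subgroup.m_inv_closed[OF subalgebra.axioms(1)[OF assms]]
    subalgebra.smult_closed[OF assms]
  by (auto simp: a_inv_def a_minus_def)

text \<open>A \<open>subalgebra\<close> in this sense is just an \<open>F\<close>-subspace. Closure
  under negation comes from the scalar \<open>\<ominus> \<one>\<close>, so only sums and multiples
  have to be checked.\<close>

lemma (in ring) subalgebraI:
  assumes "V \<subseteq> carrier R" "\<zero> \<in> V" "F \<subseteq> carrier R" "\<ominus> \<one> \<in> F"
    and "\<And>x y. x \<in> V \<Longrightarrow> y \<in> V \<Longrightarrow> x \<oplus> y \<in> V"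
    and "\<And>k x. k \<in> F \<Longrightarrow> x \<in> V \<Longrightarrow> k \<otimes> x \<in> V"
  shows "subalgebra F V R"
proof (intro subalgebra.intro subalgebra_axioms.intro)
  have "\<ominus> x \<in> V" if "x \<in> V" for x
    using assms(6)[OF assms(4) that] assms(1) that by (auto simp: l_minus)
  then show "subgroup V (add_monoid R)"
    using assms by (intro add.subgroupI) (auto simp: a_inv_def)
qed (rule assms)

text \<open>Zorn's lemma gives a maximal subspace \<open>W\<close> containing \<open>V\<close> and
  avoiding \<open>y\<close>. It has codimension one: for \<open>x\<close> outside \<open>W\<close>,
  the space spanned by \<open>x\<close> and \<open>W\<close> contains \<open>y\<close>, say
  \<open>y = k x + w\<close>, where \<open>k\<close> is nonzero because \<open>y\<close> is not in
  \<open>W\<close>; so \<open>x\<close> is congruent to a multiple of \<open>y\<close>.\<close>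

lemma (in field) exists_maximal_complement:
  assumes F: "subfield F R" and V: "subalgebra F V R" and y: "y \<in> carrier R" "y \<notin> V"
  obtains W where "subalgebra F W R" "V \<subseteq> W" "y \<notin> W"
    "\<And>x. x \<in> carrier R \<Longrightarrow> \<exists>c\<in>F. x \<ominus> c \<otimes> y \<in> W"
proof -
  define A where "A = {W. subalgebra F W R \<and> V \<subseteq> W \<and> y \<notin> W}"
  have Fc: "F \<subseteq> carrier R" and m1: "\<ominus> \<one> \<in> F"
    using subfieldE(3)[OF F] subringE(3,5)[OF subfieldE(1)[OF F]] by auto
  have "\<exists>M\<in>A. \<forall>U\<in>A. M \<subseteq> U \<longrightarrow> U = M"
  proof (rule subset_Zorn_nonempty)
    show "A \<noteq> {}" using V y by (auto simp: A_def)
    fix C assume C: "C \<noteq> {}" "subset.chain A C"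
    then have CA: "C \<subseteq> {W. subalgebra F W R \<and> V \<subseteq> W \<and> y \<notin> W}" and tot: "\<And>U Y. U \<in> C \<Longrightarrow> Y \<in> C \<Longrightarrow> U \<subseteq> Y \<or> Y \<subseteq> U"
      by (auto simp: subset_chain_def A_def)
    have "subalgebra F (\<Union>C) R"
    proof (rule subalgebraI[OF _ _ Fc m1])
      show "\<Union>C \<subseteq> carrier R" using CA subalgebraE(1) by blast
      show "\<zero> \<in> \<Union>C" using CA C(1) subalgebraE(2) by blast
      show "x \<oplus> z \<in> \<Union>C" if xz: "x \<in> \<Union>C" "z \<in> \<Union>C" for x z
      proof -
        obtain U Z where XZ: "U \<in> C" "x \<in> U" "Z \<in> C" "z \<in> Z" using xz by blast
        then have "x \<oplus> z \<in> U \<or> x \<oplus> z \<in> Z"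
          using tot[of U Z] CA subalgebraE(3)[of F U x z] subalgebraE(3)[of F Z x z] by blast
        then show ?thesis using XZ by blast
      qed
      show "k \<otimes> x \<in> \<Union>C" if "k \<in> F" "x \<in> \<Union>C" for k x
        using that CA subalgebraE(6)[of F _ k x] by blast
    qed
    then show "\<Union>C \<in> A" using CA C(1) by (auto simp: A_def)
  qed
  then obtain W where WA: "W \<in> A" and mx: "\<forall>U\<in>A. W \<subseteq> U \<longrightarrow> U = W" ..
  from WA have W: "subalgebra F W R" "V \<subseteq> W" "y \<notin> W" by (auto simp: A_def)
  have max: "U = W" if "subalgebra F U R" "V \<subseteq> U" "y \<notin> U" "W \<subseteq> U" for U
    using mx that by (simp add: A_def)
  note W' = subalgebraE[OF W(1)]
  have "\<exists>c\<in>F. x \<ominus> c \<otimes> y \<in> W" if x: "x \<in> carrier R" for x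
  proof (cases "x \<in> W")
    case True
    then show ?thesis
      using x y subringE(2)[OF subfieldE(1)[OF F]] by (intro bexI[of _ \<zero>]) (auto simp: a_minus_def)
  next
    case False
    let ?U = "line_extension F x W"
    have mem: "a \<in> ?U \<longleftrightarrow> (\<exists>k\<in>F. \<exists>w\<in>W. a = k \<otimes> x \<oplus> w)" for a
      by (rule line_extension_mem_iff)
    have U: "subalgebra F ?U R"
      using line_extension_is_subgroup[OF F subalgebra.axioms(1)[OF W(1)] x]
        line_extension_smult_closed[OF F W'(6) W'(1) x]
      by (intro subalgebra.intro subalgebra_axioms.intro) blast+
    have WX: "W \<subseteq> ?U"
    proof
      fix w assume w: "w \<in> W"
      have "w = \<zero> \<otimes> x \<oplus> w" using x w W' by auto
      then show "w \<in> ?U" using w subringE(2)[OF subfieldE(1)[OF F]] mem by blast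
    qed
    have "x = \<one> \<otimes> x \<oplus> \<zero>" using x by simp
    then have "x \<in> ?U" using W'(2) subringE(3)[OF subfieldE(1)[OF F]] mem by blast
    then have "y \<in> ?U" using max[OF U] WX W(2) False by blast
    then obtain k w where kw: "k \<in> F" "w \<in> W" "y = k \<otimes> x \<oplus> w" using mem by blast
    have "k \<noteq> \<zero>" using kw W x W' by auto
    then have k: "inv k \<in> F" "inv k \<in> carrier R" "inv k \<otimes> k = \<one>" "k \<in> carrier R"
      using subfield_m_inv[OF F, of k] kw Fc by auto
    have w: "w \<in> carrier R" using kw W' by blast
    have "inv k \<otimes> y = (inv k \<otimes> k) \<otimes> x \<oplus> inv k \<otimes> w"
      unfolding kw(3) using k(2,4) w x by algebra
    then have "inv k \<otimes> y = x \<oplus> inv k \<otimes> w" using k(3) x by simp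
    then have "x \<ominus> inv k \<otimes> y = x \<ominus> (x \<oplus> inv k \<otimes> w)" by simp
    also have "\<dots> = \<ominus> (inv k \<otimes> w)" using k(2) w x by algebra
    finally have "x \<ominus> inv k \<otimes> y = \<ominus> (inv k \<otimes> w)" .
    then show ?thesis using kw k W'(4,6) by (intro bexI[of _ "inv k"]) auto
  qed
  then show ?thesis using that W by blast
qed

text \<open>The value at \<open>x\<close> is the coefficient \<open>c\<close> for which
  \<open>x - c y\<close> lies in the maximal complement \<open>W\<close>. Two such coefficients
  would put a nonzero multiple of \<open>y\<close>, and hence \<open>y\<close>, into
  \<open>W\<close>; linearity and the prescribed values all follow from this uniqueness.\<close>

lemma (in field) exists_functional:
  assumes F: "subfield F R" and V: "subalgebra F V R" and y: "y \<in> carrier R" "y \<notin> V"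
  obtains f where "linear_on F f" "f \<in> carrier R \<rightarrow> F" "\<And>v. v \<in> V \<Longrightarrow> f v = \<zero>" "f y = \<one>"
proof -
  obtain W where W: "subalgebra F W R" "V \<subseteq> W" "y \<notin> W"
    and c: "\<And>x. x \<in> carrier R \<Longrightarrow> \<exists>c\<in>F. x \<ominus> c \<otimes> y \<in> W"
    using exists_maximal_complement[OF assms] by metis
  note W' = subalgebraE[OF W(1)]
  have Fc: "F \<subseteq> carrier R" and Fs: "subring F R"
    using subfieldE[OF F] by auto
  obtain f where f: "\<And>x. x \<in> carrier R \<Longrightarrow> f x \<in> F" "\<And>x. x \<in> carrier R \<Longrightarrow> x \<ominus> f x \<otimes> y \<in> W"
    using c by metis
  have unique: "f x = a" if x: "x \<in> carrier R" and a: "a \<in> F" "x \<ominus> a \<otimes> y \<in> W" for x a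
  proof (rule ccontr)
    assume ne: "f x \<noteq> a"
    have fa: "f x \<in> carrier R" "a \<in> carrier R" using f(1)[OF x] a Fc by auto
    let ?k = "f x \<ominus> a"
    have k: "?k \<in> F" "?k \<noteq> \<zero>" "?k \<in> carrier R"
      using f(1)[OF x] a(1) subringE(5,7)[OF Fs] r_right_minus_eq[OF fa] ne fa
      by (simp_all add: a_minus_def)
    have "(x \<ominus> a \<otimes> y) \<ominus> (x \<ominus> f x \<otimes> y) = ?k \<otimes> y"
      using fa x y by algebra
    then have "?k \<otimes> y \<in> W" using W'(5)[OF a(2) f(2)[OF x]] by simp
    moreover have i: "inv ?k \<in> F" "inv ?k \<otimes> ?k = \<one>"
      using subfield_m_inv[OF F, of ?k] k by auto
    ultimately have "inv ?k \<otimes> (?k \<otimes> y) \<in> W" using W'(6) by blast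
    moreover have "inv ?k \<otimes> (?k \<otimes> y) = y"
      using m_assoc[of "inv ?k" ?k y] i k y Fc by auto
    ultimately show False using W by simp
  qed
  have fc: "f x \<in> carrier R" if "x \<in> carrier R" for x using f(1)[OF that] Fc by blast
  have "linear_on F f"
    unfolding linear_on_def
  proof (intro conjI ballI)
    show "f \<in> carrier R \<rightarrow> carrier R" using fc by blast
    fix x z assume xz: "x \<in> carrier R" "z \<in> carrier R"
    have "(x \<oplus> z) \<ominus> (f x \<oplus> f z) \<otimes> y = (x \<ominus> f x \<otimes> y) \<oplus> (z \<ominus> f z \<otimes> y)"
      using xz y fc[OF xz(1)] fc[OF xz(2)] by algebra
    then show "f (x \<oplus> z) = f x \<oplus> f z"
      using W'(3)[OF f(2)[OF xz(1)] f(2)[OF xz(2)]] subringE(7)[OF Fs f(1)[OF xz(1)] f(1)[OF xz(2)]] xz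
      by (intro unique) auto
  next
    fix k x assume kx: "k \<in> F" "x \<in> carrier R"
    have "(k \<otimes> x) \<ominus> (k \<otimes> f x) \<otimes> y = k \<otimes> (x \<ominus> f x \<otimes> y)"
      using kx y fc[OF kx(2)] Fc by (simp add: subset_iff) algebra
    then show "f (k \<otimes> x) = k \<otimes> f x"
      using W'(6)[OF kx(1) f(2)[OF kx(2)]] subringE(6)[OF Fs kx(1) f(1)[OF kx(2)]] kx Fc
      by (intro unique) auto
  qed
  moreover have "f v = \<zero>" if "v \<in> V" for v
  proof -
    have "v \<in> W" "v \<in> carrier R" using that W(2) W'(1) by auto
    then show ?thesis using y subringE(2)[OF Fs] by (intro unique) (auto simp: a_minus_def)
  qed
  moreover have "f y = \<one>"
    using y subringE(3)[OF Fs] W'(2) by (intro unique) (auto simp: a_minus_def r_neg)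
  ultimately show ?thesis using that f(1) by blast
qed

section \<open>The Frobenius map\<close>

lemma (in cring) binomial_expansion:
  assumes "a \<in> carrier R" "b \<in> carrier R"
  shows "(a \<oplus> b) [^] (n::nat) = (\<Oplus>k\<in>{..n}. add_pow R (n choose k) (a [^] k \<otimes> b [^] (n - k)))"
proof (induction n)
  case 0
  then show ?case using assms by simp
next
  case (Suc n)
  let ?t = "\<lambda>k. a [^] k \<otimes> b [^] (Suc n - k)"
  let ?S = "\<Oplus>k\<in>{..n}. add_pow R (n choose k) (a [^] k \<otimes> b [^] (n - k))"
  let ?g = "\<lambda>k. add_pow R (n choose k) (?t k)"
  note cl = assms
  have Sc: "?S \<in> carrier R" using cl by (intro finsum_closed) auto
  have A: "?S \<otimes> a = (\<Oplus>k\<in>{..n}. add_pow R (n choose k) (?t (Suc k)))"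
    using cl by (subst finsum_ldistr) (auto intro!: finsum_cong' simp: add_pow_ldistr add_pow_rdistr m_ac)
  have "?S \<otimes> b = (\<Oplus>k\<in>{..n}. ?g k)"
    using cl by (subst finsum_ldistr)
      (auto intro!: finsum_cong' simp: add_pow_ldistr m_assoc Suc_diff_le)
  also have "\<dots> = (\<Oplus>k\<in>{..Suc n}. ?g k)"
    using cl by (subst finsum_Suc) (auto simp: binomial_eq_0)
  also have "\<dots> = (\<Oplus>k\<in>{..n}. ?g (Suc k)) \<oplus> ?g 0"
    using cl by (subst finsum_Suc2) auto
  finally have B: "?S \<otimes> b = (\<Oplus>k\<in>{..n}. ?g (Suc k)) \<oplus> ?g 0" .
  have "(\<Oplus>k\<in>{..Suc n}. add_pow R (Suc n choose k) (?t k))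
      = (\<Oplus>k\<in>{..n}. add_pow R (Suc n choose Suc k) (?t (Suc k))) \<oplus> ?g 0"
    using cl by (subst finsum_Suc2) auto
  also have "(\<Oplus>k\<in>{..n}. add_pow R (Suc n choose Suc k) (?t (Suc k)))
      = (\<Oplus>k\<in>{..n}. add_pow R (n choose k) (?t (Suc k)) \<oplus> ?g (Suc k))"
    using cl by (intro finsum_cong') (auto simp: add.nat_pow_mult)
  also have "\<dots> = ?S \<otimes> a \<oplus> (\<Oplus>k\<in>{..n}. ?g (Suc k))"
    unfolding A using cl by (subst finsum_addf) auto
  finally have "(\<Oplus>k\<in>{..Suc n}. add_pow R (Suc n choose k) (?t k)) = ?S \<otimes> a \<oplus> ?S \<otimes> b"
    unfolding B using cl Sc
    by (simp add: a_assoc finsum_closed del: binomial_Suc_Suc nat_pow_Suc)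
  then show ?case using Suc cl Sc by (simp add: r_distr)
qed

lemma (in cring) char_add_pow:
  fixes p :: nat
  assumes "add_pow R p \<one> = \<zero>" "x \<in> carrier R" "p dvd m"
  shows "add_pow R m x = \<zero>"
proof -
  have "(add_pow R p \<one>) \<otimes> x = add_pow R p (\<one> \<otimes> x)"
    using assms(2) by (intro add_pow_ldistr) auto
  then have "add_pow R p x = \<zero>" using assms by simp
  moreover obtain k where "m = p * k" using assms(3) by blast
  ultimately show ?thesis
    using assms(2) add.nat_pow_pow[OF assms(2), of k p] by simp
qed

lemma (in cring) freshman:
  assumes p: "Factorial_Ring.prime (p::nat)" "add_pow R p \<one> = \<zero>" and ab: "a \<in> carrier R" "b \<in> carrier R"
  shows "(a \<oplus> b) [^] p = a [^] p \<oplus> b [^] p"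
proof -
  \<comment> \<open>Writing \<open>p\<close> as \<open>r + 2\<close> allows both end terms of the
    binomial sum to be split off; the \<open>r + 1\<close> terms in between are the ones whose
    coefficient is divisible by \<open>p\<close>.\<close>
  obtain r where r: "p = Suc (Suc r)"
    using prime_ge_2_nat[OF p(1)] by (metis Suc_le_D numeral_2_eq_2 Suc_le_mono)
  let ?f = "\<lambda>k. add_pow R (p choose k) (a [^] k \<otimes> b [^] (p - k))"
  have z: "?f (Suc k) = \<zero>" if "k \<le> r" for k
    using that r ab p by (intro char_add_pow[OF p(2)] dvd_choose_prime) auto
  have "(a \<oplus> b) [^] p = (\<Oplus>k\<in>{..Suc (Suc r)}. ?f k)"
    using binomial_expansion[OF ab, of p] r by simp
  also have "\<dots> = ?f (Suc (Suc r)) \<oplus> (\<Oplus>k\<in>{..Suc r}. ?f k)"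
    using ab by (subst finsum_Suc) auto
  also have "(\<Oplus>k\<in>{..Suc r}. ?f k) = (\<Oplus>k\<in>{..r}. ?f (Suc k)) \<oplus> ?f 0"
    using ab by (subst finsum_Suc2) auto
  also have "(\<Oplus>k\<in>{..r}. ?f (Suc k)) = (\<Oplus>k\<in>{..r}. \<zero>)"
    by (intro finsum_cong' refl z) auto
  also have "\<dots> = \<zero>" by simp
  also have "?f (Suc (Suc r)) = a [^] p" using ab r by simp
  also have "?f 0 = b [^] p" using ab by simp
  finally show ?thesis using ab by simp
qed

text \<open>Deduced from additivity rather than from the sign \<open>(-1)^p\<close>, so that
  \<open>p = 2\<close> is not a separate case.\<close>

lemma (in cring) frobenius_minus:
  assumes p: "Factorial_Ring.prime (p::nat)" "add_pow R p \<one> = \<zero>" and a: "a \<in> carrier R"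
  shows "(\<ominus> a) [^] p = \<ominus> (a [^] p)"
proof -
  have "(\<ominus> a) [^] p \<oplus> a [^] p = (\<ominus> a \<oplus> a) [^] p"
    using freshman[OF p, of "\<ominus> a" a] a by simp
  also have "\<dots> = \<zero>"
    using a prime_gt_0_nat[OF p(1)] by (simp add: l_neg nat_pow_zero)
  finally show ?thesis using a by (simp add: minus_equality)
qed

lemma (in cring) frobenius_combine:
  assumes p: "Factorial_Ring.prime (p::nat)" "add_pow R p \<one> = \<zero>"
    and "set as \<subseteq> carrier R" "set us \<subseteq> carrier R"
  shows "combine as us [^] p = combine (map (\<lambda>x. x [^] p) as) (map (\<lambda>x. x [^] p) us)"
  using assms(3,4)
proof (induction as us rule: combine.induct)
  case (1 k Ks u Us)
  then show ?case using freshman[OF p, of "k \<otimes> u" "combine Ks Us"] by (simp add: nat_pow_distrib)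
qed (use prime_gt_0_nat[OF p(1)] in \<open>auto simp: nat_pow_zero\<close>)

section \<open>Linear disjointness\<close>

text \<open>Relative to an arbitrary subset: it is applied to subrings, but also to sets such as
  \<open>polys B x k\<close>, which are closed under addition only.\<close>

definition (in ring) no_nilpotents :: "'a set \<Rightarrow> bool"
  where "no_nilpotents S \<longleftrightarrow> (\<forall>x\<in>S. \<forall>n::nat. x [^] n = \<zero> \<longrightarrow> x = \<zero>)"

lemma (in ring) no_nilpotentsD: "no_nilpotents S \<Longrightarrow> x \<in> S \<Longrightarrow> x [^] (n::nat) = \<zero> \<Longrightarrow> x = \<zero>"
  by (auto simp: no_nilpotents_def)

lemma (in ring) no_nilpotents_mono: "no_nilpotents S \<Longrightarrow> T \<subseteq> S \<Longrightarrow> no_nilpotents T"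
  by (auto simp: no_nilpotents_def)

lemma (in ring) no_nilpotents_carrier: "no_nilpotents (carrier R) \<longleftrightarrow> reduced_ring R"
  by (auto simp: no_nilpotents_def reduced_ring_def)

lemma (in monoid) nat_pow_mult_le: "x \<in> carrier G \<Longrightarrow> (m::nat) \<le> n \<Longrightarrow> x [^] n = x [^] m \<otimes> x [^] (n - m)"
  by (simp add: nat_pow_mult)

text \<open>If \<open>x^n = 0\<close>, then \<open>x^(p^n) = 0\<close> because
  \<open>n \<le> p^n\<close>, and the \<open>n\<close> exponents \<open>p\<close> can be removed one
  after the other. So only \<open>p\<close>-th powers need to be examined, where the Frobenius map
  applies.\<close>

lemma (in ring) no_nilpotentsI:
  fixes p :: nat
  assumes "S \<subseteq> carrier R" "\<And>x. x \<in> S \<Longrightarrow> x [^] p \<in> S" "\<And>x. x \<in> S \<Longrightarrow> x [^] p = \<zero> \<Longrightarrow> x = \<zero>" "p \<ge> 2"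
  shows "no_nilpotents S"
  unfolding no_nilpotents_def
proof (intro ballI allI impI)
  fix x and n :: nat assume x: "x \<in> S" "x [^] n = \<zero>"
  have pows: "x [^] (p ^ k) \<in> S" for k
  proof (induction k)
    case (Suc k)
    have "x [^] (p ^ Suc k) = (x [^] (p ^ k)) [^] p"
      using x(1) assms(1) by (simp add: nat_pow_pow mult.commute subset_iff)
    then show ?case using assms(2)[OF Suc] by simp
  qed (use x assms(1) in auto)
  have "x = \<zero>" if "x [^] (p ^ k) = \<zero>" for k
    using that
  proof (induction k)
    case (Suc k)
    have "x [^] (p ^ Suc k) = (x [^] (p ^ k)) [^] p"
      using x(1) assms(1) by (simp add: nat_pow_pow mult.commute subset_iff)
    then have "x [^] (p ^ k) = \<zero>" using assms(3)[OF pows] Suc.prems by simp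
    then show ?case by (rule Suc.IH)
  qed (use x assms(1) in auto)
  moreover have "x [^] (p ^ n) = \<zero>"
  proof -
    have "n \<le> p ^ n" using assms(4) by (meson less_exp less_imp_le order_trans power_mono zero_le)
    then show ?thesis using nat_pow_mult_le[of x n "p ^ n"] x assms(1) by auto
  qed
  ultimately show "x = \<zero>" by blast
qed

lemma (in ring_hom_ring) hom_add_pow_one: "h (add_pow R (n::nat) \<one>\<^bsub>R\<^esub>) = add_pow S n \<one>\<^bsub>S\<^esub>"
  by (induction n) simp_all

text \<open>
  This is what remains of \<open>R = L \<otimes>\<^sub>K A\<close> once the construction is forgotten: the assumption
  \<open>contract\<close> says that \<open>f \<otimes> id\<close> is well defined for \<open>K\<close>-linear \<open>f\<close>.
\<close>

locale linearly_disjoint = R: cring R + L: field L for R (structure) and L +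
  fixes K :: "'c set" and \<iota> :: "'c \<Rightarrow> 'a" and A :: "'a set"
  assumes K: "subfield K L"
    and \<iota>_hom: "\<iota> \<in> ring_hom L R"
    and A: "subring A R"
    and \<iota>_K: "\<iota> ` K \<subseteq> A"
    and contract: "ring.linear_on L K f \<Longrightarrow>
      \<exists>T. T \<in> carrier R \<rightarrow> carrier R \<and>
        (\<forall>s\<in>carrier R. \<forall>t\<in>carrier R. T (s \<oplus> t) = T s \<oplus> T t) \<and>
        (\<forall>l\<in>carrier L. \<forall>a\<in>A. T (\<iota> l \<otimes> a) = \<iota> (f l) \<otimes> a)"
begin

sublocale \<iota>: ring_hom_ring L R \<iota>
  by (rule ring_hom_ringI2[OF L.ring_axioms R.ring_axioms \<iota>_hom])

lemmas A_carrier = subringE(1)[OF A]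

text \<open>Finite sums of products from the image of \<open>F\<close> and from \<open>A\<close>.
  For a subfield \<open>F\<close> containing \<open>K\<close> this stands for the image of the
  tensor product of \<open>F\<close> and \<open>A\<close> over \<open>K\<close>; negatives are
  absorbed by \<open>A\<close>.\<close>

inductive_set compositum :: "'c set \<Rightarrow> 'a set" for F :: "'c set"
  where zero: "\<zero> \<in> compositum F"
  | step: "l \<in> F \<Longrightarrow> a \<in> A \<Longrightarrow> s \<in> compositum F \<Longrightarrow> \<iota> l \<otimes> a \<oplus> s \<in> compositum F"

lemma compositum_carrier:
  assumes "F \<subseteq> carrier L"
  shows "compositum F \<subseteq> carrier R"
proof
  fix s assume "s \<in> compositum F"
  then show "s \<in> carrier R"
    by induction (use assms A_carrier in \<open>auto simp: subset_iff\<close>)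
qed

lemma compositum_mono: "F \<subseteq> G \<Longrightarrow> compositum F \<subseteq> compositum G"
proof
  fix s assume FG: "F \<subseteq> G" and "s \<in> compositum F"
  from this(2) show "s \<in> compositum G"
    by induction (use FG in \<open>auto intro: compositum.intros\<close>)
qed

lemma compositum_product: "F \<subseteq> carrier L \<Longrightarrow> l \<in> F \<Longrightarrow> a \<in> A \<Longrightarrow> \<iota> l \<otimes> a \<in> compositum F"
  using compositum.step[OF _ _ compositum.zero, of l F a] A_carrier by (simp add: subset_iff)

lemma compositum_add:
  assumes "F \<subseteq> carrier L" "s \<in> compositum F" "t \<in> compositum F"
  shows "s \<oplus> t \<in> compositum F"
  using assms(2)
proof induction
  case zero
  then show ?case using assms(3) compositum_carrier[OF assms(1)] by (simp add: subset_iff)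
next
  case (step l a s)
  have c: "\<iota> l \<otimes> a \<in> carrier R" "s \<in> carrier R" "t \<in> carrier R"
    using step assms compositum_carrier[OF assms(1)] A_carrier by (auto simp: subset_iff)
  show ?case using compositum.step[OF step(1,2) step.IH] c by (simp add: R.a_assoc)
qed

lemma compositum_subring:
  assumes F: "subring F L"
  shows "subring (compositum F) R"
proof (rule R.subringI)
  note F' = subringE[OF F] and A' = subringE[OF A]
  show sub: "compositum F \<subseteq> carrier R" by (rule compositum_carrier) (rule F')
  show "\<one> \<in> compositum F"
    using compositum_product[OF F'(1) F'(3) A'(3)] by simp
  show "\<ominus> s \<in> compositum F" if "s \<in> compositum F" for s
    using that
  proof induction
    case zero
    then show ?case using compositum.zero by simp
  next
    case (step l a s)
    have c: "l \<in> carrier L" "a \<in> carrier R" "s \<in> carrier R"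
      using step sub F' A' by auto
    have "\<ominus> (\<iota> l \<otimes> a \<oplus> s) = \<iota> l \<otimes> (\<ominus> a) \<oplus> (\<ominus> s)"
      using c \<iota>.hom_closed[OF c(1)] by algebra
    then show ?case using compositum.step[OF step(1) A'(5)[OF step(2)] step.IH] by simp
  qed
  have prod: "\<iota> l \<otimes> a \<otimes> t \<in> compositum F" if la: "l \<in> F" "a \<in> A" and t: "t \<in> compositum F" for l a t
    using t
  proof induction
    case zero
    have "\<iota> l \<otimes> a \<in> carrier R" using la F'(1) A'(1) by (auto simp: subset_iff)
    then show ?case using compositum.zero by simp
  next
    case (step m b s)
    have c: "l \<in> carrier L" "a \<in> carrier R" "s \<in> carrier R" "m \<in> carrier L" "b \<in> carrier R"
      using step la sub F' A' by auto
    have "\<iota> l \<otimes> a \<otimes> (\<iota> m \<otimes> b \<oplus> s) = \<iota> (l \<otimes>\<^bsub>L\<^esub> m) \<otimes> (a \<otimes> b) \<oplus> (\<iota> l \<otimes> a \<otimes> s)"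
      unfolding \<iota>.hom_mult[OF c(1,4)]
      using c \<iota>.hom_closed[OF c(1)] \<iota>.hom_closed[OF c(4)] by algebra
    then show ?case
      using compositum.step[OF F'(6)[OF la(1) step(1)] A'(6)[OF la(2) step(2)] step.IH] by simp
  qed
  show "s \<otimes> t \<in> compositum F" if s: "s \<in> compositum F" and t: "t \<in> compositum F" for s t
    using s
  proof induction
    case zero
    then show ?case using compositum.zero t sub by auto
  next
    case (step l a s)
    have c: "\<iota> l \<otimes> a \<in> carrier R" "s \<in> carrier R" "t \<in> carrier R"
      using step t sub F'(1) A'(1) by (auto simp: subset_iff)
    show ?case
      unfolding R.l_distr[OF c] using prod[OF step(1,2) t] step.IH compositum_add[OF F'(1)] by blast
  qed
  show "s \<oplus> t \<in> compositum F" if "s \<in> compositum F" "t \<in> compositum F" for s t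
    by (rule compositum_add[OF F'(1) that])
qed

lemma A_compositum:
  assumes "subring F L"
  shows "A \<subseteq> compositum F"
proof
  fix a assume a: "a \<in> A"
  show "a \<in> compositum F"
    using compositum_product[OF subringE(1,3)[OF assms] a] a A_carrier by auto
qed

lemma \<iota>_compositum:
  assumes "subring F L" "l \<in> F"
  shows "\<iota> l \<in> compositum F"
  using compositum_product[OF subringE(1)[OF assms(1)] assms(2) subringE(3)[OF A]]
    subringE(1)[OF assms(1)] assms(2) by auto

lemma compositum_K: "compositum K = A"
proof
  show "A \<subseteq> compositum K" by (rule A_compositum[OF subfieldE(1)[OF K]])
  show "compositum K \<subseteq> A"
  proof
    fix s assume "s \<in> compositum K"
    then show "s \<in> A"
      by induction (use \<iota>_K subringE[OF A] in auto)
  qed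
qed

text \<open>If \<open>f\<close> is linear over an intermediate field, its contraction is linear over
  the compositum of that field with \<open>A\<close>, and not only over \<open>A\<close>. This
  allows the base field to grow inside a fixed ambient ring.\<close>

lemma contract_compositum:
  assumes F: "subring F L" "K \<subseteq> F" and f: "ring.linear_on L F f"
  obtains T where "T \<in> carrier R \<rightarrow> carrier R"
    "\<And>s t. s \<in> carrier R \<Longrightarrow> t \<in> carrier R \<Longrightarrow> T (s \<oplus> t) = T s \<oplus> T t" "T \<zero> = \<zero>"
    "\<And>l b. l \<in> carrier L \<Longrightarrow> b \<in> compositum F \<Longrightarrow> T (b \<otimes> \<iota> l) = b \<otimes> \<iota> (f l)"
proof -
  note Fc = subringE(1)[OF F(1)]
  obtain T where T: "T \<in> carrier R \<rightarrow> carrier R"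
    "\<And>s t. s \<in> carrier R \<Longrightarrow> t \<in> carrier R \<Longrightarrow> T (s \<oplus> t) = T s \<oplus> T t"
    "\<And>l a. l \<in> carrier L \<Longrightarrow> a \<in> A \<Longrightarrow> T (\<iota> l \<otimes> a) = \<iota> (f l) \<otimes> a"
    using contract[OF L.linear_on_mono[OF f F(2)]] by blast
  have T0: "T \<zero> = \<zero>"
  proof -
    have "T \<zero> \<in> carrier R" using T(1) by auto
    moreover have "T \<zero> \<oplus> T \<zero> = T \<zero> \<oplus> \<zero>" using T(2)[of \<zero> \<zero>] calculation by simp
    ultimately show ?thesis using R.add.l_cancel by blast
  qed
  have "T (b \<otimes> \<iota> l) = b \<otimes> \<iota> (f l)" if l: "l \<in> carrier L" and b: "b \<in> compositum F" for l b
    using b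
  proof induction
    case zero
    then show ?case using l T0 L.linear_onD(1)[OF f l] by simp
  next
    case (step k a s)
    have c: "k \<in> carrier L" "a \<in> carrier R" "s \<in> carrier R" "l \<in> carrier L" "f l \<in> carrier L"
      using step Fc A_carrier compositum_carrier[OF Fc] l L.linear_onD(1)[OF f l] by auto
    note hc = \<iota>.hom_closed[OF c(1)] \<iota>.hom_closed[OF c(4)] \<iota>.hom_closed[OF c(5)]
    have "(\<iota> k \<otimes> a \<oplus> s) \<otimes> \<iota> l = \<iota> (k \<otimes>\<^bsub>L\<^esub> l) \<otimes> a \<oplus> s \<otimes> \<iota> l"
      unfolding \<iota>.hom_mult[OF c(1,4)] using c hc by algebra
    then have "T ((\<iota> k \<otimes> a \<oplus> s) \<otimes> \<iota> l) = T (\<iota> (k \<otimes>\<^bsub>L\<^esub> l) \<otimes> a) \<oplus> T (s \<otimes> \<iota> l)"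
      using c hc by (simp add: T(2))
    also have "\<dots> = \<iota> (k \<otimes>\<^bsub>L\<^esub> f l) \<otimes> a \<oplus> s \<otimes> \<iota> (f l)"
      using T(3)[of "k \<otimes>\<^bsub>L\<^esub> l" a] c step L.linear_onD(3)[OF f step(1) l] by simp
    also have "\<dots> = (\<iota> k \<otimes> a \<oplus> s) \<otimes> \<iota> (f l)"
      unfolding \<iota>.hom_mult[OF c(1,5)] using c hc by algebra
    finally show ?case .
  qed
  then show ?thesis using that T T0 by blast
qed

text \<open>A functional that is one at \<open>u\<close> and zero on the span of the other entries
  contracts the relation to the coefficient of \<open>u\<close>, which must therefore vanish; the
  remaining relation is shorter.\<close>

lemma independent_over_compositum:
  assumes F: "subfield F L" "K \<subseteq> F" and us: "ring.independent L F us"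
    and bs: "set bs \<subseteq> compositum F" "length bs = length us"
    and zero: "R.combine bs (map \<iota> us) = \<zero>"
  shows "set bs \<subseteq> {\<zero>}"
  using us bs zero
proof (induction us arbitrary: bs rule: list.induct)
  case Nil
  then show ?case by simp
next
  case (Cons u us)
  note li_Cons = L.independent_backwards(3,1,2)[OF Cons.prems(1)]
  then obtain c cs where bs: "bs = c # cs" using Cons.prems(3) by (metis length_Suc_conv length_Cons)
  note Fs = subfieldE(1)[OF F(1)]
  have usc: "set us \<subseteq> carrier L" by (rule L.independent_in_carrier[OF li_Cons(3)])
  obtain f where f: "ring.linear_on L F f" "f \<in> carrier L \<rightarrow> F"
    "\<And>v. v \<in> L.Span F us \<Longrightarrow> f v = \<zero>\<^bsub>L\<^esub>" "f u = \<one>\<^bsub>L\<^esub>"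
    using L.exists_functional[OF F(1) L.Span_is_subalgebra[OF F(1) usc] li_Cons(1,2)] by metis
  obtain T where T: "T \<in> carrier R \<rightarrow> carrier R"
    "\<And>s t. s \<in> carrier R \<Longrightarrow> t \<in> carrier R \<Longrightarrow> T (s \<oplus> t) = T s \<oplus> T t" "T \<zero> = \<zero>"
    "\<And>l b. l \<in> carrier L \<Longrightarrow> b \<in> compositum F \<Longrightarrow> T (b \<otimes> \<iota> l) = b \<otimes> \<iota> (f l)"
    using contract_compositum[OF Fs F(2) f(1)] by metis
  note Cc = compositum_carrier[OF subringE(1)[OF Fs]]
  have kill: "T (R.combine cs (map \<iota> vs)) = \<zero>"
    if "set vs \<subseteq> carrier L \<inter> {v. f v = \<zero>\<^bsub>L\<^esub>}" "set cs \<subseteq> compositum F" for cs vs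
    using that
  proof (induction vs arbitrary: cs)
    case (Cons v vs)
    show ?case
    proof (cases cs)
      case (Cons c cs')
      have c: "c \<in> carrier R" "R.combine cs' (map \<iota> vs) \<in> carrier R" "v \<in> carrier L"
        using Cons.prems Cons Cc by (auto intro!: R.combine_in_carrier simp: subset_iff)
      show ?thesis
        using Cons.IH[of cs'] Cons.prems Cons c T(4)[of v c] by (simp add: T(2))
    qed (use T(3) in auto)
  qed (use T(3) in auto)
  have c: "c \<in> carrier R" "R.combine cs (map \<iota> us) \<in> carrier R"
    using Cons.prems bs Cc usc by (auto intro!: R.combine_in_carrier simp: subset_iff)
  have tail: "T (R.combine cs (map \<iota> us)) = \<zero>"
    by (rule kill) (use Cons.prems bs usc f(3) L.Span_base_incl[OF F(1) usc] in auto)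
  have "\<zero> = T (c \<otimes> \<iota> u \<oplus> R.combine cs (map \<iota> us))"
    using Cons.prems(4) T(3) by (simp add: bs)
  also have "\<dots> = T (c \<otimes> \<iota> u) \<oplus> T (R.combine cs (map \<iota> us))"
    by (rule T(2)) (use c li_Cons(1) in auto)
  also have "\<dots> = c"
    using T(4)[OF li_Cons(1), of c] c tail f(4) Cons.prems(2) by (simp add: bs)
  finally have "c = \<zero>" ..
  moreover have "set cs \<subseteq> {\<zero>}"
    using Cons.prems calculation li_Cons(1) c by (intro Cons.IH li_Cons(3)) (auto simp: bs)
  ultimately show ?case by (simp add: bs)
qed

text \<open>The products are inserted one at a time. A new factor \<open>l\<close> either extends
  the independent list or is a \<open>K\<close>-combination of it; in the second case its
  coefficients lie in the image of \<open>K\<close>, hence in \<open>A\<close>, and are merged with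
  those already present.\<close>

lemma compositum_independent_representation:
  assumes "s \<in> compositum (carrier L)"
  obtains as us where "set as \<subseteq> A" "length as = length us" "ring.independent L K us"
    "s = R.combine as (map \<iota> us)"
proof -
  have "\<exists>as us. set as \<subseteq> A \<and> length as = length us \<and> ring.independent L K us \<and> s = R.combine as (map \<iota> us)"
    using assms
  proof induction
    case zero
    then show ?case by (intro exI[of _ "[]"]) auto
  next
    case (step l a s)
    then obtain as us where s: "set as \<subseteq> A" "length as = length us" "ring.independent L K us"
      "s = R.combine as (map \<iota> us)" by blast
    have usc: "set us \<subseteq> carrier L" by (rule L.independent_in_carrier[OF s(3)])
    have asc: "set as \<subseteq> carrier R" using s(1) A_carrier by blast
    have ac: "a \<in> carrier R" using step A_carrier by blast
    show ?case
    proof (cases "l \<in> L.Span K us")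
      case False
      then have "ring.independent L K (l # us)" using step s by (intro L.li_Cons)
      then show ?thesis using step s
        by (intro exI[of _ "a # as"] exI[of _ "l # us"]) (auto simp: R.m_comm ac)
    next
      case True
      then obtain ks where ks: "set ks \<subseteq> K" "length ks = length us" "l = L.combine ks us"
        using L.Span_mem_iff_length_version[OF K usc] by blast
      have ksc: "set ks \<subseteq> carrier L" using ks(1) subfieldE(3)[OF K] by blast
      let ?bs = "map ((\<otimes>) a) (map \<iota> ks)"
      have bs: "set ?bs \<subseteq> A" using ks(1) \<iota>_K step(2) subringE(6)[OF A] by auto
      have "\<iota> l \<otimes> a = a \<otimes> R.combine (map \<iota> ks) (map \<iota> us)"
        unfolding ks(3) \<iota>.combine_hom[OF ksc usc] using L.combine_in_carrier[OF ksc usc] ac by (simp add: R.m_comm)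
      also have "\<dots> = R.combine ?bs (map \<iota> us)"
        by (rule R.combine_r_distr) (use ksc usc ac in auto)
      finally have "\<iota> l \<otimes> a \<oplus> s = R.combine (map2 (\<oplus>) ?bs as) (map \<iota> us)"
        unfolding s(4) using ks(2) s(2) bs A_carrier asc usc
        by (simp only:) (rule R.combine_add, auto)
      moreover have "set (map2 (\<oplus>) ?bs as) \<subseteq> A"
      proof
        fix x assume "x \<in> set (map2 (\<oplus>) ?bs as)"
        then obtain y z where yz: "(y, z) \<in> set (zip ?bs as)" "x = y \<oplus> z" by (auto simp del: map_map)
        then have "y \<in> A" "z \<in> A"
          using set_zip_leftD[OF yz(1)] set_zip_rightD[OF yz(1)] bs s(1) by blast+
        then show "x \<in> A" using subringE(7)[OF A] yz(2) by blast
      qed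
      ultimately show ?thesis using s ks(2)
        by (intro exI[of _ "map2 (\<oplus>) ?bs as"] exI[of _ us]) simp
    qed
  qed
  then show ?thesis using that by blast
qed

text \<open>
  A \<open>p\<close>-th power \<open>(\<Sum> u\<^sub>i a\<^sub>i)\<^sup>p = \<Sum> u\<^sub>i\<^sup>p a\<^sub>i\<^sup>p\<close> vanishes only if all \<open>a\<^sub>i\<^sup>p\<close> do, as the \<open>u\<^sub>i\<^sup>p\<close> stay independent.
\<close>

theorem compositum_reduced_char_p:
  fixes p :: nat
  assumes p: "Factorial_Ring.prime p" "add_pow L p \<one>\<^bsub>L\<^esub> = \<zero>\<^bsub>L\<^esub>"
    and maclane: "\<And>us. ring.independent L K us \<Longrightarrow> ring.independent L K (map (\<lambda>x. x [^]\<^bsub>L\<^esub> p) us)"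
    and Ared: "R.no_nilpotents A"
  shows "R.no_nilpotents (compositum (carrier L))"
proof (rule R.no_nilpotentsI[of _ p])
  have pR: "add_pow R p \<one> = \<zero>"
    using \<iota>.hom_add_pow_one[of p] p(2) by simp
  note sub = compositum_subring[OF L.carrier_is_subring]
  show "compositum (carrier L) \<subseteq> carrier R" by (rule subringE(1)[OF sub])
  show "2 \<le> p" by (rule prime_ge_2_nat[OF p(1)])
  have pow: "x [^] n \<in> S" if "subring S R" "x \<in> S" for x S and n :: nat
    by (induction n) (use that subringE in \<open>auto\<close>)
  show "x [^] p \<in> compositum (carrier L)" if "x \<in> compositum (carrier L)" for x
    by (rule pow[OF sub that])
  fix s assume s: "s \<in> compositum (carrier L)" "s [^] p = \<zero>"
  obtain as us where *: "set as \<subseteq> A" "length as = length us" "ring.independent L K us"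
    "s = R.combine as (map \<iota> us)"
    using compositum_independent_representation[OF s(1)] by metis
  have usc: "set us \<subseteq> carrier L" by (rule L.independent_in_carrier[OF *(3)])
  have "R.combine (map (\<lambda>x. x [^] p) as) (map (\<lambda>x. x [^] p) (map \<iota> us)) = \<zero>"
    using R.frobenius_combine[OF p(1) pR, of as "map \<iota> us"] s(2) *(1,4) A_carrier usc by force
  moreover have "map (\<lambda>x. x [^] p) (map \<iota> us) = map \<iota> (map (\<lambda>x. x [^]\<^bsub>L\<^esub> p) us)"
    using usc by (auto simp: \<iota>.hom_nat_pow)
  ultimately have 0: "R.combine (map (\<lambda>x. x [^] p) as) (map \<iota> (map (\<lambda>x. x [^]\<^bsub>L\<^esub> p) us)) = \<zero>"
    by (simp only:)
  \<comment> \<open>\<open>A\<close> is \<open>compositum K\<close>, so the coefficients are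
    admissible for linear disjointness over \<open>K\<close>, applied to the \<open>p\<close>-th
    powers of \<open>us\<close>.\<close>
  have "set (map (\<lambda>x. x [^] p) as) \<subseteq> {\<zero>}"
    by (rule independent_over_compositum[OF K order_refl maclane[OF *(3)] _ _ 0])
      (use *(1,2) pow[OF A] compositum_K in auto)
  then have as0: "set as \<subseteq> {\<zero>}"
    using *(1) R.no_nilpotentsD[OF Ared] by auto
  have combine0: "R.combine as vs = \<zero>" if "set vs \<subseteq> carrier R" "set as \<subseteq> {\<zero>}" for as vs
    using that by (induction as vs rule: R.combine.induct) auto
  show "s = \<zero>"
    unfolding *(4) by (rule combine0) (use usc as0 in \<open>auto simp: subset_iff\<close>)
qed

end

section \<open>Polynomial expressions\<close>

text \<open>Values at \<open>x\<close> of polynomials over \<open>B\<close> of degree less than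
  \<open>k\<close>, leading term first. Coefficients are not part of the data; where a leading
  coefficient has to be determined by the value, this is proved by a contraction.\<close>

primrec (in ring) polys :: "'a set \<Rightarrow> 'a \<Rightarrow> nat \<Rightarrow> 'a set" where
  "polys B x 0 = {\<zero>}"
| "polys B x (Suc k) = {b \<otimes> x [^] k \<oplus> r | b r. b \<in> B \<and> r \<in> polys B x k}"

context cring
begin

context
  fixes B x
  assumes B: "subring B R" and x: "x \<in> carrier R"
begin

lemma B_sub [simp]: "b \<in> B \<Longrightarrow> b \<in> carrier R"
  using subringE(1)[OF B] by auto

lemma polys_SucI: "b \<in> B \<Longrightarrow> r \<in> polys B x k \<Longrightarrow> b \<otimes> x [^] k \<oplus> r \<in> polys B x (Suc k)"
  by auto

lemma polys_carrier: "r \<in> polys B x k \<Longrightarrow> r \<in> carrier R"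
  by (induction k arbitrary: r) (use x in auto)

lemma polys_Suc_mono: "r \<in> polys B x k \<Longrightarrow> r \<in> polys B x (Suc k)"
  using polys_SucI[OF subringE(2)[OF B], of r k] polys_carrier[of r k] x by simp

lemma polys_mono: "r \<in> polys B x j \<Longrightarrow> j \<le> k \<Longrightarrow> r \<in> polys B x k"
  by (induction k) (auto simp: le_Suc_eq simp del: polys.simps(2) intro: polys_Suc_mono)

lemma zero_polys: "\<zero> \<in> polys B x k"
  using polys_mono[of \<zero> 0 k] by simp

lemma polys_add: "r \<in> polys B x k \<Longrightarrow> s \<in> polys B x k \<Longrightarrow> r \<oplus> s \<in> polys B x k"
proof (induction k arbitrary: r s)
  case (Suc k)
  obtain b r' where r: "r = b \<otimes> x [^] k \<oplus> r'" "b \<in> B" "r' \<in> polys B x k" using Suc.prems(1) by auto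
  obtain c s' where s: "s = c \<otimes> x [^] k \<oplus> s'" "c \<in> B" "s' \<in> polys B x k" using Suc.prems(2) by auto
  have c: "b \<in> carrier R" "c \<in> carrier R" "r' \<in> carrier R" "s' \<in> carrier R" "x [^] k \<in> carrier R"
    using r s x by (auto intro: polys_carrier)
  have "r \<oplus> s = (b \<oplus> c) \<otimes> x [^] k \<oplus> (r' \<oplus> s')"
    unfolding r(1) s(1) using c by algebra
  then show ?case using polys_SucI[OF subringE(7)[OF B r(2) s(2)] Suc.IH[OF r(3) s(3)]] by simp
qed simp

lemma polys_smult: "c \<in> B \<Longrightarrow> r \<in> polys B x k \<Longrightarrow> c \<otimes> r \<in> polys B x k"
proof (induction k arbitrary: r)
  case (Suc k)
  obtain b r' where r: "r = b \<otimes> x [^] k \<oplus> r'" "b \<in> B" "r' \<in> polys B x k" using Suc.prems(2) by auto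
  have cl: "b \<in> carrier R" "c \<in> carrier R" "r' \<in> carrier R" "x [^] k \<in> carrier R"
    using r x Suc.prems(1) by (auto intro: polys_carrier)
  have "c \<otimes> r = (c \<otimes> b) \<otimes> x [^] k \<oplus> (c \<otimes> r')"
    unfolding r(1) using cl by algebra
  then show ?case
    using polys_SucI[OF subringE(6)[OF B Suc.prems(1) r(2)] Suc.IH[OF Suc.prems(1) r(3)]] by simp
qed simp

lemma polys_minus:
  assumes "r \<in> polys B x k"
  shows "\<ominus> r \<in> polys B x k"
  using polys_smult[OF subringE(5)[OF B subringE(3)[OF B]] assms] polys_carrier[OF assms]
  by (simp add: l_minus)

lemma polys_diff: "r \<in> polys B x k \<Longrightarrow> s \<in> polys B x k \<Longrightarrow> r \<ominus> s \<in> polys B x k"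
  unfolding a_minus_def by (intro polys_add polys_minus)

lemma monom_polys: "b \<in> B \<Longrightarrow> b \<otimes> x [^] k \<in> polys B x (Suc k)"
  using polys_SucI[OF _ zero_polys, of b k] x by simp

lemma polys_shift: "r \<in> polys B x k \<Longrightarrow> r \<otimes> x [^] j \<in> polys B x (k + j)"
proof (induction k arbitrary: r)
  case 0
  then show ?case using x by (simp add: zero_polys)
next
  case (Suc k)
  obtain b r' where r: "r = b \<otimes> x [^] k \<oplus> r'" "b \<in> B" "r' \<in> polys B x k" using Suc.prems by auto
  have cl: "b \<in> carrier R" "r' \<in> carrier R" "x [^] k \<in> carrier R" "x [^] j \<in> carrier R"
    using r x by (auto intro: polys_carrier)
  have "r \<otimes> x [^] j = b \<otimes> (x [^] k \<otimes> x [^] j) \<oplus> r' \<otimes> x [^] j"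
    unfolding r(1) using cl by algebra
  then show ?case
    using polys_SucI[OF r(2) Suc.IH[OF r(3)]] x by (simp add: nat_pow_mult)
qed

lemma polys_mult: "r \<in> polys B x j \<Longrightarrow> s \<in> polys B x k \<Longrightarrow> r \<otimes> s \<in> polys B x (j + k)"
proof (induction j arbitrary: r)
  case 0
  then show ?case using polys_carrier[OF 0(2)] by (simp add: zero_polys)
next
  case (Suc j)
  obtain b r' where r: "r = b \<otimes> x [^] j \<oplus> r'" "b \<in> B" "r' \<in> polys B x j" using Suc.prems by auto
  have cl: "b \<in> carrier R" "r' \<in> carrier R" "x [^] j \<in> carrier R" "s \<in> carrier R"
    using r x Suc.prems by (auto intro: polys_carrier)
  have "r \<otimes> s = b \<otimes> (s \<otimes> x [^] j) \<oplus> r' \<otimes> s"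
    unfolding r(1) using cl by algebra
  moreover have "b \<otimes> (s \<otimes> x [^] j) \<in> polys B x (j + k)"
    using polys_smult[OF r(2) polys_shift[OF Suc.prems(2), of j]] by (simp add: add.commute)
  ultimately have "r \<otimes> s \<in> polys B x (j + k)" using polys_add Suc.IH[OF r(3) Suc.prems(2)] by simp
  then show ?case by (rule polys_mono) simp
qed

lemma polys_Union_subring: "subring (\<Union>k. polys B x k) R"
proof (rule subringI)
  show "(\<Union>k. polys B x k) \<subseteq> carrier R" by (auto intro: polys_carrier)
  have "\<one> \<in> polys B x (Suc 0)" using monom_polys[OF subringE(3)[OF B], of 0] by simp
  then show "\<one> \<in> (\<Union>k. polys B x k)" by blast
  show "\<ominus> r \<in> (\<Union>k. polys B x k)" if "r \<in> (\<Union>k. polys B x k)" for r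
    using that polys_minus by blast
  show "r \<otimes> s \<in> (\<Union>k. polys B x k)" if "r \<in> (\<Union>k. polys B x k)" "s \<in> (\<Union>k. polys B x k)" for r s
    using that polys_mult by blast
  show "r \<oplus> s \<in> (\<Union>k. polys B x k)" if rs: "r \<in> (\<Union>k. polys B x k)" "s \<in> (\<Union>k. polys B x k)" for r s
  proof -
    obtain j k where "r \<in> polys B x j" "s \<in> polys B x k" using rs by blast
    then have "r \<in> polys B x (j + k)" "s \<in> polys B x (j + k)"
      by (auto intro: polys_mono)
    then show ?thesis using polys_add by blast
  qed
qed

lemma base_polys: "B \<subseteq> (\<Union>k. polys B x k)"
proof
  fix b assume b: "b \<in> B"
  then have "b \<in> polys B x (Suc 0)" using monom_polys[OF b, of 0] by (simp del: polys.simps(2))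
  then show "b \<in> (\<Union>k. polys B x k)" by blast
qed

lemma var_polys: "x \<in> (\<Union>k. polys B x k)"
proof -
  have "x \<in> polys B x 2"
    using monom_polys[OF subringE(3)[OF B], of 1] x by (simp add: numeral_2_eq_2 del: polys.simps(2))
  then show ?thesis by blast
qed

text \<open>The hypothesis is a monic equation of degree \<open>d\<close> for \<open>x\<close>, by
  which every higher power reduces to degrees below \<open>d\<close>.\<close>

lemma polys_bounded:
  assumes d: "x [^] d \<in> polys B x d"
  shows "polys B x k \<subseteq> polys B x d"
proof -
  have mult: "r \<otimes> x \<in> polys B x d" if rd: "r \<in> polys B x d" for r
  proof (cases d)
    case 0
    then show ?thesis using rd x by simp
  next
    case (Suc e)
    then obtain b r' where r: "r = b \<otimes> x [^] e \<oplus> r'" "b \<in> B" "r' \<in> polys B x e" using rd by auto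
    have cl: "b \<in> carrier R" "r' \<in> carrier R" "x [^] e \<in> carrier R"
      using r x by (auto intro: polys_carrier)
    have "r \<otimes> x = b \<otimes> x [^] d \<oplus> r' \<otimes> x"
      unfolding r(1) Suc nat_pow_Suc using cl x by algebra
    moreover have "r' \<otimes> x \<in> polys B x d"
      using polys_shift[OF r(3), of 1] x Suc by simp
    ultimately show ?thesis using polys_add[OF polys_smult[OF r(2) d]] by simp
  qed
  have pow: "x [^] k \<in> polys B x d" for k :: nat
  proof (cases "k < d")
    case True
    have "x [^] k \<in> polys B x (Suc k)" using monom_polys[OF subringE(3)[OF B], of k] x by simp
    then show ?thesis using True by (rule polys_mono[OF _ Suc_leI])
  next
    case False
    have "x [^] (d + j) \<in> polys B x d" for j :: nat
      by (induction j) (use d mult in auto)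
    then show ?thesis using False by (metis add_diff_inverse_nat)
  qed
  show ?thesis
  proof
    fix r assume "r \<in> polys B x k"
    then show "r \<in> polys B x d"
    proof (induction k arbitrary: r)
      case (Suc k)
      then show ?case using polys_add polys_smult pow by auto
    qed (simp add: zero_polys)
  qed
qed

text \<open>The leading coefficient \<open>b\<close> of the divisor need not be invertible, so each
  step of the division costs one factor \<open>b\<close>: if \<open>t\<close> has leading term
  \<open>c x^n\<close>, then subtracting \<open>c x^(n-k)\<close> times the divisor from
  \<open>b t\<close> cancels the top degree. What is left is \<open>t2\<close>.\<close>

lemma pseudo_division:
  assumes b: "b \<in> B" and r: "r \<in> polys B x k" and t: "t \<in> polys B x n"
  shows "\<exists>(m::nat) q r'. q \<in> carrier R \<and> r' \<in> polys B x k \<and> b [^] m \<otimes> t = q \<otimes> (b \<otimes> x [^] k \<oplus> r) \<oplus> r'"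
  using t
proof (induction n arbitrary: t)
  case 0
  then have "t = \<zero>" by simp
  then show ?case
    using b polys_carrier[OF r] x
    by (intro exI[of _ 0] exI[of _ \<zero>]) (auto simp: zero_polys)
next
  case (Suc n)
  note rc = polys_carrier[OF r]
  show ?case
  proof (cases "Suc n \<le> k")
    case True
    then have "t \<in> polys B x k" "t \<in> carrier R" using polys_mono[OF Suc.prems True] polys_carrier[OF Suc.prems] by auto
    then show ?thesis
      using b rc x by (intro exI[of _ 0] exI[of _ \<zero>] exI[of _ t]) auto
  next
    case False
    then have nk: "x [^] n = x [^] (n - k) \<otimes> x [^] k" using x by (simp add: nat_pow_mult)
    obtain c t' where t: "t = c \<otimes> x [^] n \<oplus> t'" "c \<in> B" "t' \<in> polys B x n" using Suc.prems by auto
    have cl: "b \<in> carrier R" "c \<in> carrier R" "t' \<in> carrier R" "r \<in> carrier R"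
        "x [^] (n - k) \<in> carrier R" "x [^] k \<in> carrier R"
      using b r t x by (auto intro: polys_carrier)
    define t2 where "t2 = b \<otimes> t' \<ominus> c \<otimes> (r \<otimes> x [^] (n - k))"
    have rn: "r \<otimes> x [^] (n - k) \<in> polys B x n"
      using polys_shift[OF r, of "n - k"] False by simp
    have t2n: "t2 \<in> polys B x n"
      unfolding t2_def by (rule polys_diff[OF polys_smult[OF b t(3)] polys_smult[OF t(2) rn]])
    from Suc.IH[OF t2n] obtain m :: nat and q r' where q: "q \<in> carrier R" "r' \<in> polys B x k"
      "b [^] m \<otimes> t2 = q \<otimes> (b \<otimes> x [^] k \<oplus> r) \<oplus> r'" by blast
    note r'c = polys_carrier[OF q(2)]
    have bm: "b [^] (m::nat) \<in> carrier R" for m using cl by simp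
    have "b \<otimes> t = c \<otimes> x [^] (n - k) \<otimes> (b \<otimes> x [^] k \<oplus> r) \<oplus> t2"
      unfolding t(1) t2_def nk using cl by algebra
    moreover have "b [^] Suc m \<otimes> t = b [^] m \<otimes> (b \<otimes> t)"
      using cl polys_carrier[OF Suc.prems] by (simp add: m_assoc)
    ultimately have "b [^] Suc m \<otimes> t
        = b [^] m \<otimes> (c \<otimes> x [^] (n - k)) \<otimes> (b \<otimes> x [^] k \<oplus> r) \<oplus> b [^] m \<otimes> t2"
      using cl bm[of m] polys_carrier[OF t2n] by (simp only: r_distr m_closed a_closed m_assoc)
    also have "\<dots> = (b [^] m \<otimes> (c \<otimes> x [^] (n - k)) \<oplus> q) \<otimes> (b \<otimes> x [^] k \<oplus> r) \<oplus> r'"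
      unfolding q(3) using cl bm[of m] q(1) r'c by algebra
    finally show ?thesis using q cl bm
      by (intro exI[of _ "Suc m"] exI[of _ "b [^] m \<otimes> (c \<otimes> x [^] (n - k)) \<oplus> q"] exI[of _ r']) simp
  qed
qed

end

end

lemma (in ring_hom_ring) hom_pow: "x \<in> carrier R \<Longrightarrow> h (x [^]\<^bsub>R\<^esub> (n::nat)) = h x [^]\<^bsub>S\<^esub> n"
  by (induction n) auto

lemma (in field) polys_subalgebra:
  assumes "subfield F R" "x \<in> carrier R"
  shows "subalgebra F (polys F x k) R"
proof (rule subalgebraI)
  note F = subfieldE(1)[OF assms(1)]
  show "polys F x k \<subseteq> carrier R" using polys_carrier[OF F assms(2)] by blast
  show "\<zero> \<in> polys F x k" by (rule zero_polys[OF F assms(2)])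
  show "F \<subseteq> carrier R" "\<ominus> \<one> \<in> F" using subringE(1,3,5)[OF F] by auto
  show "r \<oplus> s \<in> polys F x k" if "r \<in> polys F x k" "s \<in> polys F x k" for r s
    by (rule polys_add[OF F assms(2) that])
  show "c \<otimes> r \<in> polys F x k" if "c \<in> F" "r \<in> polys F x k" for c r
    by (rule polys_smult[OF F assms(2) that])
qed

subsection \<open>Dual numbers\<close>

text \<open>The pair \<open>(a, b)\<close> stands for \<open>a + b \<epsilon>\<close> with
  \<open>\<epsilon>\<close> of square zero. Evaluating a polynomial at \<open>(x, 1)\<close> returns
  its value and its derivative at \<open>x\<close> together.\<close>

definition dual_numbers :: "('a, 'm) ring_scheme \<Rightarrow> ('a \<times> 'a) ring"
  where "dual_numbers R =
    \<lparr>carrier = carrier R \<times> carrier R,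
     monoid.mult = (\<lambda>u v. (fst u \<otimes>\<^bsub>R\<^esub> fst v, fst u \<otimes>\<^bsub>R\<^esub> snd v \<oplus>\<^bsub>R\<^esub> snd u \<otimes>\<^bsub>R\<^esub> fst v)),
     one = (\<one>\<^bsub>R\<^esub>, \<zero>\<^bsub>R\<^esub>),
     ring.zero = (\<zero>\<^bsub>R\<^esub>, \<zero>\<^bsub>R\<^esub>),
     ring.add = (\<lambda>u v. (fst u \<oplus>\<^bsub>R\<^esub> fst v, snd u \<oplus>\<^bsub>R\<^esub> snd v))\<rparr>"

lemma dual_numbers_simps [simp]:
  "carrier (dual_numbers R) = carrier R \<times> carrier R"
  "u \<otimes>\<^bsub>dual_numbers R\<^esub> v = (fst u \<otimes>\<^bsub>R\<^esub> fst v, fst u \<otimes>\<^bsub>R\<^esub> snd v \<oplus>\<^bsub>R\<^esub> snd u \<otimes>\<^bsub>R\<^esub> fst v)"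
  "\<one>\<^bsub>dual_numbers R\<^esub> = (\<one>\<^bsub>R\<^esub>, \<zero>\<^bsub>R\<^esub>)"
  "\<zero>\<^bsub>dual_numbers R\<^esub> = (\<zero>\<^bsub>R\<^esub>, \<zero>\<^bsub>R\<^esub>)"
  "u \<oplus>\<^bsub>dual_numbers R\<^esub> v = (fst u \<oplus>\<^bsub>R\<^esub> fst v, snd u \<oplus>\<^bsub>R\<^esub> snd v)"
  by (simp_all add: dual_numbers_def)

lemma (in cring) dual_numbers_cring: "cring (dual_numbers R)"
proof (rule cringI)
  have neg: "\<exists>y\<in>carrier R \<times> carrier R. fst y \<oplus> fst u = \<zero> \<and> snd y \<oplus> snd u = \<zero>"
    if "u \<in> carrier R \<times> carrier R" for u
    using that by (intro bexI[of _ "(\<ominus> fst u, \<ominus> snd u)"]) (auto simp: l_neg)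
  show "abelian_group (dual_numbers R)"
    by (rule abelian_groupI) (use neg in \<open>auto simp: a_ac\<close>)
  show "comm_monoid (dual_numbers R)"
    by (rule comm_monoidI) (auto simp: m_ac a_ac l_distr r_distr)
next
  fix u v w assume "u \<in> carrier (dual_numbers R)" "v \<in> carrier (dual_numbers R)" "w \<in> carrier (dual_numbers R)"
  then have c: "fst u \<in> carrier R" "snd u \<in> carrier R" "fst v \<in> carrier R" "snd v \<in> carrier R"
      "fst w \<in> carrier R" "snd w \<in> carrier R" by auto
  have "(fst u \<oplus> fst v) \<otimes> snd w \<oplus> (snd u \<oplus> snd v) \<otimes> fst w
      = (fst u \<otimes> snd w \<oplus> snd u \<otimes> fst w) \<oplus> (fst v \<otimes> snd w \<oplus> snd v \<otimes> fst w)"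
    using c by algebra
  then show "(u \<oplus>\<^bsub>dual_numbers R\<^esub> v) \<otimes>\<^bsub>dual_numbers R\<^esub> w
      = u \<otimes>\<^bsub>dual_numbers R\<^esub> w \<oplus>\<^bsub>dual_numbers R\<^esub> v \<otimes>\<^bsub>dual_numbers R\<^esub> w"
    using c by (simp add: l_distr)
qed

section \<open>Reducedness in characteristic zero\<close>

context linearly_disjoint
begin

context
  fixes F x
  assumes F: "subfield F L" "K \<subseteq> F" and x: "x \<in> carrier L"
begin

lemma Fs: "subring F L"
  by (rule subfieldE(1)[OF F(1)])

lemma Fc: "c \<in> F \<Longrightarrow> c \<in> carrier L"
  using subringE(1)[OF Fs] by blast

lemma Bs: "subring (compositum F) R"
  by (rule compositum_subring[OF Fs])

lemma Bc: "b \<in> compositum F \<Longrightarrow> b \<in> carrier R"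
  using subringE(1)[OF Bs] by blast

lemma \<xi>: "\<iota> x \<in> carrier R"
  using x by simp

lemmas Lpolys_carrier = L.polys_carrier[OF Fs x]
lemmas Rpolys_carrier = R.polys_carrier[OF Bs \<xi>]

section \<open>Powers of a generator over the compositum\<close>

lemma hom_polys: "r \<in> L.polys F x k \<Longrightarrow> \<iota> r \<in> R.polys (compositum F) (\<iota> x) k"
proof (induction k arbitrary: r)
  case (Suc k)
  from Suc.prems(1) obtain c r' where r: "r = c \<otimes>\<^bsub>L\<^esub> x [^]\<^bsub>L\<^esub> k \<oplus>\<^bsub>L\<^esub> r'" "c \<in> F" "r' \<in> L.polys F x k" by auto
  have "\<iota> r = \<iota> c \<otimes> \<iota> x [^] k \<oplus> \<iota> r'"
    unfolding r(1) using Fc[OF r(2)] Lpolys_carrier[OF r(3)] x by (simp add: \<iota>.hom_pow)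
  then show ?case
    using R.polys_SucI[OF Bs \<xi> \<iota>_compositum[OF Fs r(2)] Suc.IH[OF r(3)]] by simp
qed simp

text \<open>Since \<open>x^k\<close> lies outside the \<open>F\<close>-span of the lower powers,
  there is a functional that is one at \<open>x^k\<close> and zero on that span. Its contraction
  kills \<open>r\<close> and turns the relation into \<open>b = 0\<close>.\<close>

lemma leading_coeff_zero:
  assumes xk: "x [^]\<^bsub>L\<^esub> k \<notin> L.polys F x k" and b: "b \<in> compositum F"
    and r: "r \<in> R.polys (compositum F) (\<iota> x) k" and zero: "b \<otimes> \<iota> x [^] k \<oplus> r = \<zero>"
  shows "b = \<zero>"
proof -
  obtain f where f: "ring.linear_on L F f" "f \<in> carrier L \<rightarrow> F"
    "\<And>v. v \<in> L.polys F x k \<Longrightarrow> f v = \<zero>\<^bsub>L\<^esub>" "f (x [^]\<^bsub>L\<^esub> k) = \<one>\<^bsub>L\<^esub>"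
    using L.exists_functional[OF F(1) L.polys_subalgebra[OF F(1) x] L.nat_pow_closed[OF x] xk] by metis
  obtain T where T: "T \<in> carrier R \<rightarrow> carrier R"
    "\<And>s t. s \<in> carrier R \<Longrightarrow> t \<in> carrier R \<Longrightarrow> T (s \<oplus> t) = T s \<oplus> T t" "T \<zero> = \<zero>"
    "\<And>l b. l \<in> carrier L \<Longrightarrow> b \<in> compositum F \<Longrightarrow> T (b \<otimes> \<iota> l) = b \<otimes> \<iota> (f l)"
    using contract_compositum[OF Fs F(2) f(1)] by metis
  have Tr: "T t = \<zero>" if "t \<in> R.polys (compositum F) (\<iota> x) j" "j \<le> k" for t j
    using that
  proof (induction j arbitrary: t)
    case (Suc j)
    then obtain c t' where t: "t = c \<otimes> \<iota> x [^] j \<oplus> t'" "c \<in> compositum F"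
      "t' \<in> R.polys (compositum F) (\<iota> x) j" by auto
    have "x [^]\<^bsub>L\<^esub> j \<in> L.polys F x (Suc j)"
      using L.monom_polys[OF Fs x subringE(3)[OF Fs], of j] x by simp
    then have "f (x [^]\<^bsub>L\<^esub> j) = \<zero>\<^bsub>L\<^esub>"
      using f(3) L.polys_mono[OF Fs x _ Suc.prems(2)] by blast
    then have "T (c \<otimes> \<iota> (x [^]\<^bsub>L\<^esub> j)) = \<zero>"
      using T(4)[OF L.nat_pow_closed[OF x] t(2), of j] Bc[OF t(2)] by simp
    moreover have "T t = T (c \<otimes> \<iota> x [^] j) \<oplus> T t'"
      unfolding t(1) using Bc[OF t(2)] Rpolys_carrier[OF t(3)] x by (intro T(2)) auto
    ultimately show ?case using Suc.IH[OF t(3)] Suc.prems(2) x by (simp add: \<iota>.hom_pow)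
  qed (use T(3) in simp)
  have "\<zero> = T (b \<otimes> \<iota> (x [^]\<^bsub>L\<^esub> k) \<oplus> r)"
    using zero T(3) x by (simp add: \<iota>.hom_pow)
  also have "\<dots> = T (b \<otimes> \<iota> (x [^]\<^bsub>L\<^esub> k)) \<oplus> T r"
    using Bc[OF b] Rpolys_carrier[OF r] x by (intro T(2)) auto
  also have "\<dots> = b"
    using T(4)[OF L.nat_pow_closed[OF x] b, of k] f(4) Tr[OF r order_refl] Bc[OF b] by simp
  finally show ?thesis by simp
qed

lemma top_power:
  assumes b: "b \<in> compositum F" and r: "r \<in> R.polys (compositum F) (\<iota> x) k"
  shows "\<exists>t\<in>R.polys (compositum F) (\<iota> x) (k * n).
    (b \<otimes> \<iota> x [^] k \<oplus> r) [^] n = b [^] n \<otimes> \<iota> x [^] (k * n) \<oplus> t"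
proof (induction n)
  case 0
  then show ?case by simp
next
  case (Suc n)
  let ?P = "R.polys (compositum F) (\<iota> x)"
  obtain t where t: "t \<in> ?P (k * n)"
    "(b \<otimes> \<iota> x [^] k \<oplus> r) [^] n = b [^] n \<otimes> \<iota> x [^] (k * n) \<oplus> t"
    using Suc by blast
  have bn: "b [^] n \<in> compositum F"
    by (induction n) (use b subringE(3,6)[OF Bs] in auto)
  have c: "b \<in> carrier R" "b [^] n \<in> carrier R" "r \<in> carrier R" "t \<in> carrier R"
      "\<iota> x [^] k \<in> carrier R" "\<iota> x [^] (k * n) \<in> carrier R"
    using Bc[OF b] Rpolys_carrier[OF r] Rpolys_carrier[OF t(1)] x by auto
  define u where "u = b [^] n \<otimes> (r \<otimes> \<iota> x [^] (k * n)) \<oplus> b \<otimes> (t \<otimes> \<iota> x [^] k) \<oplus> t \<otimes> r"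
  have "u \<in> ?P (k * Suc n)"
  proof -
    have *: "r \<otimes> \<iota> x [^] (k * n) \<in> ?P (k * Suc n)" "t \<otimes> \<iota> x [^] k \<in> ?P (k * Suc n)" "t \<otimes> r \<in> ?P (k * Suc n)"
      using R.polys_shift[OF Bs \<xi> r, of "k * n"] R.polys_shift[OF Bs \<xi> t(1), of k]
        R.polys_mult[OF Bs \<xi> t(1) r]
      by (simp_all add: add.commute)
    show ?thesis
      unfolding u_def
      by (rule R.polys_add[OF Bs \<xi> R.polys_add[OF Bs \<xi> R.polys_smult[OF Bs \<xi> bn *(1)]
            R.polys_smult[OF Bs \<xi> b *(2)]] *(3)])
  qed
  moreover have "(b \<otimes> \<iota> x [^] k \<oplus> r) [^] Suc n = b [^] Suc n \<otimes> \<iota> x [^] (k * Suc n) \<oplus> u"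
  proof -
    have "(b \<otimes> \<iota> x [^] k \<oplus> r) [^] Suc n = (b [^] n \<otimes> \<iota> x [^] (k * n) \<oplus> t) \<otimes> (b \<otimes> \<iota> x [^] k \<oplus> r)"
      using t(2) by simp
    also have "\<dots> = (b [^] n \<otimes> b) \<otimes> (\<iota> x [^] (k * n) \<otimes> \<iota> x [^] k) \<oplus> u"
      unfolding u_def using c by algebra
    also have "\<iota> x [^] (k * n) \<otimes> \<iota> x [^] k = \<iota> x [^] (k * Suc n)"
      using x by (simp add: R.nat_pow_mult add.commute)
    finally show ?thesis by simp
  qed
  ultimately show ?case by blast
qed

text \<open>The leading coefficient of \<open>s^n\<close> is \<open>b^n\<close>, with
  \<open>b\<close> that of \<open>s\<close>. No power of \<open>x\<close> depends on the lower ones,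
  so \<open>b^n\<close> vanishes together with \<open>s^n\<close>, and the degree of
  \<open>s\<close> drops.\<close>

lemma polys_reduced_transcendental:
  assumes tr: "\<And>k. x [^]\<^bsub>L\<^esub> k \<notin> L.polys F x k" and red: "R.no_nilpotents (compositum F)"
  shows "R.no_nilpotents (R.polys (compositum F) (\<iota> x) k)"
proof (induction k)
  case 0
  then show ?case by (simp add: R.no_nilpotents_def)
next
  case (Suc k)
  show ?case
    unfolding R.no_nilpotents_def
  proof (intro ballI allI impI)
    fix s and n :: nat
    assume s: "s \<in> R.polys (compositum F) (\<iota> x) (Suc k)" and sn: "s [^] n = \<zero>"
    obtain b r where r: "s = b \<otimes> \<iota> x [^] k \<oplus> r" "b \<in> compositum F"
      "r \<in> R.polys (compositum F) (\<iota> x) k" using s by auto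
    obtain t where t: "t \<in> R.polys (compositum F) (\<iota> x) (k * n)"
      "s [^] n = b [^] n \<otimes> \<iota> x [^] (k * n) \<oplus> t"
      using top_power[OF r(2,3), of n] unfolding r(1) by blast
    have "b [^] n \<in> compositum F"
      by (induction n) (use r(2) subringE(3,6)[OF Bs] in auto)
    then have "b [^] n = \<zero>" using leading_coeff_zero[OF tr _ t(1)] t(2) sn by simp
    then have "b = \<zero>" using R.no_nilpotentsD[OF red r(2)] by blast
    then have "s = r" using r(1) Rpolys_carrier[OF r(3)] x by simp
    then show "s = \<zero>" using R.no_nilpotentsD[OF Suc.IH, of s n] r(3) sn by simp
  qed
qed

text \<open>
  For \<open>x\<close> algebraic over \<open>F\<close> with minimal polynomial \<open>f\<close>, a nilpotent \<open>S(x)\<close> of least degree divides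
  a multiple of \<open>f\<close>, say \<open>b\<^sup>m f = Q S\<close> with \<open>b\<close> the leading coefficient of \<open>S\<close>. Differentiating at \<open>x\<close>,
  that is, evaluating at \<open>x + \<epsilon>\<close>, gives \<open>b\<^sup>m f'(x) S(x) = Q'(x) S(x)\<^sup>2\<close>, so that \<open>b\<close> is nilpotent.
\<close>

abbreviation (input) D where "D \<equiv> dual_numbers R"
abbreviation (input) B' where "B' \<equiv> compositum F \<times> {\<zero>}"
abbreviation (input) V where "V \<equiv> (\<iota> x, \<one>)"

lemma D: "cring D"
  by (rule R.dual_numbers_cring)

lemma B's: "subring B' D"
proof (rule ring.subringI[OF cring.axioms(1)[OF D]])
  interpret D: cring D by (rule D)
  have "\<ominus>\<^bsub>D\<^esub> (b, \<zero>) = (\<ominus> b, \<zero>)" if "b \<in> compositum F" for b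
    using Bc[OF that] by (intro D.minus_equality) (auto simp: R.l_neg)
  then show "\<ominus>\<^bsub>D\<^esub> u \<in> B'" if "u \<in> B'" for u
    using that subringE(5)[OF Bs] by auto
qed (use Bc subringE(3,6,7)[OF Bs] in auto)

lemma Vc: "V \<in> carrier D"
  using x by simp

lemma V_pow: "V [^]\<^bsub>D\<^esub> Suc k = (\<iota> x [^] Suc k, add_pow R (Suc k) (\<iota> x [^] k))"
proof -
  interpret D: cring D by (rule D)
  show ?thesis
  proof (induction k)
    case 0
    then show ?case using x by simp
  next
    case (Suc k)
    have "add_pow R (Suc k) (\<iota> x [^] k) \<otimes> \<iota> x = add_pow R (Suc k) (\<iota> x [^] Suc k)"
      using x by (subst R.add_pow_ldistr) auto
    then show ?case
      using Suc x unfolding D.nat_pow_Suc[of _ "Suc k"] by (simp add: R.a_comm)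
  qed
qed

lemma fst_V_pow: "fst (V [^]\<^bsub>D\<^esub> (k::nat)) = \<iota> x [^] k"
  proof (cases k)
  case (Suc j)
  show ?thesis unfolding Suc V_pow by simp
qed simp

lemma snd_V_pow_closed: "snd (V [^]\<^bsub>D\<^esub> (k::nat)) \<in> carrier R"
proof -
  interpret D: cring D by (rule D)
  show ?thesis using D.nat_pow_closed[OF Vc, of k] by (auto simp: mem_Times_iff)
qed

lemma fst_polys: "r \<in> ring.polys D B' V k \<Longrightarrow> fst r \<in> R.polys (compositum F) (\<iota> x) k"
proof -
  interpret D: cring D by (rule D)
  show "r \<in> D.polys B' V k \<Longrightarrow> fst r \<in> R.polys (compositum F) (\<iota> x) k"
  proof (induction k arbitrary: r)
    case (Suc k)
    from Suc.prems(1) obtain c r' where r: "r = (c, \<zero>) \<otimes>\<^bsub>D\<^esub> V [^]\<^bsub>D\<^esub> k \<oplus>\<^bsub>D\<^esub> r'" "c \<in> compositum F" "r' \<in> D.polys B' V k"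
      by auto
    then have "fst r = c \<otimes> \<iota> x [^] k \<oplus> fst r'" by (simp add: fst_V_pow)
    then show ?case using R.polys_SucI[OF Bs \<xi> r(2) Suc.IH[OF r(3)]] by simp
  qed simp
qed

lemma lift_polys: "r \<in> R.polys (compositum F) (\<iota> x) k \<Longrightarrow> \<exists>\<rho>\<in>ring.polys D B' V k. fst \<rho> = r"
proof -
  interpret D: cring D by (rule D)
  show "r \<in> R.polys (compositum F) (\<iota> x) k \<Longrightarrow> \<exists>\<rho>\<in>D.polys B' V k. fst \<rho> = r"
  proof (induction k arbitrary: r)
    case (Suc k)
    from Suc.prems(1) obtain c r' where r: "r = c \<otimes> \<iota> x [^] k \<oplus> r'" "c \<in> compositum F"
      "r' \<in> R.polys (compositum F) (\<iota> x) k" by auto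
    obtain \<rho> where \<rho>: "\<rho> \<in> D.polys B' V k" "fst \<rho> = r'" using Suc.IH[OF r(3)] by blast
    have "(c, \<zero>) \<otimes>\<^bsub>D\<^esub> V [^]\<^bsub>D\<^esub> k \<oplus>\<^bsub>D\<^esub> \<rho> \<in> D.polys B' V (Suc k)"
      using r(2) by (intro D.polys_SucI[OF B's Vc] \<rho>) simp
    then show ?case
      by (rule bexI[rotated]) (simp add: fst_V_pow \<rho> r)
  qed simp
qed

text \<open>Below the degree \<open>d\<close> of \<open>x\<close>, a value determines the
  coefficients. If the value at \<open>x\<close> is zero, then all coefficients are zero, and the
  derivative vanishes as well.\<close>

lemma polys_zero_of_fst:
  assumes low: "\<And>j. j < d \<Longrightarrow> x [^]\<^bsub>L\<^esub> j \<notin> L.polys F x j"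
  shows "r \<in> ring.polys D B' V k \<Longrightarrow> k \<le> d \<Longrightarrow> fst r = \<zero> \<Longrightarrow> r = (\<zero>, \<zero>)"
proof -
  interpret D: cring D by (rule D)
  show "r \<in> D.polys B' V k \<Longrightarrow> k \<le> d \<Longrightarrow> fst r = \<zero> \<Longrightarrow> r = (\<zero>, \<zero>)"
  proof (induction k arbitrary: r)
    case (Suc k)
    from Suc.prems(1) obtain c r' where r: "r = (c, \<zero>) \<otimes>\<^bsub>D\<^esub> V [^]\<^bsub>D\<^esub> k \<oplus>\<^bsub>D\<^esub> r'" "c \<in> compositum F" "r' \<in> D.polys B' V k"
      by auto
    then have "c \<otimes> \<iota> x [^] k \<oplus> fst r' = \<zero>" using Suc.prems(3) by (simp add: fst_V_pow)
    then have c: "c = \<zero>"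
      using leading_coeff_zero[OF low r(2) fst_polys[OF r(3)]] Suc.prems(2) by simp
    have "r' \<in> carrier D" by (rule D.polys_carrier[OF B's Vc r(3)])
    then have "r = r'"
      unfolding r(1) c using x snd_V_pow_closed[of k] by (auto simp: fst_V_pow)
    then show ?case using Suc.IH[OF r(3)] Suc.prems by simp
  qed simp
qed

text \<open>For coefficients in \<open>F\<close> the derivative at \<open>x\<close> again comes from
  \<open>L\<close>, and its degree is one less. Both facts are needed to compare the derivative of
  the minimal polynomial with lower powers of \<open>x\<close>. The natural subtraction is harmless
  at \<open>k = 0\<close>, where only zero occurs.\<close>

lemma derivative_lift:
  "r \<in> L.polys F x k \<Longrightarrow> \<exists>\<rho>\<in>ring.polys D B' V k. \<exists>e\<in>L.polys F x (k - 1). \<rho> = (\<iota> r, \<iota> e)"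
proof -
  interpret D: cring D by (rule D)
  show "r \<in> L.polys F x k \<Longrightarrow> \<exists>\<rho>\<in>D.polys B' V k. \<exists>e\<in>L.polys F x (k - 1). \<rho> = (\<iota> r, \<iota> e)"
  proof (induction k arbitrary: r)
    case (Suc k)
    from Suc.prems(1) obtain c r' where r: "r = c \<otimes>\<^bsub>L\<^esub> x [^]\<^bsub>L\<^esub> k \<oplus>\<^bsub>L\<^esub> r'" "c \<in> F" "r' \<in> L.polys F x k" by auto
    obtain \<rho> e where \<rho>: "\<rho> \<in> D.polys B' V k" "e \<in> L.polys F x (k - 1)" "\<rho> = (\<iota> r', \<iota> e)"
      using Suc.IH[OF r(3)] by blast
    let ?\<sigma> = "(\<iota> c, \<zero>) \<otimes>\<^bsub>D\<^esub> V [^]\<^bsub>D\<^esub> k \<oplus>\<^bsub>D\<^esub> \<rho>"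
    have mem: "?\<sigma> \<in> D.polys B' V (Suc k)"
      using \<iota>_compositum[OF Fs r(2)] by (intro D.polys_SucI[OF B's Vc] \<rho>) simp
    have c: "c \<in> carrier L" "r' \<in> carrier L" "e \<in> carrier L"
      using Fc[OF r(2)] Lpolys_carrier[OF r(3)] Lpolys_carrier[OF \<rho>(2)] by auto
    have "\<exists>e'\<in>L.polys F x k. ?\<sigma> = (\<iota> r, \<iota> e')"
    proof (cases k)
      case 0
      then have "r' = \<zero>\<^bsub>L\<^esub>" "e = \<zero>\<^bsub>L\<^esub>" using r \<rho> by auto
      then show ?thesis using 0 c r x by (intro bexI[of _ "\<zero>\<^bsub>L\<^esub>"]) (auto simp: \<rho>(3))
    next
      case (Suc j)
      let ?e = "add_pow L k \<one>\<^bsub>L\<^esub> \<otimes>\<^bsub>L\<^esub> c \<otimes>\<^bsub>L\<^esub> x [^]\<^bsub>L\<^esub> j"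
      have n: "add_pow L k \<one>\<^bsub>L\<^esub> \<in> F"
        by (induction k) (use subringE(2,3,7)[OF Fs] in auto)
      have "?e \<oplus>\<^bsub>L\<^esub> e \<in> L.polys F x k"
        using L.polys_SucI[OF Fs x subringE(6)[OF Fs n r(2)], of e j] \<rho>(2) Suc by simp
      moreover have "?\<sigma> = (\<iota> r, \<iota> (?e \<oplus>\<^bsub>L\<^esub> e))"
      proof -
        have "\<iota> (add_pow L k \<one>\<^bsub>L\<^esub>) = add_pow R k \<one>" by (rule \<iota>.hom_add_pow_one)
        then have "\<iota> ?e = add_pow R k \<one> \<otimes> (\<iota> c \<otimes> \<iota> x [^] j)"
          using c x Fc[OF n] by (simp add: \<iota>.hom_pow R.m_assoc)
        also have "\<dots> = add_pow R k (\<iota> c \<otimes> \<iota> x [^] j)"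
          using c x by (subst R.add_pow_ldistr) auto
        also have "\<dots> = \<iota> c \<otimes> add_pow R k (\<iota> x [^] j)"
          using c x by (subst R.add_pow_rdistr) auto
        finally have e: "\<iota> ?e = \<iota> c \<otimes> add_pow R k (\<iota> x [^] j)" .
        show ?thesis
          using c x Fc[OF n] V_pow[of j] e unfolding r(1) \<rho>(3) Suc[symmetric]
          by (simp add: \<iota>.hom_pow del: D.nat_pow_Suc R.add.nat_pow_Suc)
      qed
      ultimately show ?thesis by blast
    qed
    then show ?case using mem by auto
  qed (use L.zero_polys in auto)
qed

text \<open>The minimal polynomial evaluated at \<open>x + \<epsilon>\<close> has value zero and
  derivative \<open>\<delta> = d x^(d-1) + e\<close> with \<open>e\<close> of lower degree. As
  \<open>d\<close> is invertible in characteristic 0, \<open>\<delta> = 0\<close> would express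
  \<open>x^(d-1)\<close> by lower powers, against the minimality of \<open>d\<close>.\<close>

lemma minpoly_derivative:
  assumes char0: "\<And>n::nat. n > 0 \<Longrightarrow> add_pow L n \<one>\<^bsub>L\<^esub> \<noteq> \<zero>\<^bsub>L\<^esub>"
    and alg: "x [^]\<^bsub>L\<^esub> d \<in> L.polys F x d" and low: "\<And>j. j < d \<Longrightarrow> x [^]\<^bsub>L\<^esub> j \<notin> L.polys F x j"
  obtains \<delta> where "\<delta> \<in> carrier L" "\<delta> \<noteq> \<zero>\<^bsub>L\<^esub>" "(\<zero>, \<iota> \<delta>) \<in> ring.polys D B' V (Suc d)"
proof -
  interpret D: cring D by (rule D)
  obtain c where d: "d = Suc c"
    using alg x by (cases d) auto
  have xd: "x [^]\<^bsub>L\<^esub> d \<in> carrier L" using x by simp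
  \<comment> \<open>The element lifted is \<open>- x^d\<close>, written in lower powers of
    \<open>x\<close>; adding the leading power of \<open>V\<close> then gives the minimal polynomial
    at \<open>x + \<epsilon>\<close>.\<close>
  obtain \<rho> e where \<rho>: "\<rho> \<in> D.polys B' V d" "e \<in> L.polys F x (d - 1)" "\<rho> = (\<iota> (\<ominus>\<^bsub>L\<^esub> (x [^]\<^bsub>L\<^esub> d)), \<iota> e)"
    using derivative_lift[OF L.polys_minus[OF Fs x alg]] by blast
  have e: "e \<in> L.polys F x c" "e \<in> carrier L"
    using \<rho>(2) Lpolys_carrier[OF \<rho>(2)] d by auto
  define \<delta> where "\<delta> = add_pow L d (x [^]\<^bsub>L\<^esub> c) \<oplus>\<^bsub>L\<^esub> e"
  have hom_pow: "\<iota> (add_pow L n y) = add_pow R n (\<iota> y)" if "y \<in> carrier L" for n :: nat and y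
    by (induction n) (use that in simp_all)
  have "\<one>\<^bsub>D\<^esub> \<otimes>\<^bsub>D\<^esub> V [^]\<^bsub>D\<^esub> d \<oplus>\<^bsub>D\<^esub> \<rho> \<in> D.polys B' V (Suc d)"
    by (rule D.polys_SucI[OF B's Vc subringE(3)[OF B's] \<rho>(1)])
  moreover have "\<one>\<^bsub>D\<^esub> \<otimes>\<^bsub>D\<^esub> V [^]\<^bsub>D\<^esub> d \<oplus>\<^bsub>D\<^esub> \<rho> = (\<zero>, \<iota> \<delta>)"
  proof -
    have "\<one>\<^bsub>D\<^esub> \<otimes>\<^bsub>D\<^esub> V [^]\<^bsub>D\<^esub> d = (\<iota> x [^] d, add_pow R d (\<iota> x [^] c))"
      unfolding d D.l_one[OF D.nat_pow_closed[OF Vc]] by (rule V_pow)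
    moreover have "\<iota> \<delta> = add_pow R d (\<iota> x [^] c) \<oplus> \<iota> e"
      unfolding \<delta>_def using x e by (simp add: hom_pow \<iota>.hom_pow)
    moreover have "\<iota> x [^] d \<oplus> \<iota> (\<ominus>\<^bsub>L\<^esub> (x [^]\<^bsub>L\<^esub> d)) = \<zero>"
      using xd x by (simp add: \<iota>.hom_pow R.r_neg)
    ultimately show ?thesis unfolding \<rho>(3) by simp
  qed
  moreover have "\<delta> \<noteq> \<zero>\<^bsub>L\<^esub>"
  proof
    assume 0: "\<delta> = \<zero>\<^bsub>L\<^esub>"
    define n where "n = add_pow L d \<one>\<^bsub>L\<^esub>"
    have "add_pow L k \<one>\<^bsub>L\<^esub> \<in> F" for k :: nat
      by (induction k) (use subringE(2,3,7)[OF Fs] in auto)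
    then have nF: "n \<in> F" unfolding n_def .
    have n: "n \<in> F" "n \<noteq> \<zero>\<^bsub>L\<^esub>" "n \<in> carrier L"
      using nF char0[of d] d Fc[OF nF] unfolding n_def by blast+
    have inv: "inv\<^bsub>L\<^esub> n \<in> F" "inv\<^bsub>L\<^esub> n \<otimes>\<^bsub>L\<^esub> n = \<one>\<^bsub>L\<^esub>"
      using L.subfield_m_inv[OF F(1), of n] n by auto
    have "add_pow L d (x [^]\<^bsub>L\<^esub> c) = n \<otimes>\<^bsub>L\<^esub> x [^]\<^bsub>L\<^esub> c"
      unfolding n_def using x by (subst L.add_pow_ldistr) auto
    then have "n \<otimes>\<^bsub>L\<^esub> x [^]\<^bsub>L\<^esub> c \<oplus>\<^bsub>L\<^esub> e = \<zero>\<^bsub>L\<^esub>"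
      using 0 by (simp add: \<delta>_def)
    then have "n \<otimes>\<^bsub>L\<^esub> x [^]\<^bsub>L\<^esub> c = \<ominus>\<^bsub>L\<^esub> e"
      using x n e by (metis L.m_closed L.minus_equality L.nat_pow_closed)
    then have "n \<otimes>\<^bsub>L\<^esub> x [^]\<^bsub>L\<^esub> c \<in> L.polys F x c"
      using L.polys_minus[OF Fs x e(1)] by simp
    then have "inv\<^bsub>L\<^esub> n \<otimes>\<^bsub>L\<^esub> (n \<otimes>\<^bsub>L\<^esub> x [^]\<^bsub>L\<^esub> c) \<in> L.polys F x c"
      by (rule L.polys_smult[OF Fs x inv(1)])
    moreover have "inv\<^bsub>L\<^esub> n \<otimes>\<^bsub>L\<^esub> (n \<otimes>\<^bsub>L\<^esub> x [^]\<^bsub>L\<^esub> c) = x [^]\<^bsub>L\<^esub> c"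
      using L.m_assoc[of "inv\<^bsub>L\<^esub> n" n "x [^]\<^bsub>L\<^esub> c"] inv Fc[OF inv(1)] n x by simp
    ultimately show False using low[of c] d by simp
  qed
  moreover have "\<delta> \<in> carrier L" unfolding \<delta>_def using x e by simp
  ultimately show ?thesis using that by metis
qed

lemma polys_reduced_algebraic:
  assumes char0: "\<And>n::nat. n > 0 \<Longrightarrow> add_pow L n \<one>\<^bsub>L\<^esub> \<noteq> \<zero>\<^bsub>L\<^esub>"
    and alg: "x [^]\<^bsub>L\<^esub> d \<in> L.polys F x d" and low: "\<And>j. j < d \<Longrightarrow> x [^]\<^bsub>L\<^esub> j \<notin> L.polys F x j"
    and red: "R.no_nilpotents (compositum F)"
  shows "k \<le> d \<Longrightarrow> R.no_nilpotents (R.polys (compositum F) (\<iota> x) k)"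
proof (induction k)
  case 0
  then show ?case by (simp add: R.no_nilpotents_def)
next
  case (Suc k)
  interpret D: cring D by (rule D)
  obtain \<delta> where \<delta>: "\<delta> \<in> carrier L" "\<delta> \<noteq> \<zero>\<^bsub>L\<^esub>" "(\<zero>, \<iota> \<delta>) \<in> D.polys B' V (Suc d)"
    using minpoly_derivative[OF char0 alg low] by metis
  have IH: "R.no_nilpotents (R.polys (compositum F) (\<iota> x) k)" using Suc by simp
  show ?case
    unfolding R.no_nilpotents_def
  proof (intro ballI allI impI)
    fix s and n :: nat
    assume s: "s \<in> R.polys (compositum F) (\<iota> x) (Suc k)" and sn: "s [^] n = \<zero>"
    obtain b r where r: "s = b \<otimes> \<iota> x [^] k \<oplus> r" "b \<in> compositum F"
      "r \<in> R.polys (compositum F) (\<iota> x) k" using s by auto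
    have sc: "s \<in> carrier R" by (rule Rpolys_carrier[OF s])
    have bc: "b \<in> carrier R" by (rule Bc[OF r(2)])
    obtain \<rho> where \<rho>: "\<rho> \<in> D.polys B' V k" "fst \<rho> = r" using lift_polys[OF r(3)] by blast
    let ?S = "(b, \<zero>) \<otimes>\<^bsub>D\<^esub> V [^]\<^bsub>D\<^esub> k \<oplus>\<^bsub>D\<^esub> \<rho>"
    have bB: "(b, \<zero>) \<in> B'" using r(2) by simp
    \<comment> \<open>Pseudo-division of the minimal polynomial, whose value at
      \<open>x + \<epsilon>\<close> is \<open>(0, \<iota> \<delta>)\<close>, by the lift
      \<open>?S\<close> of \<open>s\<close>.\<close>
    obtain m :: nat and q r' where q: "q \<in> carrier D" "r' \<in> D.polys B' V k"
      "(b, \<zero>) [^]\<^bsub>D\<^esub> m \<otimes>\<^bsub>D\<^esub> (\<zero>, \<iota> \<delta>) = q \<otimes>\<^bsub>D\<^esub> ?S \<oplus>\<^bsub>D\<^esub> r'"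
      using D.pseudo_division[OF B's Vc bB \<rho>(1) \<delta>(3)] by blast
    have fstS: "fst ?S = s" using r(1) \<rho>(2) by (simp add: fst_V_pow)
    define s1 where "s1 = snd ?S"
    have "?S \<in> carrier D" using D.polys_carrier[OF B's Vc D.polys_SucI[OF B's Vc bB \<rho>(1)]] .
    then have s1: "s1 \<in> carrier R" by (auto simp: s1_def mem_Times_iff)
    have S: "?S = (s, s1)" using fstS s1_def by (metis prod.collapse)
    obtain q0 q1 where qq: "q = (q0, q1)" by (cases q)
    have qc: "q0 \<in> carrier R" "q1 \<in> carrier R" using q(1) qq by auto
    have bm: "(b, \<zero>) [^]\<^bsub>D\<^esub> m = (b [^] m, \<zero>)" for m :: nat
      by (induction m) (use bc in auto)
    have ud: "\<iota> \<delta> \<in> carrier R" using \<delta>(1) by simp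
    have r'c: "r' \<in> carrier D" by (rule D.polys_carrier[OF B's Vc q(2)])
    have "\<zero> = q0 \<otimes> s \<oplus> fst r'"
      using arg_cong[OF q(3), of fst] unfolding S qq bm using bc by simp
    then have fr': "fst r' = \<ominus> (q0 \<otimes> s)"
      using qc sc r'c by (metis R.m_closed R.minus_equality R.add.m_comm dual_numbers_simps(1) mem_Times_iff)
    have "fst r' = (\<ominus> q0) \<otimes> s" using fr' qc sc by (simp add: R.l_minus)
    \<comment> \<open>The value of the remainder is a multiple of the nilpotent \<open>s\<close> and
      has lower degree, so the induction hypothesis makes it zero; its derivative is then zero as
      well.\<close>
    then have "fst r' [^] n = \<zero>" using sn qc sc by (simp add: R.nat_pow_distrib)
    then have "fst r' = \<zero>" using R.no_nilpotentsD[OF IH fst_polys[OF q(2)]] by blast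
    then have r'0: "r' = (\<zero>, \<zero>)"
      using polys_zero_of_fst[OF low q(2)] Suc.prems by simp
    have q0s: "q0 \<otimes> s = \<zero>"
      using \<open>\<zero> = q0 \<otimes> s \<oplus> fst r'\<close> r'0 qc sc by simp
    \<comment> \<open>The product rule, read off from the second components; \<open>s1\<close> is
      the derivative of the lift of \<open>s\<close>.\<close>
    have main: "b [^] m \<otimes> \<iota> \<delta> = q0 \<otimes> s1 \<oplus> q1 \<otimes> s"
      using arg_cong[OF q(3), of snd] unfolding S qq bm r'0 using bc ud qc sc s1 by simp
    define u where "u = \<iota> (inv\<^bsub>L\<^esub> \<delta>)"
    have inv: "inv\<^bsub>L\<^esub> \<delta> \<in> carrier L" "\<delta> \<otimes>\<^bsub>L\<^esub> inv\<^bsub>L\<^esub> \<delta> = \<one>\<^bsub>L\<^esub>"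
      using L.field_Units \<delta> by auto
    then have u: "u \<in> carrier R" "\<iota> \<delta> \<otimes> u = \<one>"
      using \<iota>.hom_mult[OF \<delta>(1) inv(1)] by (simp_all add: u_def)
    let ?c = "b [^] m"
    define w where "w = u \<otimes> q1"
    have cc: "?c \<in> carrier R" "w \<in> carrier R" using bc u qc by (simp_all add: w_def)
    \<comment> \<open>Multiplication by \<open>s\<close> removes the term with
      \<open>q0 s = 0\<close>, and the image of \<open>\<delta>\<close> is cancelled because
      \<open>\<delta>\<close> is invertible in \<open>L\<close>.\<close>
    have cs: "?c \<otimes> s = w \<otimes> s \<otimes> s"
    proof -
      have "?c \<otimes> s = (?c \<otimes> \<iota> \<delta>) \<otimes> (u \<otimes> s)"
        using u cc sc ud by (simp add: R.m_ac) (simp add: R.m_assoc[symmetric])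
      also have "\<dots> = (q0 \<otimes> s) \<otimes> (s1 \<otimes> u) \<oplus> w \<otimes> s \<otimes> s"
        unfolding main w_def using qc sc s1 u(1) by algebra
      also have "\<dots> = w \<otimes> s \<otimes> s" unfolding q0s using s1 u(1) cc sc by simp
      finally show ?thesis .
    qed
    \<comment> \<open>Each factor \<open>?c\<close> next to \<open>s\<close> is traded for a factor
      \<open>w s\<close>. After \<open>n\<close> trades \<open>s^n = 0\<close> appears, so
      \<open>b^(m n) s = 0\<close>, and the leading coefficient \<open>b^(m n + 1)\<close> of this
      element vanishes.\<close>
    have iter: "?c [^] j \<otimes> s = w [^] j \<otimes> s [^] j \<otimes> s" for j :: nat
    proof (induction j)
      case (Suc j)
      have p: "?c [^] j \<in> carrier R" "w [^] j \<in> carrier R" "s [^] j \<in> carrier R" using cc sc by auto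
      have "?c [^] Suc j \<otimes> s = ?c \<otimes> (?c [^] j \<otimes> s)" using cc(1) p sc by (simp add: R.m_ac)
      also have "\<dots> = (w [^] j \<otimes> s [^] j) \<otimes> (?c \<otimes> s)"
        unfolding Suc using cc(1) p sc by (simp add: R.m_ac)
      also have "\<dots> = w [^] Suc j \<otimes> s [^] Suc j \<otimes> s"
        unfolding cs using cc(2) p sc by (simp add: R.m_ac)
      finally show ?case .
    qed (use sc in simp)
    have cn: "?c [^] n \<in> compositum F"
    proof -
      have "a [^] j \<in> compositum F" if "a \<in> compositum F" for a and j :: nat
        by (induction j) (use that subringE(3,6)[OF Bs] in auto)
      then show ?thesis using r(2) by blast
    qed
    have "?c [^] n \<otimes> s = \<zero>" using iter[of n] sn cc sc by simp
    moreover have "?c [^] n \<otimes> s = (?c [^] n \<otimes> b) \<otimes> \<iota> x [^] k \<oplus> ?c [^] n \<otimes> r"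
      unfolding r(1) using Bc[OF cn] bc Rpolys_carrier[OF r(3)] R.nat_pow_closed[OF \<xi>, of k] by algebra
    ultimately have "?c [^] n \<otimes> b = \<zero>"
      using leading_coeff_zero[OF low subringE(6)[OF Bs cn r(2)] R.polys_smult[OF Bs \<xi> cn r(3)]] Suc.prems
      by simp
    then have "b [^] (Suc (m * n)) = \<zero>"
      using bc by (simp add: R.nat_pow_pow)
    then have "b = \<zero>" using R.no_nilpotentsD[OF red r(2)] by blast
    then have "s = r" using r(1) Rpolys_carrier[OF r(3)] x by simp
    then show "s = \<zero>" using R.no_nilpotentsD[OF IH, of s n] r(3) sn by simp
  qed
qed

lemma polys_reduced:
  assumes char0: "\<And>n::nat. n > 0 \<Longrightarrow> add_pow L n \<one>\<^bsub>L\<^esub> \<noteq> \<zero>\<^bsub>L\<^esub>"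
    and red: "R.no_nilpotents (compositum F)"
  shows "R.no_nilpotents (R.polys (compositum F) (\<iota> x) k)"
proof (cases "\<exists>d. x [^]\<^bsub>L\<^esub> d \<in> L.polys F x d")
  case True
  define d where "d = (LEAST d. x [^]\<^bsub>L\<^esub> d \<in> L.polys F x d)"
  have alg: "x [^]\<^bsub>L\<^esub> d \<in> L.polys F x d"
    unfolding d_def using True by (rule LeastI_ex)
  have low: "x [^]\<^bsub>L\<^esub> j \<notin> L.polys F x j" if "j < d" for j
    using not_less_Least[of j "\<lambda>d. x [^]\<^bsub>L\<^esub> d \<in> L.polys F x d"] that by (simp add: d_def)
  have "\<iota> x [^] d \<in> R.polys (compositum F) (\<iota> x) d"
    using hom_polys[OF alg] x by (simp add: \<iota>.hom_pow)
  then have "R.polys (compositum F) (\<iota> x) k \<subseteq> R.polys (compositum F) (\<iota> x) d"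
    by (rule R.polys_bounded[OF Bs \<xi>])
  then show ?thesis
    using R.no_nilpotents_mono polys_reduced_algebraic[OF char0 alg low red order_refl] by blast
next
  case False
  then show ?thesis using polys_reduced_transcendental[OF _ red] by blast
qed

section \<open>From polynomials to rational functions in one generator\<close>

lemma simple_extension_fraction:
  assumes "z \<in> generate_field L (insert x F)"
  shows "\<exists>u\<in>(\<Union>k. L.polys F x k). \<exists>v\<in>(\<Union>k. L.polys F x k). v \<noteq> \<zero>\<^bsub>L\<^esub> \<and> z \<in> carrier L \<and> z \<otimes>\<^bsub>L\<^esub> v = u"
    (is "\<exists>u\<in>?P. _")
  using assms
proof induction
  note P = L.polys_Union_subring[OF Fs x]
  note Pc = subsetD[OF subringE(1)[OF P]]
  {
    case one
    show ?case using subringE(3)[OF P] by (intro bexI[of _ "\<one>\<^bsub>L\<^esub>"]) auto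
  next
    case (incl h)
    then have "h \<in> ?P" using L.var_polys[OF Fs x] L.base_polys[OF Fs x] by blast
    then show ?case using subringE(3)[OF P] Pc by (intro bexI[of _ h] bexI[of _ "\<one>\<^bsub>L\<^esub>"]) auto
  next
    case (a_inv h)
    then obtain u v where uv: "u \<in> ?P" "v \<in> ?P" "v \<noteq> \<zero>\<^bsub>L\<^esub>" "h \<in> carrier L" "h \<otimes>\<^bsub>L\<^esub> v = u" by blast
    then have "(\<ominus>\<^bsub>L\<^esub> h) \<otimes>\<^bsub>L\<^esub> v = \<ominus>\<^bsub>L\<^esub> u" using Pc by (simp add: L.l_minus)
    then show ?case using uv subringE(5)[OF P uv(1)] by blast
  next
    case (m_inv h)
    then obtain u v where uv: "u \<in> ?P" "v \<in> ?P" "v \<noteq> \<zero>\<^bsub>L\<^esub>" "h \<in> carrier L" "h \<otimes>\<^bsub>L\<^esub> v = u" by blast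
    have h: "inv\<^bsub>L\<^esub> h \<in> carrier L" "inv\<^bsub>L\<^esub> h \<otimes>\<^bsub>L\<^esub> h = \<one>\<^bsub>L\<^esub>"
      using L.field_Units uv(4) m_inv(2) by auto
    have vc: "v \<in> carrier L" using uv Pc by blast
    have "inv\<^bsub>L\<^esub> h \<otimes>\<^bsub>L\<^esub> u = (inv\<^bsub>L\<^esub> h \<otimes>\<^bsub>L\<^esub> h) \<otimes>\<^bsub>L\<^esub> v"
      using uv(4,5) h(1) vc by (simp add: L.m_assoc)
    then have "inv\<^bsub>L\<^esub> h \<otimes>\<^bsub>L\<^esub> u = v" using h vc by simp
    moreover have "u \<noteq> \<zero>\<^bsub>L\<^esub>"
      using uv(3-5) vc m_inv(2) L.integral by blast
    ultimately show ?case using uv(1,2) h by blast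
  next
    case (eng_add h1 h2)
    then obtain u v where uv: "u \<in> ?P" "v \<in> ?P" "v \<noteq> \<zero>\<^bsub>L\<^esub>" "h1 \<in> carrier L" "h1 \<otimes>\<^bsub>L\<^esub> v = u" by blast
    from eng_add obtain u' v' where uv': "u' \<in> ?P" "v' \<in> ?P" "v' \<noteq> \<zero>\<^bsub>L\<^esub>" "h2 \<in> carrier L" "h2 \<otimes>\<^bsub>L\<^esub> v' = u'" by blast
    have c: "v \<in> carrier L" "v' \<in> carrier L" using uv uv' Pc by auto
    have "(h1 \<oplus>\<^bsub>L\<^esub> h2) \<otimes>\<^bsub>L\<^esub> (v \<otimes>\<^bsub>L\<^esub> v') = (h1 \<otimes>\<^bsub>L\<^esub> v) \<otimes>\<^bsub>L\<^esub> v' \<oplus>\<^bsub>L\<^esub> (h2 \<otimes>\<^bsub>L\<^esub> v') \<otimes>\<^bsub>L\<^esub> v"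
      using c uv(4) uv'(4) by algebra
    also have "\<dots> \<in> ?P"
      unfolding uv(5) uv'(5) by (intro subringE(6,7)[OF P] uv uv')
    finally have "(h1 \<oplus>\<^bsub>L\<^esub> h2) \<otimes>\<^bsub>L\<^esub> (v \<otimes>\<^bsub>L\<^esub> v') \<in> ?P" .
    moreover have "v \<otimes>\<^bsub>L\<^esub> v' \<noteq> \<zero>\<^bsub>L\<^esub>" using uv(3) uv'(3) c L.integral by blast
    ultimately show ?case using subringE(6)[OF P uv(2) uv'(2)] uv(4) uv'(4) by blast
  next
    case (eng_mult h1 h2)
    then obtain u v where uv: "u \<in> ?P" "v \<in> ?P" "v \<noteq> \<zero>\<^bsub>L\<^esub>" "h1 \<in> carrier L" "h1 \<otimes>\<^bsub>L\<^esub> v = u" by blast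
    from eng_mult obtain u' v' where uv': "u' \<in> ?P" "v' \<in> ?P" "v' \<noteq> \<zero>\<^bsub>L\<^esub>" "h2 \<in> carrier L" "h2 \<otimes>\<^bsub>L\<^esub> v' = u'" by blast
    have c: "v \<in> carrier L" "v' \<in> carrier L" using uv uv' Pc by auto
    have "(h1 \<otimes>\<^bsub>L\<^esub> h2) \<otimes>\<^bsub>L\<^esub> (v \<otimes>\<^bsub>L\<^esub> v') = (h1 \<otimes>\<^bsub>L\<^esub> v) \<otimes>\<^bsub>L\<^esub> (h2 \<otimes>\<^bsub>L\<^esub> v')"
      using c uv(4) uv'(4) by algebra
    also have "\<dots> \<in> ?P"
      unfolding uv(5) uv'(5) by (intro subringE(6)[OF P] uv uv')
    finally have "(h1 \<otimes>\<^bsub>L\<^esub> h2) \<otimes>\<^bsub>L\<^esub> (v \<otimes>\<^bsub>L\<^esub> v') \<in> ?P" .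
    moreover have "v \<otimes>\<^bsub>L\<^esub> v' \<noteq> \<zero>\<^bsub>L\<^esub>" using uv(3) uv'(3) c L.integral by blast
    ultimately show ?case using subringE(6)[OF P uv(2) uv'(2)] uv(4) uv'(4) by blast
  }
qed

text \<open>A common denominator \<open>v\<close> moves an element of the larger compositum into
  polynomial expressions over the smaller one. The image of \<open>v\<close> is a unit, so neither
  nilpotence nor vanishing is affected.\<close>

lemma simple_extension_reduced:
  assumes char0: "\<And>n::nat. n > 0 \<Longrightarrow> add_pow L n \<one>\<^bsub>L\<^esub> \<noteq> \<zero>\<^bsub>L\<^esub>"
    and red: "R.no_nilpotents (compositum F)"
  shows "R.no_nilpotents (compositum (generate_field L (insert x F)))"
proof -
  let ?P = "\<Union>k. L.polys F x k" and ?Q = "\<Union>k. R.polys (compositum F) (\<iota> x) k"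
  note P = L.polys_Union_subring[OF Fs x] and Q = R.polys_Union_subring[OF Bs \<xi>]
  note Pc = subsetD[OF subringE(1)[OF P]] and Qc = subsetD[OF subringE(1)[OF Q]]
  have \<iota>P: "\<iota> u \<in> ?Q" if "u \<in> ?P" for u using that hom_polys by blast
  have AQ: "a \<in> ?Q" if "a \<in> A" for a
    using that A_compositum[OF Fs] R.base_polys[OF Bs \<xi>] by blast
  have frac: "\<exists>v\<in>?P. v \<noteq> \<zero>\<^bsub>L\<^esub> \<and> \<iota> v \<otimes> s \<in> ?Q \<and> s \<in> carrier R" if "s \<in> compositum (generate_field L (insert x F))" for s
    using that
  proof induction
    case zero
    have "\<iota> \<one>\<^bsub>L\<^esub> \<otimes> \<zero> \<in> ?Q" using subringE(2)[OF Q] by simp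
    then show ?case using subringE(3)[OF P] by (intro bexI[of _ "\<one>\<^bsub>L\<^esub>"]) auto
  next
    case (step z a s)
    obtain v where v: "v \<in> ?P" "v \<noteq> \<zero>\<^bsub>L\<^esub>" "\<iota> v \<otimes> s \<in> ?Q" "s \<in> carrier R" using step.IH by blast
    obtain u w where uw: "u \<in> ?P" "w \<in> ?P" "w \<noteq> \<zero>\<^bsub>L\<^esub>" "z \<in> carrier L" "z \<otimes>\<^bsub>L\<^esub> w = u"
      using simple_extension_fraction[OF step(1)] by blast
    have c: "v \<in> carrier L" "w \<in> carrier L" "u \<in> carrier L" "a \<in> carrier R"
      using v uw Pc A_carrier step(2) by blast+
    note ic = \<iota>.hom_closed[OF c(1)] \<iota>.hom_closed[OF c(2)] \<iota>.hom_closed[OF uw(4)]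
    have "\<iota> (v \<otimes>\<^bsub>L\<^esub> w) \<otimes> (\<iota> z \<otimes> a \<oplus> s) = \<iota> v \<otimes> \<iota> u \<otimes> a \<oplus> \<iota> w \<otimes> (\<iota> v \<otimes> s)"
      unfolding uw(5)[symmetric] \<iota>.hom_mult[OF c(1,2)] \<iota>.hom_mult[OF uw(4) c(2)]
      using ic c(4) v(4) by algebra
    also have "\<dots> \<in> ?Q"
      by (intro subringE(6,7)[OF Q] \<iota>P AQ v uw step)
    finally have "\<iota> (v \<otimes>\<^bsub>L\<^esub> w) \<otimes> (\<iota> z \<otimes> a \<oplus> s) \<in> ?Q" .
    moreover have "v \<otimes>\<^bsub>L\<^esub> w \<noteq> \<zero>\<^bsub>L\<^esub>" using v(2) uw(3) c L.integral by blast
    moreover have "\<iota> z \<otimes> a \<oplus> s \<in> carrier R" using ic c v by simp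
    ultimately show ?case using subringE(6)[OF P v(1) uw(2)] by blast
  qed
  show ?thesis
    unfolding R.no_nilpotents_def
  proof (intro ballI allI impI)
    fix s and n :: nat
    assume s: "s \<in> compositum (generate_field L (insert x F))" and sn: "s [^] n = \<zero>"
    obtain v where v: "v \<in> ?P" "v \<noteq> \<zero>\<^bsub>L\<^esub>" "\<iota> v \<otimes> s \<in> ?Q" "s \<in> carrier R" using frac[OF s] by blast
    have vc: "v \<in> carrier L" using v Pc by blast
    obtain k where k: "\<iota> v \<otimes> s \<in> R.polys (compositum F) (\<iota> x) k" using v(3) by blast
    have pn: "(\<iota> v \<otimes> s) [^] n = \<zero>" using sn v(4) vc by (simp add: R.nat_pow_distrib)
    have vs: "\<iota> v \<otimes> s = \<zero>"
      by (rule R.no_nilpotentsD[OF polys_reduced[OF char0 red] k pn])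
    have inv: "inv\<^bsub>L\<^esub> v \<in> carrier L" "inv\<^bsub>L\<^esub> v \<otimes>\<^bsub>L\<^esub> v = \<one>\<^bsub>L\<^esub>"
      using L.field_Units v(2) vc by auto
    have "s = \<iota> (inv\<^bsub>L\<^esub> v \<otimes>\<^bsub>L\<^esub> v) \<otimes> s" using inv v(4) by simp
    also have "\<dots> = \<iota> (inv\<^bsub>L\<^esub> v) \<otimes> (\<iota> v \<otimes> s)"
      using inv(1) vc v(4) by (simp add: R.m_assoc)
    also have "\<dots> = \<zero>" unfolding vs using inv(1) by simp
    finally show "s = \<zero>" .
  qed
qed

end

text \<open>An element of the compositum involves only finitely many elements of \<open>L\<close>.
  The induction over its terms carries along a subfield containing those met so far, together with
  the reducedness of its compositum.\<close>

theorem compositum_reduced_char_0: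
  assumes char0: "\<And>n::nat. n > 0 \<Longrightarrow> add_pow L n \<one>\<^bsub>L\<^esub> \<noteq> \<zero>\<^bsub>L\<^esub>"
    and red: "R.no_nilpotents A"
  shows "R.no_nilpotents (compositum (carrier L))"
proof -
  have "\<exists>F. subfield F L \<and> K \<subseteq> F \<and> s \<in> compositum F \<and> R.no_nilpotents (compositum F)"
    if "s \<in> compositum (carrier L)" for s
    using that
  proof induction
    case zero
    show ?case using K red compositum_K compositum.zero by (intro exI[of _ K]) auto
  next
    case (step l a s)
    obtain F where F: "subfield F L" "K \<subseteq> F" "s \<in> compositum F" "R.no_nilpotents (compositum F)"
      using step.IH by blast
    let ?F = "generate_field L (insert l F)"
    have c: "insert l F \<subseteq> carrier L" using step(1) subfieldE(3)[OF F(1)] by blast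
    have sub: "insert l F \<subseteq> ?F" by (auto intro: generate_field.incl)
    have "s \<in> compositum ?F" using F(3) compositum_mono[of F ?F] sub by blast
    then have "\<iota> l \<otimes> a \<oplus> s \<in> compositum ?F" using sub step(2) by (intro compositum.step) auto
    then show ?case
      using L.generate_field_is_subfield[OF c] sub F(2) simple_extension_reduced[OF F(1,2) step(1) char0 F(4)]
      by (intro exI[of _ ?F]) auto
  qed
  then show ?thesis unfolding R.no_nilpotents_def by blast
qed

end

section \<open>Field extensions\<close>

lemma (in domain) char_zero_or_prime:
  obtains "\<And>n::nat. n > 0 \<Longrightarrow> add_pow R n \<one> \<noteq> \<zero>"
  | p :: nat where "Factorial_Ring.prime p" "add_pow R p \<one> = \<zero>"
proof (cases "\<exists>n::nat. n > 0 \<and> add_pow R n \<one> = \<zero>")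
  case False
  then show ?thesis using that(1) by blast
next
  case True
  define p where "p = (LEAST n::nat. n > 0 \<and> add_pow R n \<one> = \<zero>)"
  have p: "p > 0" "add_pow R p \<one> = \<zero>"
    using LeastI_ex[OF True] by (auto simp: p_def)
  have min: "add_pow R n \<one> \<noteq> \<zero>" if "0 < n" "n < p" for n
    using not_less_Least[of n "\<lambda>n. n > 0 \<and> add_pow R n \<one> = \<zero>"] that by (auto simp: p_def)
  have "p \<noteq> 1" using p(2) by (intro notI) simp
  have "Factorial_Ring.prime p"
  proof (rule ccontr)
    assume "\<not> Factorial_Ring.prime p"
    then obtain m where m: "m dvd p" "m \<noteq> 1" "m \<noteq> p"
      using p(1) \<open>p \<noteq> 1\<close> by (auto simp: prime_nat_iff)
    then obtain k where k: "p = m * k" by blast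
    have mk: "0 < m" "m < p" "0 < k" "k < p"
      using k m p(1) by (auto simp: n_less_m_mult_n n_less_n_mult_m intro!: Nat.gr0I)
    have "add_pow R m \<one> \<otimes> add_pow R k \<one> = add_pow R m (add_pow R k \<one>)"
      by (subst add_pow_ldistr) auto
    also have "\<dots> = add_pow R p \<one>"
      using add.nat_pow_pow[OF one_closed, of m k] by (simp add: k mult.commute)
    finally show False using min[of m] min[of k] mk p(2) integral by auto
  qed
  then show ?thesis using that(2) p by blast
qed

lemma (in domain) domain_pow_zero: "x \<in> carrier R \<Longrightarrow> x [^] (n::nat) = \<zero> \<Longrightarrow> x = \<zero>"
  by (induction n) (auto dest: integral)

theorem (in linearly_disjoint) compositum_reduced:
  assumes maclane: "\<And>(p::nat) us. Factorial_Ring.prime p \<Longrightarrow> add_pow L p \<one>\<^bsub>L\<^esub> = \<zero>\<^bsub>L\<^esub> \<Longrightarrow> ring.independent L K us \<Longrightarrow>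
      ring.independent L K (map (\<lambda>x. x [^]\<^bsub>L\<^esub> p) us)"
    and red: "R.no_nilpotents A"
  shows "R.no_nilpotents (compositum (carrier L))"
proof (rule L.char_zero_or_prime)
  assume "\<And>n::nat. n > 0 \<Longrightarrow> add_pow L n \<one>\<^bsub>L\<^esub> \<noteq> \<zero>\<^bsub>L\<^esub>"
  then show ?thesis using compositum_reduced_char_0 red by blast
next
  fix p :: nat assume p: "Factorial_Ring.prime p" "add_pow L p \<one>\<^bsub>L\<^esub> = \<zero>\<^bsub>L\<^esub>"
  show ?thesis by (rule compositum_reduced_char_p[OF p maclane[OF p] red])
qed

locale field_ext = K: field K + L: field L + alg: algebra K L
  for K :: "('k, 'r) ring_scheme" and L :: "('k, 'l, 'm) module_scheme"
begin

definition emb :: "'k \<Rightarrow> 'l"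
  where "emb k = k \<odot>\<^bsub>L\<^esub> \<one>\<^bsub>L\<^esub>"

abbreviation F where "F \<equiv> base_field K L"

lemma F_eq: "F = emb ` carrier K"
  by (simp add: base_field_def emb_def)

lemma smult_emb: "k \<in> carrier K \<Longrightarrow> x \<in> carrier L \<Longrightarrow> k \<odot>\<^bsub>L\<^esub> x = emb k \<otimes>\<^bsub>L\<^esub> x"
  by (simp add: emb_def alg.smult_assoc2)

lemma emb_hom: "ring_hom_ring K L emb"
proof (rule ring_hom_ringI2[OF K.ring_axioms L.ring_axioms], rule ring_hom_memI)
  show "emb (x \<otimes>\<^bsub>K\<^esub> y) = emb x \<otimes>\<^bsub>L\<^esub> emb y" if "x \<in> carrier K" "y \<in> carrier K" for x y
    using that alg.smult_assoc1[of x y "\<one>\<^bsub>L\<^esub>"] smult_emb[of x "emb y"] by (simp add: emb_def)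
qed (auto simp: emb_def alg.smult_l_distr)

sublocale emb: ring_hom_ring K L emb
  by (rule emb_hom)

lemma subfield_F: "subfield F L"
  unfolding F_eq using K.carrier_is_subfield by (rule emb.img_is_subfield(2)) simp

lemma F_carrier: "F \<subseteq> carrier L"
  by (rule subfieldE(3)[OF subfield_F])

lemma inj_emb: "inj_on emb (carrier K)"
  using K.carrier_is_subfield by (rule emb.img_is_subfield(1)) simp

text \<open>Functionals on \<open>L\<close> take values in the copy \<open>F\<close> of
  \<open>K\<close>; \<open>coemb\<close> returns them to \<open>K\<close>, so that they can act on a
  \<open>K\<close>-algebra.\<close>

definition coemb :: "'l \<Rightarrow> 'k"
  where "coemb = the_inv_into (carrier K) emb"

lemma coemb_closed: "x \<in> F \<Longrightarrow> coemb x \<in> carrier K"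
  unfolding coemb_def F_eq using the_inv_into_into[OF inj_emb] by blast

lemma emb_coemb: "x \<in> F \<Longrightarrow> emb (coemb x) = x"
  unfolding coemb_def F_eq by (rule f_the_inv_into_f[OF inj_emb])

lemma coemb_emb: "k \<in> carrier K \<Longrightarrow> coemb (emb k) = k"
  unfolding coemb_def by (rule the_inv_into_f_f[OF inj_emb])

lemma coemb_add:
  assumes "x \<in> F" "y \<in> F"
  shows "coemb (x \<oplus>\<^bsub>L\<^esub> y) = coemb x \<oplus>\<^bsub>K\<^esub> coemb y"
proof -
  have "x \<oplus>\<^bsub>L\<^esub> y = emb (coemb x \<oplus>\<^bsub>K\<^esub> coemb y)" using assms by (simp add: coemb_closed emb_coemb)
  then show ?thesis using assms by (simp only: coemb_emb coemb_closed K.a_closed)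
qed

lemma coemb_mult:
  assumes "x \<in> F" "y \<in> F"
  shows "coemb (x \<otimes>\<^bsub>L\<^esub> y) = coemb x \<otimes>\<^bsub>K\<^esub> coemb y"
proof -
  have "x \<otimes>\<^bsub>L\<^esub> y = emb (coemb x \<otimes>\<^bsub>K\<^esub> coemb y)" using assms by (simp add: coemb_closed emb_coemb)
  then show ?thesis using assms by (simp only: coemb_emb coemb_closed K.m_closed)
qed

lemma coemb_one: "coemb \<one>\<^bsub>L\<^esub> = \<one>\<^bsub>K\<^esub>"
  using coemb_emb[of "\<one>\<^bsub>K\<^esub>"] by simp

text \<open>Mac Lane's criterion, for all characteristics at once: it is void in characteristic \<open>0\<close>.\<close>

definition maclane :: bool
  where "maclane \<longleftrightarrow> (\<forall>(p::nat) us. Factorial_Ring.prime p \<longrightarrow> add_pow L p \<one>\<^bsub>L\<^esub> = \<zero>\<^bsub>L\<^esub> \<longrightarrow> L.independent F us \<longrightarrow>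
    L.independent F (map (\<lambda>x. x [^]\<^bsub>L\<^esub> p) us))"

text \<open>Such a functional splits the inclusion of scalars. It yields the injectivity of
  \<open>A\<close> in \<open>L \<otimes> A\<close> and the non-triviality of the tensor
  powers.\<close>

lemma unit_functional:
  obtains f where "L.linear_on F f" "f \<in> carrier L \<rightarrow> F" "f \<one>\<^bsub>L\<^esub> = \<one>\<^bsub>L\<^esub>"
proof -
  have "subalgebra F {\<zero>\<^bsub>L\<^esub>} L"
    using F_carrier subringE(3,5)[OF subfieldE(1)[OF subfield_F]]
    by (intro L.subalgebraI) auto
  then show ?thesis
    using that L.exists_functional[OF subfield_F, of "{\<zero>\<^bsub>L\<^esub>}" "\<one>\<^bsub>L\<^esub>"] by (metis L.one_closed L.one_not_zero singletonD)
qed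

lemma linear_smult:
  assumes "L.linear_on F f" "k \<in> carrier K" "x \<in> carrier L"
  shows "f (k \<odot>\<^bsub>L\<^esub> x) = k \<odot>\<^bsub>L\<^esub> f x"
  using assms L.linear_onD(1,3)[OF assms(1)] by (simp add: smult_emb F_eq)

end

lemma field_extI: "field_extension K L \<Longrightarrow> field_ext K L"
  by (simp add: field_extension_def field_ext_def)

section \<open>Separability and Mac Lane's criterion\<close>

lemma (in comm_monoid) frag_of_mult_diff:
  "frag_of m \<otimes>\<^bsub>monoid_ring G\<^esub> (u - v) = frag_of m \<otimes>\<^bsub>monoid_ring G\<^esub> u - frag_of m \<otimes>\<^bsub>monoid_ring G\<^esub> v"
  "frag_of m \<otimes>\<^bsub>monoid_ring G\<^esub> frag_of x = frag_of (m \<otimes> x)"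
  by (simp_all add: monoid_ring_simps frag_extend_diff)

section \<open>The tensor product with a test algebra\<close>

locale tensor_algebra = field_ext K L + A: cring A + kA: algebra K A
  for K :: "('k, 'r) ring_scheme" and L :: "('k, 'l, 'm) module_scheme"
    and A :: "('k, 'a, 'n) module_scheme"
begin

sublocale T: monoid_ring_quotient "L \<times>\<times> A" "tensor_rels K L A"
proof -
  interpret P: comm_monoid "L \<times>\<times> A"
    by (rule comm_monoidI)
      (auto simp: L.m_ac A.m_ac)
  show "monoid_ring_quotient (L \<times>\<times> A) (tensor_rels K L A)"
  proof
    fix s assume s: "s \<in> tensor_rels K L A"
    then show "Poly_Mapping.keys s \<subseteq> carrier (L \<times>\<times> A)"
      unfolding tensor_rels_def
      by (auto dest!: subsetD[OF keys_diff])
    fix m assume "m \<in> carrier (L \<times>\<times> A)"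
    then obtain l c where m: "m = (l, c)" "l \<in> carrier L" "c \<in> carrier A" by auto
    have l_smult: "l \<otimes>\<^bsub>L\<^esub> (k \<odot>\<^bsub>L\<^esub> a) = k \<odot>\<^bsub>L\<^esub> (l \<otimes>\<^bsub>L\<^esub> a)" if "k \<in> carrier K" "a \<in> carrier L" for k a
      using that m(2) alg.smult_assoc2[of k a l] by (simp add: L.m_comm)
    have c_smult: "c \<otimes>\<^bsub>A\<^esub> (k \<odot>\<^bsub>A\<^esub> b) = k \<odot>\<^bsub>A\<^esub> (c \<otimes>\<^bsub>A\<^esub> b)" if "k \<in> carrier K" "b \<in> carrier A" for k b
      using that m(3) kA.smult_assoc2[of k b c] by (simp add: A.m_comm)
    from s consider
      a a' b where "s = frag_of (a \<oplus>\<^bsub>L\<^esub> a', b) - frag_of (a, b) - frag_of (a', b)"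
        "a \<in> carrier L" "a' \<in> carrier L" "b \<in> carrier A"
      | a b b' where "s = frag_of (a, b \<oplus>\<^bsub>A\<^esub> b') - frag_of (a, b) - frag_of (a, b')"
        "a \<in> carrier L" "b \<in> carrier A" "b' \<in> carrier A"
      | k a b where "s = frag_of (k \<odot>\<^bsub>L\<^esub> a, b) - frag_of (a, k \<odot>\<^bsub>A\<^esub> b)"
        "k \<in> carrier K" "a \<in> carrier L" "b \<in> carrier A"
      unfolding tensor_rels_def by blast
    then show "frag_of m \<otimes>\<^bsub>monoid_ring (L \<times>\<times> A)\<^esub> s \<in> tensor_rels K L A"
    proof cases
      case 1
      have "frag_of m \<otimes>\<^bsub>monoid_ring (L \<times>\<times> A)\<^esub> s
        = frag_of (l \<otimes>\<^bsub>L\<^esub> a \<oplus>\<^bsub>L\<^esub> l \<otimes>\<^bsub>L\<^esub> a', c \<otimes>\<^bsub>A\<^esub> b) - frag_of (l \<otimes>\<^bsub>L\<^esub> a, c \<otimes>\<^bsub>A\<^esub> b) - frag_of (l \<otimes>\<^bsub>L\<^esub> a', c \<otimes>\<^bsub>A\<^esub> b)"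
        using 1 m by (simp add: P.frag_of_mult_diff L.r_distr)
      moreover have "l \<otimes>\<^bsub>L\<^esub> a \<in> carrier L" "l \<otimes>\<^bsub>L\<^esub> a' \<in> carrier L" "c \<otimes>\<^bsub>A\<^esub> b \<in> carrier A"
        using 1 m by auto
      ultimately show ?thesis unfolding tensor_rels_def by blast
    next
      case 2
      have "frag_of m \<otimes>\<^bsub>monoid_ring (L \<times>\<times> A)\<^esub> s
        = frag_of (l \<otimes>\<^bsub>L\<^esub> a, c \<otimes>\<^bsub>A\<^esub> b \<oplus>\<^bsub>A\<^esub> c \<otimes>\<^bsub>A\<^esub> b') - frag_of (l \<otimes>\<^bsub>L\<^esub> a, c \<otimes>\<^bsub>A\<^esub> b) - frag_of (l \<otimes>\<^bsub>L\<^esub> a, c \<otimes>\<^bsub>A\<^esub> b')"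
        using 2 m by (simp add: P.frag_of_mult_diff A.r_distr)
      moreover have "l \<otimes>\<^bsub>L\<^esub> a \<in> carrier L" "c \<otimes>\<^bsub>A\<^esub> b \<in> carrier A" "c \<otimes>\<^bsub>A\<^esub> b' \<in> carrier A"
        using 2 m by auto
      ultimately show ?thesis unfolding tensor_rels_def by blast
    next
      case 3
      have "frag_of m \<otimes>\<^bsub>monoid_ring (L \<times>\<times> A)\<^esub> s
        = frag_of (k \<odot>\<^bsub>L\<^esub> (l \<otimes>\<^bsub>L\<^esub> a), c \<otimes>\<^bsub>A\<^esub> b) - frag_of (l \<otimes>\<^bsub>L\<^esub> a, k \<odot>\<^bsub>A\<^esub> (c \<otimes>\<^bsub>A\<^esub> b))"
        using 3 m by (simp add: P.frag_of_mult_diff l_smult c_smult)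
      moreover have "l \<otimes>\<^bsub>L\<^esub> a \<in> carrier L" "c \<otimes>\<^bsub>A\<^esub> b \<in> carrier A"
        using 3 m by auto
      ultimately show ?thesis using 3(2) unfolding tensor_rels_def by blast
    qed
  qed
qed

lemma quot_eq: "T.quot = tensor_product K L A"
  by (simp add: tensor_product_def T.rel_ideal_def)

lemma cls_add_left:
  assumes "a \<in> carrier L" "a' \<in> carrier L" "b \<in> carrier A"
  shows "T.cls (a \<oplus>\<^bsub>L\<^esub> a', b) = T.cls (a, b) \<oplus>\<^bsub>T.quot\<^esub> T.cls (a', b)"
proof (rule T.cls_addI)
  show "frag_of (a \<oplus>\<^bsub>L\<^esub> a', b) - frag_of (a, b) - frag_of (a', b) \<in> tensor_rels K L A"
    unfolding tensor_rels_def using assms by blast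
qed (use assms in auto)

lemma cls_add_right:
  assumes "a \<in> carrier L" "b \<in> carrier A" "b' \<in> carrier A"
  shows "T.cls (a, b \<oplus>\<^bsub>A\<^esub> b') = T.cls (a, b) \<oplus>\<^bsub>T.quot\<^esub> T.cls (a, b')"
proof (rule T.cls_addI)
  show "frag_of (a, b \<oplus>\<^bsub>A\<^esub> b') - frag_of (a, b) - frag_of (a, b') \<in> tensor_rels K L A"
    unfolding tensor_rels_def using assms by blast
qed (use assms in auto)

lemma cls_smult:
  assumes "k \<in> carrier K" "a \<in> carrier L" "b \<in> carrier A"
  shows "T.cls (k \<odot>\<^bsub>L\<^esub> a, b) = T.cls (a, k \<odot>\<^bsub>A\<^esub> b)"
proof (rule T.cls_eqI)
  show "frag_of (k \<odot>\<^bsub>L\<^esub> a, b) - frag_of (a, k \<odot>\<^bsub>A\<^esub> b) \<in> tensor_rels K L A"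
    unfolding tensor_rels_def using assms by blast
qed (use assms in auto)

lemma bilinear_universal:
  assumes G: "abelian_group G"
    and f: "\<And>a b. a \<in> carrier L \<Longrightarrow> b \<in> carrier A \<Longrightarrow> f a b \<in> carrier G"
    and left: "\<And>a a' b. a \<in> carrier L \<Longrightarrow> a' \<in> carrier L \<Longrightarrow> b \<in> carrier A \<Longrightarrow>
        f (a \<oplus>\<^bsub>L\<^esub> a') b = f a b \<oplus>\<^bsub>G\<^esub> f a' b"
    and right: "\<And>a b b'. a \<in> carrier L \<Longrightarrow> b \<in> carrier A \<Longrightarrow> b' \<in> carrier A \<Longrightarrow>
        f a (b \<oplus>\<^bsub>A\<^esub> b') = f a b \<oplus>\<^bsub>G\<^esub> f a b'"
    and smult: "\<And>k a b. k \<in> carrier K \<Longrightarrow> a \<in> carrier L \<Longrightarrow> b \<in> carrier A \<Longrightarrow>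
        f (k \<odot>\<^bsub>L\<^esub> a) b = f a (k \<odot>\<^bsub>A\<^esub> b)"
  shows "\<exists>h. h \<in> carrier T.quot \<rightarrow> carrier G \<and>
    (\<forall>s\<in>carrier T.quot. \<forall>t\<in>carrier T.quot. h (s \<oplus>\<^bsub>T.quot\<^esub> t) = h s \<oplus>\<^bsub>G\<^esub> h t) \<and>
    (\<forall>x\<in>carrier (L \<times>\<times> A). h (T.cls x) = case_prod f x)"
proof (rule T.quot_universal[OF G])
  show "case_prod f x \<in> carrier G" if "x \<in> carrier (L \<times>\<times> A)" for x
    using that f by auto
  fix s assume "s \<in> tensor_rels K L A"
  then consider
      a a' b where "s = frag_of (a \<oplus>\<^bsub>L\<^esub> a', b) - frag_of (a, b) - frag_of (a', b)"
        "a \<in> carrier L" "a' \<in> carrier L" "b \<in> carrier A"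
      | a b b' where "s = frag_of (a, b \<oplus>\<^bsub>A\<^esub> b') - frag_of (a, b) - frag_of (a, b')"
        "a \<in> carrier L" "b \<in> carrier A" "b' \<in> carrier A"
      | k a b where "s = frag_of (k \<odot>\<^bsub>L\<^esub> a, b) - frag_of (a, k \<odot>\<^bsub>A\<^esub> b)"
        "k \<in> carrier K" "a \<in> carrier L" "b \<in> carrier A"
    unfolding tensor_rels_def by blast
  then show "(\<exists>x y z. x \<in> carrier (L \<times>\<times> A) \<and> y \<in> carrier (L \<times>\<times> A) \<and> z \<in> carrier (L \<times>\<times> A) \<and>
           s = frag_of z - frag_of x - frag_of y \<and> case_prod f z = case_prod f x \<oplus>\<^bsub>G\<^esub> case_prod f y) \<or>
        (\<exists>x y. x \<in> carrier (L \<times>\<times> A) \<and> y \<in> carrier (L \<times>\<times> A) \<and> s = frag_of x - frag_of y \<and> case_prod f x = case_prod f y)"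
  proof cases
    case 1
    then show ?thesis
      by (intro disjI1 exI[of _ "(a, b)"] exI[of _ "(a', b)"] exI[of _ "(a \<oplus>\<^bsub>L\<^esub> a', b)"]) (simp add: left)
  next
    case 2
    then show ?thesis
      by (intro disjI1 exI[of _ "(a, b)"] exI[of _ "(a, b')"] exI[of _ "(a, b \<oplus>\<^bsub>A\<^esub> b')"]) (simp add: right)
  next
    case 3
    then show ?thesis
      by (intro disjI2 exI[of _ "(k \<odot>\<^bsub>L\<^esub> a, b)"] exI[of _ "(a, k \<odot>\<^bsub>A\<^esub> b)"]) (simp add: smult)
  qed
qed

definition inl :: "'l \<Rightarrow> ('l \<times> 'a \<Rightarrow>\<^sub>0 int) set"
  where "inl l = T.cls (l, \<one>\<^bsub>A\<^esub>)"

definition inr :: "'a \<Rightarrow> ('l \<times> 'a \<Rightarrow>\<^sub>0 int) set"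
  where "inr a = T.cls (\<one>\<^bsub>L\<^esub>, a)"

lemma inl_hom: "inl \<in> ring_hom L T.quot"
  by (rule ring_hom_memI) (auto simp: inl_def T.cls_mult cls_add_left T.cls_one[simplified])

lemma inr_hom: "ring_hom_ring A T.quot inr"
  by (rule ring_hom_ringI2[OF A.ring_axioms T.Q.ring_axioms], rule ring_hom_memI)
    (auto simp: inr_def T.cls_mult cls_add_right T.cls_one[simplified])

sublocale inr: ring_hom_ring A T.quot inr
  by (rule inr_hom)

lemma inl_inr: "l \<in> carrier L \<Longrightarrow> a \<in> carrier A \<Longrightarrow> inl l \<otimes>\<^bsub>T.quot\<^esub> inr a = T.cls (l, a)"
  by (simp add: inl_def inr_def T.cls_mult)

lemma inl_emb: "k \<in> carrier K \<Longrightarrow> inl (emb k) = inr (k \<odot>\<^bsub>A\<^esub> \<one>\<^bsub>A\<^esub>)"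
  by (simp add: inl_def inr_def emb_def cls_smult)

text \<open>For a functional \<open>f\<close> with \<open>f 1 = 1\<close>, the additive map sending
  \<open>l \<otimes> a\<close> to \<open>f(l) a\<close> is a retraction of
  \<open>inr\<close>.\<close>

lemma inj_inr: "inj_on inr (carrier A)"
proof -
  obtain f where f: "L.linear_on F f" "f \<in> carrier L \<rightarrow> F" "f \<one>\<^bsub>L\<^esub> = \<one>\<^bsub>L\<^esub>"
    using unit_functional by blast
  have fF: "f a \<in> F" if "a \<in> carrier L" for a using f(2) that by blast
  have "\<exists>h. h \<in> carrier T.quot \<rightarrow> carrier A \<and>
    (\<forall>s\<in>carrier T.quot. \<forall>t\<in>carrier T.quot. h (s \<oplus>\<^bsub>T.quot\<^esub> t) = h s \<oplus>\<^bsub>A\<^esub> h t) \<and>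
    (\<forall>x\<in>carrier (L \<times>\<times> A). h (T.cls x) = (case x of (a, b) \<Rightarrow> coemb (f a) \<odot>\<^bsub>A\<^esub> b))"
  proof (rule bilinear_universal)
    show "abelian_group A" by (rule A.is_abelian_group)
    fix k a b assume kab: "k \<in> carrier K" "a \<in> carrier L" "b \<in> carrier A"
    have "f (k \<odot>\<^bsub>L\<^esub> a) = emb k \<otimes>\<^bsub>L\<^esub> f a"
      using kab linear_smult[OF f(1)] smult_emb L.linear_onD(1)[OF f(1)] by simp
    then have "coemb (f (k \<odot>\<^bsub>L\<^esub> a)) = k \<otimes>\<^bsub>K\<^esub> coemb (f a)"
      using kab fF by (simp add: coemb_mult coemb_emb F_eq)
    then show "coemb (f (k \<odot>\<^bsub>L\<^esub> a)) \<odot>\<^bsub>A\<^esub> b = coemb (f a) \<odot>\<^bsub>A\<^esub> (k \<odot>\<^bsub>A\<^esub> b)"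
      using kab coemb_closed[OF fF] by (simp add: kA.smult_assoc1[symmetric] K.m_comm)
  qed (use fF in \<open>auto simp: coemb_closed coemb_add L.linear_onD(2)[OF f(1)] kA.smult_l_distr kA.smult_r_distr\<close>)
  then obtain h where h: "\<forall>x\<in>carrier (L \<times>\<times> A). h (T.cls x) = (case x of (a, b) \<Rightarrow> coemb (f a) \<odot>\<^bsub>A\<^esub> b)"
    by (elim exE conjE)
  have "h (inr a) = a" if "a \<in> carrier A" for a
    using that bspec[OF h, of "(\<one>\<^bsub>L\<^esub>, a)"] f(3) by (simp add: inr_def coemb_one)
  then show ?thesis by (rule inj_on_inverseI)
qed

text \<open>The contraction is \<open>f \<otimes> id\<close>. It respects the passage of scalars
  between the factors because \<open>f\<close> is linear over the image of \<open>K\<close>.\<close>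

sublocale LD: linearly_disjoint T.quot L F inl "inr ` carrier A"
proof (intro linearly_disjoint.intro linearly_disjoint_axioms.intro)
  show "cring T.quot" by (rule T.Q.is_cring)
  show "field L" by (rule L.field_axioms)
  show "subfield F L" by (rule subfield_F)
  show "inl \<in> ring_hom L T.quot" by (rule inl_hom)
  show "subring (inr ` carrier A) T.quot"
    by (rule inr.img_is_subring[OF A.carrier_is_subring])
  show "inl ` F \<subseteq> inr ` carrier A"
    by (auto simp: F_eq inl_emb)
  fix f assume f: "L.linear_on F f"
  note f' = L.linear_onD[OF f]
  have "\<exists>h. h \<in> carrier T.quot \<rightarrow> carrier T.quot \<and>
    (\<forall>s\<in>carrier T.quot. \<forall>t\<in>carrier T.quot. h (s \<oplus>\<^bsub>T.quot\<^esub> t) = h s \<oplus>\<^bsub>T.quot\<^esub> h t) \<and>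
    (\<forall>x\<in>carrier (L \<times>\<times> A). h (T.cls x) = (case x of (a, b) \<Rightarrow> T.cls (f a, b)))"
    by (rule bilinear_universal[OF T.Q.is_abelian_group])
      (use f' in \<open>auto simp: cls_add_left cls_add_right cls_smult linear_smult[OF f]\<close>)
  then obtain h where h: "h \<in> carrier T.quot \<rightarrow> carrier T.quot"
    "\<forall>s\<in>carrier T.quot. \<forall>t\<in>carrier T.quot. h (s \<oplus>\<^bsub>T.quot\<^esub> t) = h s \<oplus>\<^bsub>T.quot\<^esub> h t"
    "\<forall>x\<in>carrier (L \<times>\<times> A). h (T.cls x) = (case x of (a, b) \<Rightarrow> T.cls (f a, b))"
    by (elim exE conjE)
  have "h (inl l \<otimes>\<^bsub>T.quot\<^esub> inr a) = inl (f l) \<otimes>\<^bsub>T.quot\<^esub> inr a" if "l \<in> carrier L" "a \<in> carrier A" for l a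
    using bspec[OF h(3), of "(l, a)"] that f'(1) by (simp add: inl_inr)
  then show "\<exists>h. h \<in> carrier T.quot \<rightarrow> carrier T.quot \<and>
        (\<forall>s\<in>carrier T.quot. \<forall>t\<in>carrier T.quot. h (s \<oplus>\<^bsub>T.quot\<^esub> t) = h s \<oplus>\<^bsub>T.quot\<^esub> h t) \<and>
        (\<forall>l\<in>carrier L. \<forall>a\<in>inr ` carrier A. h (inl l \<otimes>\<^bsub>T.quot\<^esub> a) = inl (f l) \<otimes>\<^bsub>T.quot\<^esub> a)"
    using h(1,2) by (intro exI[of _ h]) simp
qed

lemma carrier_quot: "carrier T.quot = LD.compositum (carrier L)"
proof
  note sub = LD.compositum_subring[OF L.carrier_is_subring]
  show "LD.compositum (carrier L) \<subseteq> carrier T.quot" by (rule subringE(1)[OF sub])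
  show "carrier T.quot \<subseteq> LD.compositum (carrier L)"
  proof
    fix t assume "t \<in> carrier T.quot"
    then show "t \<in> LD.compositum (carrier L)"
    proof (induction rule: T.quot_induct)
      case (cls x)
      then obtain l a where "x = (l, a)" "l \<in> carrier L" "a \<in> carrier A" by auto
      then show ?case
        using LD.compositum_product[of "carrier L" l "inr a"] by (simp add: inl_inr)
    qed (use subringE[OF sub] in auto)
  qed
qed

lemma inr_reduced:
  assumes "reduced_ring A"
  shows "T.Q.no_nilpotents (inr ` carrier A)"
  unfolding T.Q.no_nilpotents_def
proof (intro ballI allI impI)
  fix x and n :: nat assume "x \<in> inr ` carrier A" "x [^]\<^bsub>T.quot\<^esub> n = \<zero>\<^bsub>T.quot\<^esub>"
  then obtain a where a: "a \<in> carrier A" "x = inr a" "inr a [^]\<^bsub>T.quot\<^esub> n = \<zero>\<^bsub>T.quot\<^esub>" by blast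
  then have "inr (a [^]\<^bsub>A\<^esub> n) = inr \<zero>\<^bsub>A\<^esub>" by (simp add: inr.hom_pow)
  then have "a [^]\<^bsub>A\<^esub> n = \<zero>\<^bsub>A\<^esub>" using inj_onD[OF inj_inr] a(1) by simp
  then show "x = \<zero>\<^bsub>T.quot\<^esub>" using assms a by (auto simp: reduced_ring_def)
qed

lemma maclane_imp_reduced:
  assumes "maclane" "reduced_ring A"
  shows "reduced_ring (tensor_product K L A)"
proof -
  have "T.Q.no_nilpotents (LD.compositum (carrier L))"
    by (rule LD.compositum_reduced[OF _ inr_reduced[OF assms(2)]])
      (use assms(1) in \<open>simp add: maclane_def\<close>)
  then show ?thesis
    using T.Q.no_nilpotents_carrier carrier_quot by (simp add: quot_eq)
qed

end

section \<open>Comparison of separability with Mac Lane's criterion\<close>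

context field_ext
begin

lemma maclane_imp_separable:
  assumes "maclane"
  shows "separable_extension TYPE('u) K L"
  unfolding separable_extension_def
proof (intro allI impI)
  fix A :: "('k, 'l list + 'u) module"
  assume A: "algebra K A \<and> reduced_ring A"
  interpret kA: algebra K A using A by simp
  interpret A: cring A by (rule kA.M_cring)
  interpret tensor_algebra K L A ..
  show "reduced_ring (tensor_product K L A)"
    using maclane_imp_reduced assms A by blast
qed

text \<open>
  The test algebra is \<open>K\<close> itself with scalars acting through the Frobenius map; it stands in for
  \<open>K\<^sup>1\<^sup>/\<^sup>p\<close>. Its carrier is a copy of \<open>K\<close> made of singleton lists, since the test
  algebras for separability live on \<open>'l list + 'u\<close>.
\<close>

definition (in -) box :: "'l \<Rightarrow> 'l list + 'u"
  where "box x = Inl [x]"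

definition (in -) unbox :: "'l list + 'u \<Rightarrow> 'l"
  where "unbox u = hd (projl u)"

lemma (in -) unbox_box [simp]: "unbox (box x) = x"
  by (simp add: box_def unbox_def)

lemma (in -) box_eq_iff [simp]: "box x = box y \<longleftrightarrow> x = y"
  by (simp add: box_def)

definition frobenius_algebra :: "nat \<Rightarrow> ('k, 'l list + 'u) module"
  where "frobenius_algebra p =
    \<lparr>carrier = box ` F,
     monoid.mult = (\<lambda>u v. box (unbox u \<otimes>\<^bsub>L\<^esub> unbox v)),
     one = box \<one>\<^bsub>L\<^esub>,
     ring.zero = box \<zero>\<^bsub>L\<^esub>,
     ring.add = (\<lambda>u v. box (unbox u \<oplus>\<^bsub>L\<^esub> unbox v)),
     smult = (\<lambda>k u. box (emb k [^]\<^bsub>L\<^esub> p \<otimes>\<^bsub>L\<^esub> unbox u))\<rparr>"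

lemma frobenius_algebra_simps:
  "carrier (frobenius_algebra p) = box ` F"
  "u \<otimes>\<^bsub>frobenius_algebra p\<^esub> v = box (unbox u \<otimes>\<^bsub>L\<^esub> unbox v)"
  "\<one>\<^bsub>frobenius_algebra p\<^esub> = box \<one>\<^bsub>L\<^esub>"
  "\<zero>\<^bsub>frobenius_algebra p\<^esub> = box \<zero>\<^bsub>L\<^esub>"
  "u \<oplus>\<^bsub>frobenius_algebra p\<^esub> v = box (unbox u \<oplus>\<^bsub>L\<^esub> unbox v)"
  "k \<odot>\<^bsub>(frobenius_algebra p :: ('k, 'l list + 'u) module)\<^esub> u = box (emb k [^]\<^bsub>L\<^esub> p \<otimes>\<^bsub>L\<^esub> unbox u)"
  by (simp_all add: frobenius_algebra_def)

lemma frobenius_algebra_pow: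
  "frobenius_algebra p = (A :: ('k, 'l list + 'u) module) \<Longrightarrow> box x [^]\<^bsub>A\<^esub> (n::nat) = box (x [^]\<^bsub>L\<^esub> n)"
  by (induction n) (auto simp: frobenius_algebra_simps nat_pow_def)

lemma algebra_frobenius_algebra:
  assumes p: "Factorial_Ring.prime p" "add_pow L p \<one>\<^bsub>L\<^esub> = \<zero>\<^bsub>L\<^esub>"
  shows "algebra K (frobenius_algebra p :: ('k, 'l list + 'u) module)"
proof -
  let ?A = "frobenius_algebra p :: ('k, 'l list + 'u) module"
  note F = subringE[OF subfieldE(1)[OF subfield_F]]
  have Fc: "x \<in> carrier L" if "x \<in> F" for x using that F_carrier by blast
  have pow: "emb k [^]\<^bsub>L\<^esub> p \<in> F" if "k \<in> carrier K" for k
  proof -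
    have "emb k [^]\<^bsub>L\<^esub> (n::nat) \<in> F" for n
      by (induction n) (use that F(3,6) in \<open>auto simp: F_eq\<close>)
    then show ?thesis .
  qed
  have ag: "abelian_group ?A"
  proof (rule abelian_groupI)
    fix u assume "u \<in> carrier ?A"
    then obtain x where x: "u = box x" "x \<in> F" by (auto simp: frobenius_algebra_simps)
    then show "\<exists>v\<in>carrier ?A. v \<oplus>\<^bsub>?A\<^esub> u = \<zero>\<^bsub>?A\<^esub>"
      using F(5)[OF x(2)] Fc[OF x(2)]
      by (intro bexI[of _ "box (\<ominus>\<^bsub>L\<^esub> x)"]) (auto simp: frobenius_algebra_simps L.l_neg)
  qed (auto simp: frobenius_algebra_simps Fc F L.a_ac intro!: imageI)
  have cm: "comm_monoid ?A"
    by (rule comm_monoidI) (auto simp: frobenius_algebra_simps Fc F L.m_ac intro!: imageI)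
  have cr: "cring ?A"
    by (rule cringI[OF ag cm]) (auto simp: frobenius_algebra_simps Fc L.l_distr)
  show ?thesis
  proof (rule algebraI[OF K.is_cring cr])
    show "(a \<oplus>\<^bsub>K\<^esub> b) \<odot>\<^bsub>?A\<^esub> u = a \<odot>\<^bsub>?A\<^esub> u \<oplus>\<^bsub>?A\<^esub> b \<odot>\<^bsub>?A\<^esub> u"
      if "a \<in> carrier K" "b \<in> carrier K" "u \<in> carrier ?A" for a b u
      using that L.freshman[OF p] by (auto simp: frobenius_algebra_simps Fc L.l_distr)
    show "(a \<otimes>\<^bsub>K\<^esub> b) \<odot>\<^bsub>?A\<^esub> u = a \<odot>\<^bsub>?A\<^esub> (b \<odot>\<^bsub>?A\<^esub> u)"
      if "a \<in> carrier K" "b \<in> carrier K" "u \<in> carrier ?A" for a b u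
      using that by (auto simp: frobenius_algebra_simps Fc L.nat_pow_distrib L.m_assoc)
    show "a \<odot>\<^bsub>?A\<^esub> u \<in> carrier ?A" if "a \<in> carrier K" "u \<in> carrier ?A" for a u
      using that F(6)[OF pow] by (auto simp: frobenius_algebra_simps)
  qed (auto simp: frobenius_algebra_simps Fc L.r_distr L.m_assoc)
qed

lemma reduced_frobenius_algebra: "reduced_ring (frobenius_algebra p :: ('k, 'l list + 'u) module)"
  unfolding reduced_ring_def
proof (intro ballI impI)
  let ?A = "frobenius_algebra p :: ('k, 'l list + 'u) module"
  fix u assume u: "u \<in> carrier ?A" "\<exists>n::nat. u [^]\<^bsub>?A\<^esub> n = \<zero>\<^bsub>?A\<^esub>"
  obtain x where x: "u = box x" "x \<in> F" using u(1) by (auto simp: frobenius_algebra_simps)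
  obtain n :: nat where "u [^]\<^bsub>?A\<^esub> n = \<zero>\<^bsub>?A\<^esub>" using u(2) by blast
  then have "box (x [^]\<^bsub>L\<^esub> n) = (box \<zero>\<^bsub>L\<^esub> :: 'l list + 'u)"
    unfolding x(1) frobenius_algebra_pow[OF refl] by (simp only: frobenius_algebra_simps)
  then have "x [^]\<^bsub>L\<^esub> n = \<zero>\<^bsub>L\<^esub>" by simp
  then have "x = \<zero>\<^bsub>L\<^esub>" using L.domain_pow_zero x(2) F_carrier by blast
  then show "u = \<zero>\<^bsub>?A\<^esub>" using x(1) by (simp add: frobenius_algebra_simps)
qed

text \<open>A relation among the \<open>u_i^p\<close> with coefficients \<open>x_i\<close> is the
  \<open>p\<close>-th power of the tensor formed from the \<open>u_i\<close> and the
  \<open>x_i\<close>, the latter read in the Frobenius algebra. That tensor vanishes by reducedness,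
  and linear disjointness over \<open>F\<close> makes every \<open>x_i\<close> zero.\<close>

lemma separable_imp_maclane:
  assumes sep: "separable_extension TYPE('u) K L"
  shows "maclane"
  unfolding maclane_def
proof (intro allI impI)
  fix p :: nat and us
  assume p: "Factorial_Ring.prime (p::nat)" "add_pow L p \<one>\<^bsub>L\<^esub> = \<zero>\<^bsub>L\<^esub>" and us: "L.independent F us"
  define A where "A = (frobenius_algebra p :: ('k, 'l list + 'u) module)"
  have alg: "algebra K A" and redA: "reduced_ring A"
    unfolding A_def by (rule algebra_frobenius_algebra[OF p], rule reduced_frobenius_algebra)
  interpret kA: algebra K A by (rule alg)
  interpret A: cring A by (rule kA.M_cring)
  interpret tensor_algebra K L A ..
  have red: "reduced_ring T.quot"
    using sep alg redA by (simp add: separable_extension_def quot_eq)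
  have pT: "add_pow T.quot p \<one>\<^bsub>T.quot\<^esub> = \<zero>\<^bsub>T.quot\<^esub>"
    using LD.\<iota>.hom_add_pow_one[of p] p(2) by simp
  have usc: "set us \<subseteq> carrier L" by (rule L.independent_in_carrier[OF us])
  have boxA: "box x \<in> carrier A" if "x \<in> F" for x
    using that by (simp add: A_def frobenius_algebra_simps)
  \<comment> \<open>In the test algebra, \<open>x^p\<close> is the scalar \<open>x\<close> applied
    to one, so it can cross the tensor sign and become \<open>x\<close> in the left factor.\<close>
  have frob: "inr (box x) [^]\<^bsub>T.quot\<^esub> p = inl x" if x: "x \<in> F" for x
  proof -
    obtain k where k: "k \<in> carrier K" "x = emb k" using x by (auto simp: F_eq)
    have "inr (box x) [^]\<^bsub>T.quot\<^esub> p = inr (box (x [^]\<^bsub>L\<^esub> p))"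
      using inr.hom_pow[OF boxA[OF x], of p] frobenius_algebra_pow[OF A_def[symmetric], of x p]
      by (simp only:)
    also have "box (x [^]\<^bsub>L\<^esub> p) = k \<odot>\<^bsub>A\<^esub> \<one>\<^bsub>A\<^esub>"
      using k by (simp add: A_def frobenius_algebra_simps)
    also have "inr (k \<odot>\<^bsub>A\<^esub> \<one>\<^bsub>A\<^esub>) = inl x" using k by (simp add: inl_emb)
    finally show ?thesis .
  qed
  have comb: "T.Q.combine (map (\<lambda>x. x [^]\<^bsub>T.quot\<^esub> p) (map (\<lambda>x. inr (box x)) xs)) (map (\<lambda>x. x [^]\<^bsub>T.quot\<^esub> p) (map inl us))
      = inl (L.combine xs (map (\<lambda>x. x [^]\<^bsub>L\<^esub> p) us))" if xs: "set xs \<subseteq> F" for xs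
  proof -
    have 1: "map (\<lambda>x. x [^]\<^bsub>T.quot\<^esub> p) (map (\<lambda>x. inr (box x)) xs) = map inl xs"
      using xs frob by auto
    have 2: "map (\<lambda>x. x [^]\<^bsub>T.quot\<^esub> p) (map inl us) = map inl (map (\<lambda>x. x [^]\<^bsub>L\<^esub> p) us)"
      using usc by (auto simp: LD.\<iota>.hom_pow)
    show ?thesis
      unfolding 1 2 by (rule LD.\<iota>.combine_hom) (use xs F_carrier usc in auto)
  qed
  show "L.independent F (map (\<lambda>x. x [^]\<^bsub>L\<^esub> p) us)"
  proof (rule L.trivial_combine_imp_independent[OF subfield_F])
    show "set (map (\<lambda>x. x [^]\<^bsub>L\<^esub> p) us) \<subseteq> carrier L" using usc by auto
    fix xs0 assume xs0: "set xs0 \<subseteq> F" "L.combine xs0 (map (\<lambda>x. x [^]\<^bsub>L\<^esub> p) us) = \<zero>\<^bsub>L\<^esub>"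
    \<comment> \<open>The coefficient list of the independence test may have any length; truncation
      and padding with zeros adjust it to \<open>us\<close> without changing the
      combination.\<close>
    define xs where "xs = take (length us) xs0 @ replicate (length us - length xs0) \<zero>\<^bsub>L\<^esub>"
    have len: "length xs = length us" by (simp add: xs_def)
    have xs: "set xs \<subseteq> F"
      using xs0(1) subringE(2)[OF subfieldE(1)[OF subfield_F]] by (auto simp: xs_def dest: in_set_takeD)
    have z: "L.combine xs (map (\<lambda>x. x [^]\<^bsub>L\<^esub> p) us) = \<zero>\<^bsub>L\<^esub>"
    proof -
      have "set (map (\<lambda>x. x [^]\<^bsub>L\<^esub> p) us) \<subseteq> carrier L" using usc by auto
      then show ?thesis
        using xs0(2) L.combine_take[of "map (\<lambda>x. x [^]\<^bsub>L\<^esub> p) us" xs0]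
        unfolding xs_def by (subst L.combine_append_replicate) simp_all
    qed
    let ?bs = "map (\<lambda>x. inr (box x)) xs"
    let ?t = "T.Q.combine ?bs (map inl us)"
    have bs: "set ?bs \<subseteq> inr ` carrier A" using xs boxA by auto
    have bsc: "set ?bs \<subseteq> carrier T.quot" and uic: "set (map inl us) \<subseteq> carrier T.quot"
      using bs usc by auto
    have "?t [^]\<^bsub>T.quot\<^esub> p = inl \<zero>\<^bsub>L\<^esub>"
      unfolding T.Q.frobenius_combine[OF p(1) pT bsc uic] comb[OF xs] z ..
    then have "?t = \<zero>\<^bsub>T.quot\<^esub>"
      using red T.Q.combine_in_carrier[OF bsc uic] by (auto simp: reduced_ring_def)
    then have "set ?bs \<subseteq> {\<zero>\<^bsub>T.quot\<^esub>}"
      using bs len LD.compositum_K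
      by (intro LD.independent_over_compositum[OF subfield_F order_refl us]) simp_all
    then have "inr (box x) = inr \<zero>\<^bsub>A\<^esub>" if "x \<in> set xs" for x using that by auto
    then have "box x = \<zero>\<^bsub>A\<^esub>" if "x \<in> set xs" for x
      using that inj_onD[OF inj_inr, of "box x" "\<zero>\<^bsub>A\<^esub>"] boxA xs by auto
    then have "set xs \<subseteq> {\<zero>\<^bsub>L\<^esub>}" by (auto simp: A_def frobenius_algebra_simps)
    then show "set (take (length (map (\<lambda>x. x [^]\<^bsub>L\<^esub> p) us)) xs0) \<subseteq> {\<zero>\<^bsub>L\<^esub>}"
      by (auto simp: xs_def)
  qed
qed

end

section \<open>Tensor powers\<close>

locale tensor_powers = field_ext K L
  for K :: "('k, 'r) ring_scheme" and L :: "('k, 'l, 'm) module_scheme" +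
  fixes n :: nat
  assumes n_pos: "n \<ge> 1"
begin

abbreviation tuples :: "(nat \<Rightarrow> 'l) set"
  where "tuples \<equiv> (\<Pi>\<^sub>E j\<in>{..<n}. carrier L)"

abbreviation tuple_monoid :: "(nat \<Rightarrow> 'l) monoid"
  where "tuple_monoid \<equiv> product_group {..<n} (\<lambda>_. L)"

section \<open>Tuples, relations and multilinear maps\<close>

lemma tuples_upd: "x \<in> tuples \<Longrightarrow> i < n \<Longrightarrow> a \<in> carrier L \<Longrightarrow> x(i := a) \<in> tuples"
  by (auto simp: PiE_iff extensional_def)

lemma tuples_nth: "x \<in> tuples \<Longrightarrow> i < n \<Longrightarrow> x i \<in> carrier L"
  by (auto simp: PiE_iff)

lemma mult_upd:
  "i < n \<Longrightarrow> x \<otimes>\<^bsub>tuple_monoid\<^esub> y(i := a) = (x \<otimes>\<^bsub>tuple_monoid\<^esub> y)(i := x i \<otimes>\<^bsub>L\<^esub> a)"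
  by (auto simp: restrict_def)

lemma mult_nth: "i < n \<Longrightarrow> (x \<otimes>\<^bsub>tuple_monoid\<^esub> y) i = x i \<otimes>\<^bsub>L\<^esub> y i"
  by simp

lemma comm_monoid_tuples: "comm_monoid tuple_monoid"
proof (rule comm_monoidI)
  fix x y z assume xyz: "x \<in> carrier tuple_monoid" "y \<in> carrier tuple_monoid" "z \<in> carrier tuple_monoid"
  show "x \<otimes>\<^bsub>tuple_monoid\<^esub> y \<in> carrier tuple_monoid"
    using xyz by (auto simp: PiE_iff)
  show "x \<otimes>\<^bsub>tuple_monoid\<^esub> y \<otimes>\<^bsub>tuple_monoid\<^esub> z = x \<otimes>\<^bsub>tuple_monoid\<^esub> (y \<otimes>\<^bsub>tuple_monoid\<^esub> z)"
    using xyz by (auto simp: PiE_iff L.m_assoc intro!: restrict_ext)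
  show "x \<otimes>\<^bsub>tuple_monoid\<^esub> y = y \<otimes>\<^bsub>tuple_monoid\<^esub> x"
    using xyz by (auto simp: PiE_iff L.m_comm intro!: restrict_ext)
  show "\<one>\<^bsub>tuple_monoid\<^esub> \<otimes>\<^bsub>tuple_monoid\<^esub> x = x"
    using xyz by (auto simp: PiE_iff extensional_def restrict_def)
qed (auto simp: PiE_iff)

sublocale T: monoid_ring_quotient tuple_monoid "tensor_power_rels K L n"
proof -
  interpret P: comm_monoid tuple_monoid by (rule comm_monoid_tuples)
  show "monoid_ring_quotient tuple_monoid (tensor_power_rels K L n)"
  proof
    fix s assume s: "s \<in> tensor_power_rels K L n"
    have smult: "k \<odot>\<^bsub>L\<^esub> x i \<in> carrier L" if "k \<in> carrier K" "x \<in> tuples" "i < n" for k x i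
      using that tuples_nth by (intro alg.smult_closed) auto
    from s consider
      x i a b where "s = frag_of (x(i := a \<oplus>\<^bsub>L\<^esub> b)) - frag_of (x(i := a)) - frag_of (x(i := b))"
        "x \<in> tuples" "i < n" "a \<in> carrier L" "b \<in> carrier L"
      | x i j k where "s = frag_of (x(i := k \<odot>\<^bsub>L\<^esub> x i)) - frag_of (x(j := k \<odot>\<^bsub>L\<^esub> x j))"
        "x \<in> tuples" "i < n" "j < n" "k \<in> carrier K"
      unfolding tensor_power_rels_def by blast
    note cases = this
    show "Poly_Mapping.keys s \<subseteq> carrier tuple_monoid"
      using cases
    proof cases
      case 1
      then have "x(i := a \<oplus>\<^bsub>L\<^esub> b) \<in> tuples" "x(i := a) \<in> tuples" "x(i := b) \<in> tuples"
        by (simp_all add: tuples_upd del: PiE_iff)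
      then show ?thesis
        unfolding 1(1) carrier_product_group
        by (intro order_trans[OF keys_diff] Un_least) (simp_all del: PiE_iff)
    next
      case 2
      then have "x(i := k \<odot>\<^bsub>L\<^esub> x i) \<in> tuples" "x(j := k \<odot>\<^bsub>L\<^esub> x j) \<in> tuples"
        by (simp_all add: tuples_upd smult del: PiE_iff)
      then show ?thesis
        unfolding 2(1) carrier_product_group
        by (intro order_trans[OF keys_diff] Un_least) (simp_all del: PiE_iff)
    qed
    fix m assume "m \<in> carrier tuple_monoid"
    then have m: "m \<in> tuples" by simp
    have mx: "m \<otimes>\<^bsub>tuple_monoid\<^esub> x \<in> tuples" if "x \<in> tuples" for x
      using P.m_closed[of m x] m that by (simp only: carrier_product_group)
    show "frag_of m \<otimes>\<^bsub>monoid_ring tuple_monoid\<^esub> s \<in> tensor_power_rels K L n"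
      using cases
    proof cases
      case 1
      let ?z = "m \<otimes>\<^bsub>tuple_monoid\<^esub> x"
      have mi: "m i \<in> carrier L" by (rule tuples_nth[OF m 1(3)])
      have "frag_of m \<otimes>\<^bsub>monoid_ring tuple_monoid\<^esub> s
        = frag_of (?z(i := m i \<otimes>\<^bsub>L\<^esub> a \<oplus>\<^bsub>L\<^esub> m i \<otimes>\<^bsub>L\<^esub> b)) - frag_of (?z(i := m i \<otimes>\<^bsub>L\<^esub> a)) - frag_of (?z(i := m i \<otimes>\<^bsub>L\<^esub> b))"
        unfolding 1(1) P.frag_of_mult_diff mult_upd[OF 1(3)] L.r_distr[OF 1(4,5) mi] ..
      moreover have "m i \<otimes>\<^bsub>L\<^esub> a \<in> carrier L" "m i \<otimes>\<^bsub>L\<^esub> b \<in> carrier L" using mi 1 by auto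
      ultimately show ?thesis using mx[OF 1(2)] 1(3) unfolding tensor_power_rels_def by blast
    next
      case 2
      let ?z = "m \<otimes>\<^bsub>tuple_monoid\<^esub> x"
      have sc: "m i \<otimes>\<^bsub>L\<^esub> (k \<odot>\<^bsub>L\<^esub> x i) = k \<odot>\<^bsub>L\<^esub> ?z i" if "i < n" for i
        unfolding mult_nth[OF that]
        using alg.smult_assoc2[OF 2(5) tuples_nth[OF 2(2) that] tuples_nth[OF m that]]
          smult[OF 2(5,2) that] tuples_nth[OF 2(2) that] tuples_nth[OF m that]
        by (simp only: L.m_comm)
      have "frag_of m \<otimes>\<^bsub>monoid_ring tuple_monoid\<^esub> s
        = frag_of (?z(i := k \<odot>\<^bsub>L\<^esub> ?z i)) - frag_of (?z(j := k \<odot>\<^bsub>L\<^esub> ?z j))"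
        unfolding 2(1) P.frag_of_mult_diff mult_upd[OF 2(3)] mult_upd[OF 2(4)] sc[OF 2(3)] sc[OF 2(4)] ..
      then show ?thesis using mx[OF 2(2)] 2(3,4,5) unfolding tensor_power_rels_def by blast
    qed
  qed
qed

lemma quot_eq: "T.quot = tensor_power K L n"
  by (simp add: tensor_power_def T.rel_ideal_def)

lemma cls_closed: "x \<in> tuples \<Longrightarrow> T.cls x \<in> carrier T.quot"
  by (rule T.cls_closed) simp

lemma cls_add:
  assumes "x \<in> tuples" "i < n" "a \<in> carrier L" "b \<in> carrier L"
  shows "T.cls (x(i := a \<oplus>\<^bsub>L\<^esub> b)) = T.cls (x(i := a)) \<oplus>\<^bsub>T.quot\<^esub> T.cls (x(i := b))"
proof (rule T.cls_addI)
  show "frag_of (x(i := a \<oplus>\<^bsub>L\<^esub> b)) - frag_of (x(i := a)) - frag_of (x(i := b)) \<in> tensor_power_rels K L n"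
    unfolding tensor_power_rels_def using assms by blast
qed (use tuples_upd[OF assms(1,2)] assms(3,4) in \<open>simp_all del: PiE_iff\<close>)

lemma cls_smult:
  assumes "x \<in> tuples" "i < n" "j < n" "k \<in> carrier K"
  shows "T.cls (x(i := k \<odot>\<^bsub>L\<^esub> x i)) = T.cls (x(j := k \<odot>\<^bsub>L\<^esub> x j))"
proof (rule T.cls_eqI)
  show "frag_of (x(i := k \<odot>\<^bsub>L\<^esub> x i)) - frag_of (x(j := k \<odot>\<^bsub>L\<^esub> x j)) \<in> tensor_power_rels K L n"
    unfolding tensor_power_rels_def using assms by blast
qed (use tuples_upd[OF assms(1)] assms tuples_nth[OF assms(1)] alg.smult_closed in \<open>simp_all del: PiE_iff\<close>)

lemma multilinear_universal:
  assumes G: "abelian_group G"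
    and f: "\<And>x. x \<in> tuples \<Longrightarrow> f x \<in> carrier G"
    and add: "\<And>x i a b. x \<in> tuples \<Longrightarrow> i < n \<Longrightarrow> a \<in> carrier L \<Longrightarrow> b \<in> carrier L \<Longrightarrow>
        f (x(i := a \<oplus>\<^bsub>L\<^esub> b)) = f (x(i := a)) \<oplus>\<^bsub>G\<^esub> f (x(i := b))"
    and smult: "\<And>x i j k. x \<in> tuples \<Longrightarrow> i < n \<Longrightarrow> j < n \<Longrightarrow> k \<in> carrier K \<Longrightarrow>
        f (x(i := k \<odot>\<^bsub>L\<^esub> x i)) = f (x(j := k \<odot>\<^bsub>L\<^esub> x j))"
  shows "\<exists>h. h \<in> carrier T.quot \<rightarrow> carrier G \<and>
    (\<forall>s\<in>carrier T.quot. \<forall>t\<in>carrier T.quot. h (s \<oplus>\<^bsub>T.quot\<^esub> t) = h s \<oplus>\<^bsub>G\<^esub> h t) \<and>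
    (\<forall>x\<in>tuples. h (T.cls x) = f x)"
proof -
  have "\<exists>h. h \<in> carrier T.quot \<rightarrow> carrier G \<and>
    (\<forall>s\<in>carrier T.quot. \<forall>t\<in>carrier T.quot. h (s \<oplus>\<^bsub>T.quot\<^esub> t) = h s \<oplus>\<^bsub>G\<^esub> h t) \<and>
    (\<forall>x\<in>carrier tuple_monoid. h (T.cls x) = f x)"
  proof (rule T.quot_universal[OF G])
    show "f x \<in> carrier G" if "x \<in> carrier tuple_monoid" for x
      using that f by simp
    fix s assume "s \<in> tensor_power_rels K L n"
    then consider
      x i a b where "s = frag_of (x(i := a \<oplus>\<^bsub>L\<^esub> b)) - frag_of (x(i := a)) - frag_of (x(i := b))"
        "x \<in> tuples" "i < n" "a \<in> carrier L" "b \<in> carrier L"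
      | x i j k where "s = frag_of (x(i := k \<odot>\<^bsub>L\<^esub> x i)) - frag_of (x(j := k \<odot>\<^bsub>L\<^esub> x j))"
        "x \<in> tuples" "i < n" "j < n" "k \<in> carrier K"
      unfolding tensor_power_rels_def by blast
    then show "(\<exists>x y z. x \<in> carrier tuple_monoid \<and> y \<in> carrier tuple_monoid \<and> z \<in> carrier tuple_monoid \<and>
           s = frag_of z - frag_of x - frag_of y \<and> f z = f x \<oplus>\<^bsub>G\<^esub> f y) \<or>
        (\<exists>x y. x \<in> carrier tuple_monoid \<and> y \<in> carrier tuple_monoid \<and> s = frag_of x - frag_of y \<and> f x = f y)"
    proof cases
      case 1
      show ?thesis
        unfolding carrier_product_group
        by (rule disjI1, intro exI[of _ "x(i := a)"] exI[of _ "x(i := b)"] exI[of _ "x(i := a \<oplus>\<^bsub>L\<^esub> b)"] conjI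
            tuples_upd[OF 1(2)] L.a_closed add[OF 1(2-5)] 1)
    next
      case 2
      show ?thesis
        unfolding carrier_product_group
        by (rule disjI2, intro exI[of _ "x(i := k \<odot>\<^bsub>L\<^esub> x i)"] exI[of _ "x(j := k \<odot>\<^bsub>L\<^esub> x j)"] conjI
            tuples_upd[OF 2(2)] alg.smult_closed tuples_nth[OF 2(2)] smult[OF 2(2-5)] 2)
    qed
  qed
  then show ?thesis unfolding carrier_product_group .
qed

section \<open>Coprojections and partial tensor powers\<close>

definition slot :: "nat \<Rightarrow> 'l \<Rightarrow> ((nat \<Rightarrow> 'l) \<Rightarrow>\<^sub>0 int) set"
  where "slot j l = T.cls (\<one>\<^bsub>tuple_monoid\<^esub>(j := l))"

lemma one_tuple: "\<one>\<^bsub>tuple_monoid\<^esub> \<in> tuples"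
  by auto

lemma slot_closed: "j < n \<Longrightarrow> l \<in> carrier L \<Longrightarrow> slot j l \<in> carrier T.quot"
  unfolding slot_def by (rule cls_closed[OF tuples_upd[OF one_tuple]])

lemma slot_cls:
  assumes "j < n" "l \<in> carrier L" "x \<in> tuples"
  shows "slot j l \<otimes>\<^bsub>T.quot\<^esub> T.cls x = T.cls (x(j := l \<otimes>\<^bsub>L\<^esub> x j))"
proof -
  have "\<one>\<^bsub>tuple_monoid\<^esub>(j := l) \<otimes>\<^bsub>tuple_monoid\<^esub> x = x(j := l \<otimes>\<^bsub>L\<^esub> x j)"
  proof
    fix i
    show "(\<one>\<^bsub>tuple_monoid\<^esub>(j := l) \<otimes>\<^bsub>tuple_monoid\<^esub> x) i = (x(j := l \<otimes>\<^bsub>L\<^esub> x j)) i"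
      using assms by (cases "i < n") (auto simp: PiE_iff extensional_def)
  qed
  then show ?thesis
    unfolding slot_def using T.cls_mult[of "\<one>\<^bsub>tuple_monoid\<^esub>(j := l)" x] assms tuples_upd[OF one_tuple assms(1,2)]
    by (simp only: carrier_product_group)
qed

lemma slot_hom:
  assumes j: "j < n"
  shows "slot j \<in> ring_hom L T.quot"
proof (rule ring_hom_memI)
  show "slot j x \<in> carrier T.quot" if "x \<in> carrier L" for x using slot_closed[OF j that] .
  show "slot j (x \<otimes>\<^bsub>L\<^esub> y) = slot j x \<otimes>\<^bsub>T.quot\<^esub> slot j y" if "x \<in> carrier L" "y \<in> carrier L" for x y
    using slot_cls[OF j that(1) tuples_upd[OF one_tuple j that(2)]] by (simp add: slot_def)
  show "slot j (x \<oplus>\<^bsub>L\<^esub> y) = slot j x \<oplus>\<^bsub>T.quot\<^esub> slot j y" if "x \<in> carrier L" "y \<in> carrier L" for x y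
    unfolding slot_def by (rule cls_add[OF one_tuple j that])
  have "\<one>\<^bsub>tuple_monoid\<^esub>(j := \<one>\<^bsub>L\<^esub>) = \<one>\<^bsub>tuple_monoid\<^esub>" using j by auto
  then show "slot j \<one>\<^bsub>L\<^esub> = \<one>\<^bsub>T.quot\<^esub>" unfolding slot_def using T.cls_one by (simp only:)
qed

lemma slot_F:
  assumes "i < n" "j < n" "c \<in> F"
  shows "slot i c = slot j c"
proof -
  obtain k where k: "k \<in> carrier K" "c = k \<odot>\<^bsub>L\<^esub> \<one>\<^bsub>L\<^esub>" using assms(3) by (auto simp: base_field_def)
  show ?thesis
    using cls_smult[OF one_tuple assms(1,2) k(1)] assms(1,2) unfolding slot_def k(2) by simp
qed

text \<open>\<open>part j\<close> is spanned by the tensors \<open>x\<^sub>0 \<otimes> \<cdots> \<otimes> x\<^sub>j\<^sub>-\<^sub>1 \<otimes> 1 \<otimes> \<cdots> \<otimes> 1\<close> over \<open>K\<close>.\<close>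

inductive_set part :: "nat \<Rightarrow> ((nat \<Rightarrow> 'l) \<Rightarrow>\<^sub>0 int) set set" for j :: nat
  where zero: "\<zero>\<^bsub>T.quot\<^esub> \<in> part j"
  | add: "s \<in> part j \<Longrightarrow> t \<in> part j \<Longrightarrow> s \<oplus>\<^bsub>T.quot\<^esub> t \<in> part j"
  | minus: "s \<in> part j \<Longrightarrow> \<ominus>\<^bsub>T.quot\<^esub> s \<in> part j"
  | cls: "x \<in> tuples \<Longrightarrow> (\<And>i. j \<le> i \<Longrightarrow> i < n \<Longrightarrow> x i \<in> F) \<Longrightarrow> T.cls x \<in> part j"

lemma part_carrier: "s \<in> part j \<Longrightarrow> s \<in> carrier T.quot"
  by (induction rule: part.induct) (auto intro: cls_closed)

lemma part_mult:
  assumes s: "s \<in> part j" and t: "t \<in> part j"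
  shows "s \<otimes>\<^bsub>T.quot\<^esub> t \<in> part j"
  using s
proof (induction rule: part.induct)
  case zero
  then show ?case using part_carrier[OF t] part.zero by simp
next
  case (add a b)
  then show ?case using part_carrier[OF t] part_carrier part.add by (simp add: T.Q.l_distr)
next
  case (minus a)
  then show ?case using part_carrier[OF t] part_carrier part.minus by (simp add: T.Q.l_minus)
next
  case (cls x)
  note xc = cls_closed[OF cls(1)]
  show ?case using t
  proof (induction rule: part.induct)
    case zero
    then show ?case using xc part.zero by simp
  next
    case (add a b)
    then show ?case using xc part_carrier part.add by (simp add: T.Q.r_distr)
  next
    case (minus a)
    then show ?case using xc part_carrier part.minus by (simp add: T.Q.r_minus)
  next
    case (cls y)
    have xy: "x \<otimes>\<^bsub>tuple_monoid\<^esub> y \<in> tuples"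
      using monoid.m_closed[OF comm_monoid.axioms(1)[OF comm_monoid_tuples], of x y] \<open>x \<in> tuples\<close> \<open>y \<in> tuples\<close>
      by (simp only: carrier_product_group)
    have "T.cls (x \<otimes>\<^bsub>tuple_monoid\<^esub> y) \<in> part j"
    proof (rule part.cls[OF xy])
      fix i assume "j \<le> i" "i < n"
      then show "(x \<otimes>\<^bsub>tuple_monoid\<^esub> y) i \<in> F"
        unfolding mult_nth[OF \<open>i < n\<close>]
        by (intro subringE(6)[OF subfieldE(1)[OF subfield_F]] cls(2) \<open>\<And>i. j \<le> i \<Longrightarrow> i < n \<Longrightarrow> x i \<in> F\<close>)
    qed
    then show ?case
      using T.cls_mult[of x y] \<open>x \<in> tuples\<close> \<open>y \<in> tuples\<close> by (simp only: carrier_product_group)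
  qed
qed

lemma part_subring: "subring (part j) T.quot"
proof (rule T.Q.subringI)
  have "T.cls \<one>\<^bsub>tuple_monoid\<^esub> \<in> part j"
    using subringE(3)[OF subfieldE(1)[OF subfield_F]] by (intro part.cls[OF one_tuple]) simp
  then show "\<one>\<^bsub>T.quot\<^esub> \<in> part j" using T.cls_one by simp
qed (auto intro: part.intros part_mult part_carrier)

lemma slot_part:
  assumes "i < j" "i < n" "l \<in> carrier L"
  shows "slot i l \<in> part j"
  unfolding slot_def
proof (rule part.cls[OF tuples_upd[OF one_tuple assms(2,3)]])
  fix k assume "j \<le> k" "k < n"
  then show "(\<one>\<^bsub>tuple_monoid\<^esub>(i := l)) k \<in> F"
    using assms(1) subringE(3)[OF subfieldE(1)[OF subfield_F]] by simp
qed

lemma slot_F_part: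
  assumes "i < n" "c \<in> F"
  shows "slot i c \<in> part j"
  unfolding slot_def
proof (rule part.cls[OF tuples_upd[OF one_tuple assms(1)]])
  show "c \<in> carrier L" using assms(2) F_carrier by blast
  fix k assume "j \<le> k" "k < n"
  then show "(\<one>\<^bsub>tuple_monoid\<^esub>(i := c)) k \<in> F"
    using assms(2) subringE(3)[OF subfieldE(1)[OF subfield_F]] by simp
qed

text \<open>The contraction applies \<open>f\<close> in slot \<open>j\<close> alone. On a generator
  of \<open>part j\<close> this slot holds an element of \<open>F\<close>, which the linear map
  \<open>f\<close> lets pass, so the contraction only touches the factor coming from
  \<open>slot j\<close>.\<close>

lemma linearly_disjoint_part:
  assumes j: "j < n"
  shows "linearly_disjoint T.quot L F (slot j) (part j)"
proof (intro linearly_disjoint.intro linearly_disjoint_axioms.intro)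
  show "cring T.quot" by (rule T.Q.is_cring)
  show "field L" by (rule L.field_axioms)
  show "subfield F L" by (rule subfield_F)
  show "slot j \<in> ring_hom L T.quot" by (rule slot_hom[OF j])
  show "subring (part j) T.quot" by (rule part_subring)
  show "slot j ` F \<subseteq> part j" using slot_F_part[OF j] by blast
  fix f assume f: "L.linear_on F f"
  note f' = L.linear_onD[OF f]
  define g where "g x = x(j := f (x j))" for x :: "nat \<Rightarrow> 'l"
  have g: "g x \<in> tuples" if "x \<in> tuples" for x
    unfolding g_def using that j tuples_nth f'(1) by (intro tuples_upd) auto
  have g_upd: "g (x(i := a)) = (g x)(i := if i = j then f a else a)" for x i a
    by (auto simp: g_def)
  have g_nth: "g x i = (if i = j then f (x i) else x i)" for x i
    by (auto simp: g_def)
  have g_smult: "g (x(i := k \<odot>\<^bsub>L\<^esub> x i)) = (g x)(i := k \<odot>\<^bsub>L\<^esub> g x i)"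
    if "x \<in> tuples" "i < n" "k \<in> carrier K" for x i k
    using linear_smult[OF f that(3) tuples_nth[OF that(1,2)]] unfolding g_upd g_nth by (cases "i = j") auto
  have "\<exists>h. h \<in> carrier T.quot \<rightarrow> carrier T.quot \<and>
    (\<forall>s\<in>carrier T.quot. \<forall>t\<in>carrier T.quot. h (s \<oplus>\<^bsub>T.quot\<^esub> t) = h s \<oplus>\<^bsub>T.quot\<^esub> h t) \<and>
    (\<forall>x\<in>tuples. h (T.cls x) = T.cls (g x))"
  proof (rule multilinear_universal[OF T.Q.is_abelian_group])
    show "T.cls (g x) \<in> carrier T.quot" if "x \<in> tuples" for x
      using cls_closed[OF g[OF that]] .
    show "T.cls (g (x(i := a \<oplus>\<^bsub>L\<^esub> b))) = T.cls (g (x(i := a))) \<oplus>\<^bsub>T.quot\<^esub> T.cls (g (x(i := b)))"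
      if "x \<in> tuples" "i < n" "a \<in> carrier L" "b \<in> carrier L" for x i a b
      unfolding g_upd
      using cls_add[OF g[OF that(1)] that(2-4)]
        cls_add[OF g[OF that(1)] that(2) f'(1)[OF that(3)] f'(1)[OF that(4)]] f'(2)[OF that(3,4)]
      by (cases "i = j") simp_all
    show "T.cls (g (x(i := k \<odot>\<^bsub>L\<^esub> x i))) = T.cls (g (x(i' := k \<odot>\<^bsub>L\<^esub> x i')))"
      if "x \<in> tuples" "i < n" "i' < n" "k \<in> carrier K" for x i i' k
      unfolding g_smult[OF that(1,2,4)] g_smult[OF that(1,3,4)]
      by (rule cls_smult[OF g[OF that(1)] that(2,3,4)])
  qed
  then obtain h where h: "h \<in> carrier T.quot \<rightarrow> carrier T.quot"
    and h': "\<forall>s\<in>carrier T.quot. \<forall>t\<in>carrier T.quot. h (s \<oplus>\<^bsub>T.quot\<^esub> t) = h s \<oplus>\<^bsub>T.quot\<^esub> h t"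
      "\<forall>x\<in>tuples. h (T.cls x) = T.cls (g x)"
    by (elim exE conjE)
  note h = h bspec[OF bspec[OF h'(1)]] bspec[OF h'(2)]
  have h_zero: "h \<zero>\<^bsub>T.quot\<^esub> = \<zero>\<^bsub>T.quot\<^esub>"
  proof -
    have "h \<zero>\<^bsub>T.quot\<^esub> \<in> carrier T.quot" using h(1) by auto
    moreover have "h \<zero>\<^bsub>T.quot\<^esub> \<oplus>\<^bsub>T.quot\<^esub> h \<zero>\<^bsub>T.quot\<^esub> = h \<zero>\<^bsub>T.quot\<^esub> \<oplus>\<^bsub>T.quot\<^esub> \<zero>\<^bsub>T.quot\<^esub>"
      using h(2)[of "\<zero>\<^bsub>T.quot\<^esub>" "\<zero>\<^bsub>T.quot\<^esub>"] calculation by simp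
    ultimately show ?thesis using T.Q.add.l_cancel by blast
  qed
  have h_minus: "h (\<ominus>\<^bsub>T.quot\<^esub> s) = \<ominus>\<^bsub>T.quot\<^esub> h s" if "s \<in> carrier T.quot" for s
  proof -
    have "h (\<ominus>\<^bsub>T.quot\<^esub> s) \<oplus>\<^bsub>T.quot\<^esub> h s = \<zero>\<^bsub>T.quot\<^esub>"
      using h(2)[of "\<ominus>\<^bsub>T.quot\<^esub> s" s] that h_zero by (simp add: T.Q.l_neg)
    moreover have "h (\<ominus>\<^bsub>T.quot\<^esub> s) \<in> carrier T.quot" "h s \<in> carrier T.quot"
      using h(1) that by auto
    ultimately show ?thesis by (simp add: T.Q.minus_equality)
  qed
  have "h (slot j l \<otimes>\<^bsub>T.quot\<^esub> a) = slot j (f l) \<otimes>\<^bsub>T.quot\<^esub> a" if l: "l \<in> carrier L" and a: "a \<in> part j" for l a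
    using a
  proof (induction rule: part.induct)
    case zero
    then show ?case using slot_closed[OF j] l f'(1) h_zero by simp
  next
    case (add s t)
    then show ?case using slot_closed[OF j] l f'(1) part_carrier h(2) by (simp add: T.Q.r_distr)
  next
    case (minus s)
    then show ?case using slot_closed[OF j] l f'(1) part_carrier h_minus by (simp add: T.Q.r_minus)
  next
    case (cls x)
    have xj: "x j \<in> F" "x j \<in> carrier L" using cls(2) j tuples_nth[OF cls(1) j] by auto
    have fx: "f (l \<otimes>\<^bsub>L\<^esub> x j) = f l \<otimes>\<^bsub>L\<^esub> x j"
      using f'(3)[OF xj(1) l] xj(2) l f'(1) by (simp add: L.m_comm)
    have "h (slot j l \<otimes>\<^bsub>T.quot\<^esub> T.cls x) = T.cls (g (x(j := l \<otimes>\<^bsub>L\<^esub> x j)))"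
      unfolding slot_cls[OF j l cls(1)] using xj l by (intro h(3) tuples_upd[OF cls(1) j]) simp
    also have "g (x(j := l \<otimes>\<^bsub>L\<^esub> x j)) = x(j := f l \<otimes>\<^bsub>L\<^esub> x j)"
      by (simp add: g_def fx)
    also have "T.cls \<dots> = slot j (f l) \<otimes>\<^bsub>T.quot\<^esub> T.cls x"
      using slot_cls[OF j f'(1)[OF l] cls(1)] by simp
    finally show ?case .
  qed
  then show "\<exists>h. h \<in> carrier T.quot \<rightarrow> carrier T.quot \<and>
        (\<forall>s\<in>carrier T.quot. \<forall>t\<in>carrier T.quot. h (s \<oplus>\<^bsub>T.quot\<^esub> t) = h s \<oplus>\<^bsub>T.quot\<^esub> h t) \<and>
        (\<forall>l\<in>carrier L. \<forall>a\<in>part j. h (slot j l \<otimes>\<^bsub>T.quot\<^esub> a) = slot j (f l) \<otimes>\<^bsub>T.quot\<^esub> a)"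
    using h(1,2) by (intro exI[of _ h]) simp
qed

text \<open>The scalars are moved into slot 0 one at a time, always from the last slot that may
  still differ from one. Slot 0 accumulates their product.\<close>

lemma scalar_tuple:
  assumes "x \<in> tuples" "\<And>i. i < n \<Longrightarrow> x i \<in> F" "\<And>i. m \<le> i \<Longrightarrow> i < n \<Longrightarrow> x i = \<one>\<^bsub>L\<^esub>" "m \<le> n"
  shows "\<exists>c\<in>F. T.cls x = slot 0 c"
  using assms
proof (induction m arbitrary: x)
  case 0
  have "x = \<one>\<^bsub>tuple_monoid\<^esub>(0 := \<one>\<^bsub>L\<^esub>)"
  proof
    fix i show "x i = (\<one>\<^bsub>tuple_monoid\<^esub>(0 := \<one>\<^bsub>L\<^esub>)) i"
      using 0(1,3) n_pos by (cases "i < n") (auto simp: PiE_iff extensional_def)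
  qed
  then have "T.cls x = slot 0 \<one>\<^bsub>L\<^esub>" by (simp only: slot_def)
  then show ?case using subringE(3)[OF subfieldE(1)[OF subfield_F]] by blast
next
  case (Suc m)
  show ?case
  proof (cases "m = 0")
    case True
    have "x = \<one>\<^bsub>tuple_monoid\<^esub>(0 := x 0)"
    proof
      fix i show "x i = (\<one>\<^bsub>tuple_monoid\<^esub>(0 := x 0)) i"
        using Suc.prems(1,3) True n_pos by (cases "i < n") (auto simp: PiE_iff extensional_def)
    qed
    then have "T.cls x = slot 0 (x 0)" unfolding slot_def by (rule arg_cong)
    then show ?thesis using Suc.prems(2)[of 0] n_pos by auto
  next
    case False
    have m: "m < n" using Suc.prems(4) by simp
    obtain k where k: "k \<in> carrier K" "x m = k \<odot>\<^bsub>L\<^esub> \<one>\<^bsub>L\<^esub>"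
      using Suc.prems(2)[OF m] by (auto simp: base_field_def)
    define y where "y = x(m := \<one>\<^bsub>L\<^esub>)"
    have y: "y \<in> tuples" unfolding y_def by (rule tuples_upd[OF Suc.prems(1) m]) simp
    have "x = y(m := k \<odot>\<^bsub>L\<^esub> y m)" using k(2) by (auto simp: y_def)
    then have "T.cls x = T.cls (y(0 := k \<odot>\<^bsub>L\<^esub> y 0))"
      using cls_smult[OF y m _ k(1), of 0] n_pos by simp
    moreover have y0: "y 0 \<in> F" "y 0 = x 0" using Suc.prems(2)[of 0] False n_pos by (auto simp: y_def)
    have "k \<odot>\<^bsub>L\<^esub> y 0 = emb k \<otimes>\<^bsub>L\<^esub> y 0" using k(1) y0 F_carrier by (intro smult_emb) auto
    then have ky: "k \<odot>\<^bsub>L\<^esub> y 0 \<in> F"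
      using subringE(6)[OF subfieldE(1)[OF subfield_F] _ y0(1), of "emb k"] k(1) by (simp add: F_eq)
    have "\<exists>c\<in>F. T.cls (y(0 := k \<odot>\<^bsub>L\<^esub> y 0)) = slot 0 c"
    proof (rule Suc.IH)
      show "y(0 := k \<odot>\<^bsub>L\<^esub> y 0) \<in> tuples"
        using ky F_carrier n_pos by (intro tuples_upd[OF y]) auto
      show "(y(0 := k \<odot>\<^bsub>L\<^esub> y 0)) i \<in> F" if "i < n" for i
        using that ky Suc.prems(2)[OF that] subringE(3)[OF subfieldE(1)[OF subfield_F]] by (simp add: y_def)
      show "(y(0 := k \<odot>\<^bsub>L\<^esub> y 0)) i = \<one>\<^bsub>L\<^esub>" if "m \<le> i" "i < n" for i
        using that False Suc.prems(3)[of i] by (simp add: y_def)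
      show "m \<le> n" using m by simp
    qed
    ultimately show ?thesis by simp
  qed
qed

lemma part_0:
  assumes "t \<in> part 0"
  shows "\<exists>c\<in>F. t = slot 0 c"
proof -
  have 0: "0 < n" using n_pos by simp
  interpret slot: ring_hom_ring L T.quot "slot 0"
    by (rule ring_hom_ringI2[OF L.ring_axioms T.Q.ring_axioms slot_hom[OF 0]])
  note F = subringE[OF subfieldE(1)[OF subfield_F]]
  show ?thesis using assms
  proof (induction rule: part.induct)
    case zero
    then show ?case using F(2) slot.hom_zero by metis
  next
    case (add s t)
    then obtain c d where cd: "c \<in> F" "d \<in> F" "s = slot 0 c" "t = slot 0 d" by blast
    then have "s \<oplus>\<^bsub>T.quot\<^esub> t = slot 0 (c \<oplus>\<^bsub>L\<^esub> d)" using F_carrier by (simp add: subset_iff)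
    then show ?case using F(7) cd by blast
  next
    case (minus s)
    then obtain c where c: "c \<in> F" "s = slot 0 c" by blast
    then have "\<ominus>\<^bsub>T.quot\<^esub> s = slot 0 (\<ominus>\<^bsub>L\<^esub> c)" using F_carrier by (simp add: subset_iff)
    then show ?case using F(5) c by blast
  next
    case (cls x)
    then show ?case by (intro scalar_tuple[of x n]) auto
  qed
qed

text \<open>\<open>part 0\<close> is the image of a field. The tensor power is not yet known to be
  nontrivial, so the argument allows for collapse: if a unit of \<open>L\<close> is sent to zero,
  then one equals zero and \<open>t = 0\<close> all the same.\<close>

lemma part_0_reduced: "T.Q.no_nilpotents (part 0)"
  unfolding T.Q.no_nilpotents_def
proof (intro ballI allI impI)
  fix t and m :: nat assume t: "t \<in> part 0" "t [^]\<^bsub>T.quot\<^esub> m = \<zero>\<^bsub>T.quot\<^esub>"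
  have 0: "0 < n" using n_pos by simp
  interpret slot: ring_hom_ring L T.quot "slot 0"
    by (rule ring_hom_ringI2[OF L.ring_axioms T.Q.ring_axioms slot_hom[OF 0]])
  obtain c where c: "c \<in> carrier L" "t = slot 0 c" using part_0[OF t(1)] F_carrier by blast
  show "t = \<zero>\<^bsub>T.quot\<^esub>"
  proof (cases "c = \<zero>\<^bsub>L\<^esub>")
    case True
    then show ?thesis using c by simp
  next
    case False
    define d where "d = c [^]\<^bsub>L\<^esub> m"
    have d: "d \<in> carrier L" "d \<noteq> \<zero>\<^bsub>L\<^esub>" "slot 0 d = \<zero>\<^bsub>T.quot\<^esub>"
      using c False L.domain_pow_zero[OF c(1), of m] t(2) by (auto simp: d_def slot.hom_pow)
    then have i: "inv\<^bsub>L\<^esub> d \<in> carrier L" "inv\<^bsub>L\<^esub> d \<otimes>\<^bsub>L\<^esub> d = \<one>\<^bsub>L\<^esub>" using L.field_Units by auto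
    have "\<one>\<^bsub>T.quot\<^esub> = slot 0 (inv\<^bsub>L\<^esub> d) \<otimes>\<^bsub>T.quot\<^esub> slot 0 d"
      using slot.hom_mult[OF i(1) d(1)] unfolding i(2) by simp
    then have "\<one>\<^bsub>T.quot\<^esub> = \<zero>\<^bsub>T.quot\<^esub>" using d(3) slot.hom_closed[OF i(1)] by simp
    then show ?thesis using part_carrier[OF t(1)] T.Q.l_one[of t] T.Q.l_null[of t] by simp
  qed
qed

text \<open>\<open>part (Suc j)\<close> lies in the compositum of the \<open>j\<close>-th factor
  \<open>L\<close> with \<open>part j\<close>: a generating tensor is split into its entry in slot
  \<open>j\<close> and the tensor with that entry replaced by one.\<close>

lemma part_reduced:
  assumes maclane
  shows "j \<le> n \<Longrightarrow> T.Q.no_nilpotents (part j)"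
proof (induction j)
  case 0
  then show ?case using part_0_reduced by simp
next
  case (Suc j)
  then have j: "j < n" by simp
  interpret LD: linearly_disjoint T.quot L F "slot j" "part j"
    by (rule linearly_disjoint_part[OF j])
  note sub = LD.compositum_subring[OF L.carrier_is_subring]
  have "T.Q.no_nilpotents (LD.compositum (carrier L))"
    by (rule LD.compositum_reduced) (use assms Suc in \<open>simp_all add: maclane_def\<close>)
  moreover have "part (Suc j) \<subseteq> LD.compositum (carrier L)"
  proof
    fix t assume "t \<in> part (Suc j)"
    then show "t \<in> LD.compositum (carrier L)"
    proof (induction rule: part.induct)
      case (cls x)
      have xj: "x j \<in> carrier L" by (rule tuples_nth[OF cls(1) j])
      let ?y = "x(j := \<one>\<^bsub>L\<^esub>)"
      have y: "?y \<in> tuples" by (rule tuples_upd[OF cls(1) j]) simp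
      have yF: "?y i \<in> F" if "j \<le> i" "i < n" for i
        using cls(2)[of i] that subringE(3)[OF subfieldE(1)[OF subfield_F]] by (cases "i = j") auto
      have "T.cls x = slot j (x j) \<otimes>\<^bsub>T.quot\<^esub> T.cls ?y"
        unfolding slot_cls[OF j xj y] using xj by simp
      then show ?case
        using LD.compositum_product[OF order_refl xj part.cls[OF y yF]] by (simp only:)
    qed (use subringE(2,5,7)[OF sub] in auto)
  qed
  ultimately show ?case using T.Q.no_nilpotents_mono by blast
qed

lemma carrier_part: "carrier T.quot \<subseteq> part n"
proof
  fix t assume "t \<in> carrier T.quot"
  then show "t \<in> part n"
  proof (induction rule: T.quot_induct)
    case (cls x)
    then have "x \<in> tuples" by simp
    then show ?case by (rule part.cls) simp
  qed (auto intro: part.intros)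
qed

theorem maclane_imp_reduced:
  assumes maclane
  shows "reduced_ring (tensor_power K L n)"
  using T.Q.no_nilpotents_mono[OF part_reduced[OF assms order_refl] carrier_part]
    T.Q.no_nilpotents_carrier by (simp add: quot_eq)

end

section \<open>Antisymmetric tensors\<close>

lemma (in cring) freshman_finsum:
  assumes p: "Factorial_Ring.prime (p::nat)" "add_pow R p \<one> = \<zero>" and "finite A" "f \<in> A \<rightarrow> carrier R"
  shows "finsum R f A [^] p = finsum R (\<lambda>x. f x [^] p) A"
  using assms(3,4)
proof (induction A rule: finite_induct)
  case empty
  then show ?case using prime_gt_0_nat[OF p(1)] by (simp add: nat_pow_zero)
next
  case (insert a A)
  have c: "f a \<in> carrier R" "finsum R f A \<in> carrier R" using insert.prems by (auto intro!: finsum_closed)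
  have "finsum R f (insert a A) [^] p = (f a \<oplus> finsum R f A) [^] p"
    using insert by (subst finsum_insert) auto
  also have "\<dots> = f a [^] p \<oplus> finsum R (\<lambda>x. f x [^] p) A"
    using freshman[OF p c] insert by auto
  also have "\<dots> = finsum R (\<lambda>x. f x [^] p) (insert a A)"
    using insert by (subst finsum_insert) auto
  finally show ?case .
qed

lemma (in cring) add_diff_add:
  assumes "a \<in> carrier R" "b \<in> carrier R" "a' \<in> carrier R" "b' \<in> carrier R"
  shows "(a \<oplus> a') \<ominus> (b \<oplus> b') = (a \<ominus> b) \<oplus> (a' \<ominus> b')"
  using assms by algebra

lemma (in cring) r_diff_distr:
  assumes "a \<in> carrier R" "b \<in> carrier R" "c \<in> carrier R"
  shows "c \<otimes> (a \<ominus> b) = c \<otimes> a \<ominus> c \<otimes> b"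
  using assms by algebra

lemma additive_finsum:
  assumes "abelian_group G" "abelian_group H" and h: "h \<in> carrier G \<rightarrow> carrier H"
    and hadd: "\<forall>s\<in>carrier G. \<forall>t\<in>carrier G. h (s \<oplus>\<^bsub>G\<^esub> t) = h s \<oplus>\<^bsub>H\<^esub> h t"
  shows "h \<zero>\<^bsub>G\<^esub> = \<zero>\<^bsub>H\<^esub>" "s \<in> carrier G \<Longrightarrow> h (\<ominus>\<^bsub>G\<^esub> s) = \<ominus>\<^bsub>H\<^esub> h s"
    "finite A \<Longrightarrow> f \<in> A \<rightarrow> carrier G \<Longrightarrow> h (finsum G f A) = finsum H (\<lambda>x. h (f x)) A"
proof -
  interpret G: abelian_group G by fact
  interpret H: abelian_group H by fact
  note add = bspec[OF bspec[OF hadd]]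
  have hc: "h s \<in> carrier H" if "s \<in> carrier G" for s using h that by blast
  show zero: "h \<zero>\<^bsub>G\<^esub> = \<zero>\<^bsub>H\<^esub>"
    using add[of "\<zero>\<^bsub>G\<^esub>" "\<zero>\<^bsub>G\<^esub>"] hc[of "\<zero>\<^bsub>G\<^esub>"] by simp
  show "h (\<ominus>\<^bsub>G\<^esub> s) = \<ominus>\<^bsub>H\<^esub> h s" if s: "s \<in> carrier G"
    using add[of "\<ominus>\<^bsub>G\<^esub> s" s] hc[of s] hc[of "\<ominus>\<^bsub>G\<^esub> s"] s zero
    by (simp add: G.l_neg H.minus_equality)
  show "h (finsum G f A) = finsum H (\<lambda>x. h (f x)) A" if "finite A" "f \<in> A \<rightarrow> carrier G"
    using that
  proof (induction A rule: finite_induct)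
    case (insert a A)
    then have c: "f a \<in> carrier G" "finsum G f A \<in> carrier G" by (auto intro!: G.finsum_closed)
    have "h (finsum G f (insert a A)) = h (f a \<oplus>\<^bsub>G\<^esub> finsum G f A)"
      using insert by (subst G.finsum_insert) auto
    also have "\<dots> = h (f a) \<oplus>\<^bsub>H\<^esub> finsum H (\<lambda>x. h (f x)) A"
      using add[OF c] insert by auto
    also have "\<dots> = finsum H (\<lambda>x. h (f x)) (insert a A)"
      using insert hc by (subst H.finsum_insert) auto
    finally show ?case .
  qed (simp add: zero)
qed

section \<open>Functionals on tensor powers\<close>

context tensor_powers
begin

text \<open>The tensor product of the functionals, followed by multiplication in \<open>L\<close>. A
  scalar taken from any slot comes out as the same factor of the product, which gives compatibility
  with moving scalars between slots.\<close>

lemma product_functional: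
  assumes \<phi>: "\<And>i. i < n \<Longrightarrow> L.linear_on F (\<phi> i)"
  shows "\<exists>h. h \<in> carrier T.quot \<rightarrow> carrier L \<and>
    (\<forall>s\<in>carrier T.quot. \<forall>t\<in>carrier T.quot. h (s \<oplus>\<^bsub>T.quot\<^esub> t) = h s \<oplus>\<^bsub>L\<^esub> h t) \<and>
    (\<forall>x\<in>tuples. h (T.cls x) = finprod L (\<lambda>i. \<phi> i (x i)) {..<n})"
proof -
  note lin = L.linear_onD[OF \<phi>]
  let ?f = "\<lambda>x. finprod L (\<lambda>i. \<phi> i (x i)) {..<n}"
  \<comment> \<open>The product over the slots other than \<open>i\<close>; it does not see changes
    in slot \<open>i\<close>, which makes linearity in that slot visible.\<close>
  define r where "r x i = finprod L (\<lambda>k. \<phi> k (x k)) ({..<n} - {i})" for x i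
  have r_closed: "r x i \<in> carrier L" if "x \<in> tuples" for x i
    unfolding r_def using that lin(1) tuples_nth by (intro L.finprod_closed) auto
  have upd: "?f (x(i := a)) = \<phi> i a \<otimes>\<^bsub>L\<^esub> r x i" if "x \<in> tuples" "i < n" "a \<in> carrier L" for x i a
  proof -
    have "{..<n} = insert i ({..<n} - {i})" using that(2) by auto
    then have "?f (x(i := a)) = finprod L (\<lambda>k. \<phi> k ((x(i := a)) k)) (insert i ({..<n} - {i}))" by simp
    also have "\<dots> = \<phi> i a \<otimes>\<^bsub>L\<^esub> finprod L (\<lambda>k. \<phi> k ((x(i := a)) k)) ({..<n} - {i})"
      using that lin(1) tuples_nth by (subst L.finprod_insert) auto
    also have "finprod L (\<lambda>k. \<phi> k ((x(i := a)) k)) ({..<n} - {i}) = r x i"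
      unfolding r_def using that lin(1) tuples_nth by (intro L.finprod_cong') auto
    finally show ?thesis .
  qed
  show ?thesis
  proof (rule multilinear_universal[OF L.is_abelian_group])
    show "?f x \<in> carrier L" if "x \<in> tuples" for x
      using that lin(1) tuples_nth by (intro L.finprod_closed) auto
    show "?f (x(i := a \<oplus>\<^bsub>L\<^esub> b)) = ?f (x(i := a)) \<oplus>\<^bsub>L\<^esub> ?f (x(i := b))"
      if "x \<in> tuples" "i < n" "a \<in> carrier L" "b \<in> carrier L" for x i a b
      unfolding upd[OF that(1,2,3)] upd[OF that(1,2,4)] upd[OF that(1,2) L.a_closed[OF that(3,4)]]
      using that lin(1,2) r_closed by (simp add: L.l_distr)
    have sm: "?f (x(i := k \<odot>\<^bsub>L\<^esub> x i)) = emb k \<otimes>\<^bsub>L\<^esub> ?f x"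
      if "x \<in> tuples" "i < n" "k \<in> carrier K" for x i k
    proof -
      have xi: "x i \<in> carrier L" by (rule tuples_nth[OF that(1,2)])
      have "?f (x(i := k \<odot>\<^bsub>L\<^esub> x i)) = \<phi> i (k \<odot>\<^bsub>L\<^esub> x i) \<otimes>\<^bsub>L\<^esub> r x i"
        by (rule upd[OF that(1,2) alg.smult_closed[OF that(3) xi]])
      also have "\<phi> i (k \<odot>\<^bsub>L\<^esub> x i) = emb k \<otimes>\<^bsub>L\<^esub> \<phi> i (x i)"
        unfolding linear_smult[OF \<phi>[OF that(2)] that(3) xi] using smult_emb[OF that(3)] lin(1)[OF that(2) xi] by simp
      also have "emb k \<otimes>\<^bsub>L\<^esub> \<phi> i (x i) \<otimes>\<^bsub>L\<^esub> r x i = emb k \<otimes>\<^bsub>L\<^esub> (\<phi> i (x i) \<otimes>\<^bsub>L\<^esub> r x i)"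
        using that lin(1)[OF that(2) xi] r_closed[OF that(1)] by (simp add: L.m_assoc)
      also have "\<phi> i (x i) \<otimes>\<^bsub>L\<^esub> r x i = ?f x"
        using upd[OF that(1,2) xi] by simp
      finally show ?thesis .
    qed
    show "?f (x(i := k \<odot>\<^bsub>L\<^esub> x i)) = ?f (x(j := k \<odot>\<^bsub>L\<^esub> x j))"
      if "x \<in> tuples" "i < n" "j < n" "k \<in> carrier K" for x i j k
      unfolding sm[OF that(1,2,4)] sm[OF that(1,3,4)] ..
  qed
qed

lemma one_not_zero: "\<one>\<^bsub>T.quot\<^esub> \<noteq> \<zero>\<^bsub>T.quot\<^esub>"
proof
  assume 1: "\<one>\<^bsub>T.quot\<^esub> = \<zero>\<^bsub>T.quot\<^esub>"
  obtain f where f: "L.linear_on F f" "f \<in> carrier L \<rightarrow> F" "f \<one>\<^bsub>L\<^esub> = \<one>\<^bsub>L\<^esub>"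
    using unit_functional by blast
  from product_functional[of "\<lambda>_. f", OF f(1)]
  obtain h where h: "h \<in> carrier T.quot \<rightarrow> carrier L"
    and h': "\<forall>s\<in>carrier T.quot. \<forall>t\<in>carrier T.quot. h (s \<oplus>\<^bsub>T.quot\<^esub> t) = h s \<oplus>\<^bsub>L\<^esub> h t"
      "\<forall>x\<in>tuples. h (T.cls x) = finprod L (\<lambda>i. f (x i)) {..<n}"
    by (elim exE conjE)
  note h = h bspec[OF bspec[OF h'(1)]] bspec[OF h'(2)]
  have "h \<one>\<^bsub>T.quot\<^esub> = finprod L (\<lambda>i. f (\<one>\<^bsub>tuple_monoid\<^esub> i)) {..<n}"
    using h(3)[OF one_tuple] T.cls_one by (simp only:)
  also have "\<dots> = \<one>\<^bsub>L\<^esub>"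
    using f(3) by (intro L.finprod_one_eqI) simp
  finally show False
    using additive_finsum(1)[OF T.Q.is_abelian_group L.is_abelian_group h(1) h'(1)] 1 L.one_not_zero by simp
qed

section \<open>Antisymmetrisation of a tuple\<close>

definition perm_tuple :: "(nat \<Rightarrow> 'l) \<Rightarrow> (nat \<Rightarrow> nat) \<Rightarrow> nat \<Rightarrow> 'l"
  where "perm_tuple v \<sigma> = (\<lambda>i\<in>{..<n}. v (\<sigma> i))"

definition perms :: "bool \<Rightarrow> (nat \<Rightarrow> nat) set"
  where "perms b = {\<sigma>. \<sigma> permutes {..<n} \<and> evenperm \<sigma> = b}"

text \<open>Keeping even and odd permutations apart replaces all signs by a single subtraction.
  Powers are computed in each half separately, and a transposition exchanges the halves.\<close>

definition half :: "bool \<Rightarrow> (nat \<Rightarrow> 'l) \<Rightarrow> ((nat \<Rightarrow> 'l) \<Rightarrow>\<^sub>0 int) set"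
  where "half b v = finsum T.quot (\<lambda>\<sigma>. T.cls (perm_tuple v \<sigma>)) (perms b)"

definition antisym :: "(nat \<Rightarrow> 'l) \<Rightarrow> ((nat \<Rightarrow> 'l) \<Rightarrow>\<^sub>0 int) set"
  where "antisym v = half True v \<ominus>\<^bsub>T.quot\<^esub> half False v"

lemma finite_perms: "finite (perms b)"
  unfolding perms_def by (rule finite_subset[OF _ finite_permutations[of "{..<n}"]]) auto

lemma perms_less: "\<sigma> \<in> perms b \<Longrightarrow> i < n \<Longrightarrow> \<sigma> i < n"
  using permutes_in_image[of \<sigma> "{..<n}" i] by (auto simp: perms_def)

lemma perm_tuple_tuples:
  assumes "\<And>i. i < n \<Longrightarrow> v i \<in> carrier L" "\<sigma> \<in> perms b"
  shows "perm_tuple v \<sigma> \<in> tuples"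
  using assms perms_less[OF assms(2)] by (auto simp: perm_tuple_def)

lemma cls_perm_closed:
  assumes "\<And>i. i < n \<Longrightarrow> v i \<in> carrier L"
  shows "(\<lambda>\<sigma>. T.cls (perm_tuple v \<sigma>)) \<in> perms b \<rightarrow> carrier T.quot"
proof
  fix \<sigma> assume "\<sigma> \<in> perms b"
  then show "T.cls (perm_tuple v \<sigma>) \<in> carrier T.quot"
    by (intro cls_closed perm_tuple_tuples[of v \<sigma> b] assms)
qed

lemma half_closed:
  assumes "\<And>i. i < n \<Longrightarrow> v i \<in> carrier L"
  shows "half b v \<in> carrier T.quot"
  unfolding half_def by (intro T.Q.finsum_closed cls_perm_closed assms)

lemma antisym_pow:
  assumes p: "Factorial_Ring.prime (p::nat)" "add_pow L p \<one>\<^bsub>L\<^esub> = \<zero>\<^bsub>L\<^esub>"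
    and v: "\<And>i. i < n \<Longrightarrow> v i \<in> carrier L"
  shows "antisym v [^]\<^bsub>T.quot\<^esub> p = antisym (\<lambda>i. v i [^]\<^bsub>L\<^esub> p)"
proof -
  have 0: "0 < n" using n_pos by simp
  interpret slot: ring_hom_ring L T.quot "slot 0"
    by (rule ring_hom_ringI2[OF L.ring_axioms T.Q.ring_axioms slot_hom[OF 0]])
  have pT: "add_pow T.quot p \<one>\<^bsub>T.quot\<^esub> = \<zero>\<^bsub>T.quot\<^esub>"
    using slot.hom_add_pow_one[of p] p(2) by simp
  have tuple_pow: "x [^]\<^bsub>tuple_monoid\<^esub> (m::nat) = (\<lambda>i\<in>{..<n}. x i [^]\<^bsub>L\<^esub> m)" if "x \<in> tuples" for x m
    by (induction m) (auto simp: restrict_def nat_pow_def)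
  have half: "half b v [^]\<^bsub>T.quot\<^esub> p = half b (\<lambda>i. v i [^]\<^bsub>L\<^esub> p)" for b
  proof -
    have "half b v [^]\<^bsub>T.quot\<^esub> p = finsum T.quot (\<lambda>\<sigma>. T.cls (perm_tuple v \<sigma>) [^]\<^bsub>T.quot\<^esub> p) (perms b)"
      unfolding half_def by (rule T.Q.freshman_finsum[OF p(1) pT finite_perms cls_perm_closed[OF v]])
    also have "\<dots> = half b (\<lambda>i. v i [^]\<^bsub>L\<^esub> p)"
      unfolding half_def
    proof (rule T.Q.finsum_cong'[OF refl cls_perm_closed])
      show "v i [^]\<^bsub>L\<^esub> p \<in> carrier L" if "i < n" for i using v[OF that] by simp
      fix \<sigma> assume \<sigma>: "\<sigma> \<in> perms b"
      have t: "perm_tuple v \<sigma> \<in> tuples" by (rule perm_tuple_tuples[OF v \<sigma>])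
      have "T.cls (perm_tuple v \<sigma>) [^]\<^bsub>T.quot\<^esub> p = T.cls (perm_tuple v \<sigma> [^]\<^bsub>tuple_monoid\<^esub> p)"
        using t by (intro T.cls_pow) simp
      also have "perm_tuple v \<sigma> [^]\<^bsub>tuple_monoid\<^esub> p = perm_tuple (\<lambda>i. v i [^]\<^bsub>L\<^esub> p) \<sigma>"
        unfolding tuple_pow[OF t] by (auto simp: perm_tuple_def)
      finally show "T.cls (perm_tuple v \<sigma>) [^]\<^bsub>T.quot\<^esub> p = T.cls (perm_tuple (\<lambda>i. v i [^]\<^bsub>L\<^esub> p) \<sigma>)" .
    qed
    finally show ?thesis .
  qed
  have "antisym v [^]\<^bsub>T.quot\<^esub> p = half True v [^]\<^bsub>T.quot\<^esub> p \<oplus>\<^bsub>T.quot\<^esub> (\<ominus>\<^bsub>T.quot\<^esub> half False v) [^]\<^bsub>T.quot\<^esub> p"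
    unfolding antisym_def a_minus_def
    by (rule T.Q.freshman[OF p(1) pT half_closed[OF v] T.Q.a_inv_closed[OF half_closed[OF v]]])
  also have "(\<ominus>\<^bsub>T.quot\<^esub> half False v) [^]\<^bsub>T.quot\<^esub> p = \<ominus>\<^bsub>T.quot\<^esub> (half False v [^]\<^bsub>T.quot\<^esub> p)"
    by (rule T.Q.frobenius_minus[OF p(1) pT half_closed[OF v]])
  finally show ?thesis by (simp only: half antisym_def a_minus_def)
qed

text \<open>Functionals that are triangular on \<open>v\<close> kill all permuted tensors except the one for the identity.\<close>

lemma antisym_nonzero:
  assumes v: "\<And>i. i < n \<Longrightarrow> v i \<in> carrier L"
    and \<phi>: "\<And>i. i < n \<Longrightarrow> L.linear_on F (\<phi> i)" "\<And>i. i < n \<Longrightarrow> \<phi> i (v i) = \<one>\<^bsub>L\<^esub>"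
      "\<And>i j. i < j \<Longrightarrow> j < n \<Longrightarrow> \<phi> i (v j) = \<zero>\<^bsub>L\<^esub>"
  shows "antisym v \<noteq> \<zero>\<^bsub>T.quot\<^esub>"
proof
  assume zero: "antisym v = \<zero>\<^bsub>T.quot\<^esub>"
  have "\<exists>h. h \<in> carrier T.quot \<rightarrow> carrier L \<and>
    (\<forall>s\<in>carrier T.quot. \<forall>t\<in>carrier T.quot. h (s \<oplus>\<^bsub>T.quot\<^esub> t) = h s \<oplus>\<^bsub>L\<^esub> h t) \<and>
    (\<forall>x\<in>tuples. h (T.cls x) = finprod L (\<lambda>i. \<phi> i (x i)) {..<n})"
    by (rule product_functional) (rule \<phi>(1))
  then obtain h where h: "h \<in> carrier T.quot \<rightarrow> carrier L"
    and h': "\<forall>s\<in>carrier T.quot. \<forall>t\<in>carrier T.quot. h (s \<oplus>\<^bsub>T.quot\<^esub> t) = h s \<oplus>\<^bsub>L\<^esub> h t"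
      "\<forall>x\<in>tuples. h (T.cls x) = finprod L (\<lambda>i. \<phi> i (x i)) {..<n}"
    by (elim exE conjE)
  note h = h bspec[OF bspec[OF h'(1)]] bspec[OF h'(2)]
  note hom = additive_finsum[OF T.Q.is_abelian_group L.is_abelian_group h(1) h'(1)]
  have \<phi>c: "\<phi> i (v j) \<in> carrier L" if "i < n" "j < n" for i j
    by (rule L.linear_onD(1)[OF \<phi>(1)[OF that(1)] v[OF that(2)]])
  have value_at: "h (T.cls (perm_tuple v \<sigma>)) = (if id = \<sigma> then \<one>\<^bsub>L\<^esub> else \<zero>\<^bsub>L\<^esub>)" if \<sigma>: "\<sigma> \<in> perms b" for \<sigma> b
  proof -
    have t: "perm_tuple v \<sigma> \<in> tuples" by (rule perm_tuple_tuples[OF v \<sigma>])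
    have eq: "h (T.cls (perm_tuple v \<sigma>)) = finprod L (\<lambda>i. \<phi> i (v (\<sigma> i))) {..<n}"
      unfolding h(3)[OF t]
      using \<phi>c perms_less[OF \<sigma>] by (intro L.finprod_cong') (auto simp: perm_tuple_def)
    show ?thesis
    proof (cases "id = \<sigma>")
      case True
      then show ?thesis unfolding eq using \<phi>(2) by (auto intro!: L.finprod_one_eqI)
    next
      case False
      \<comment> \<open>A permutation with \<open>\<sigma> i \<le> i\<close> throughout is the
        identity. Any other one has an index \<open>i\<close> with \<open>i < \<sigma> i\<close>,
        where the triangular functional produces a zero factor.\<close>
      then have "\<not> (\<forall>i\<in>{..<n}. \<sigma> i \<le> i)"
        using permutes_natset_le[of \<sigma> "{..<n}"] \<sigma> by (auto simp: perms_def)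
      then obtain i where i: "i < n" "i < \<sigma> i" by (auto simp: not_le)
      have "{..<n} = insert i ({..<n} - {i})" using i by auto
      then have "finprod L (\<lambda>i. \<phi> i (v (\<sigma> i))) {..<n} = finprod L (\<lambda>i. \<phi> i (v (\<sigma> i))) (insert i ({..<n} - {i}))"
        by simp
      also have "\<dots> = \<phi> i (v (\<sigma> i)) \<otimes>\<^bsub>L\<^esub> finprod L (\<lambda>i. \<phi> i (v (\<sigma> i))) ({..<n} - {i})"
        using i \<phi>c perms_less[OF \<sigma>] by (subst L.finprod_insert) auto
      also have "\<dots> = \<zero>\<^bsub>L\<^esub>"
        unfolding \<phi>(3)[OF i(2) perms_less[OF \<sigma> i(1)]]
        using \<phi>c perms_less[OF \<sigma>] by (intro L.l_null L.finprod_closed) auto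
      finally show ?thesis using False eq by simp
    qed
  qed
  have half: "h (half b v) = (if b then \<one>\<^bsub>L\<^esub> else \<zero>\<^bsub>L\<^esub>)" for b
  proof -
    have "h (half b v) = finsum L (\<lambda>\<sigma>. h (T.cls (perm_tuple v \<sigma>))) (perms b)"
      unfolding half_def by (rule hom(3)[OF finite_perms], rule cls_perm_closed[OF v])
    also have "\<dots> = finsum L (\<lambda>\<sigma>. if id = \<sigma> then \<one>\<^bsub>L\<^esub> else \<zero>\<^bsub>L\<^esub>) (perms b)"
      by (intro L.finsum_cong' refl) (auto simp: value_at)
    also have "\<dots> = (if b then \<one>\<^bsub>L\<^esub> else \<zero>\<^bsub>L\<^esub>)"
    proof (cases b)
      case True
      then have "id \<in> perms b" by (simp add: perms_def permutes_id)
      then show ?thesis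
        using L.finsum_singleton[OF _ finite_perms, of id b "\<lambda>_. \<one>\<^bsub>L\<^esub>"] True by simp
    next
      case False
      have "id \<notin> perms b" using False by (simp add: perms_def)
      then have "finsum L (\<lambda>\<sigma>. if id = \<sigma> then \<one>\<^bsub>L\<^esub> else \<zero>\<^bsub>L\<^esub>) (perms b) = finsum L (\<lambda>\<sigma>. \<zero>\<^bsub>L\<^esub>) (perms b)"
        by (intro L.finsum_cong' refl) auto
      then show ?thesis using False by simp
    qed
    finally show ?thesis .
  qed
  have hc: "half b v \<in> carrier T.quot" for b by (rule half_closed[OF v])
  have "h (antisym v) = h (half True v) \<oplus>\<^bsub>L\<^esub> \<ominus>\<^bsub>L\<^esub> h (half False v)"
    unfolding antisym_def a_minus_def
    by (subst h(2)) (simp_all add: hc hom(2))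
  then have "h (antisym v) = \<one>\<^bsub>L\<^esub>" using half[of True] half[of False] by simp
  then show False using zero hom(1) L.one_not_zero by simp
qed

text \<open>Each permutation reaches 0 from exactly one index \<open>i\<close>, so a change of
  \<open>v\<close> at 0 changes the permuted tuple in slot \<open>i\<close> only. This makes the
  antisymmetrisation linear in \<open>v 0\<close>.\<close>

lemma perm_tuple_upd:
  assumes \<sigma>: "\<sigma> \<in> perms b"
  obtains i where "i < n" "\<And>a. perm_tuple (v(0 := a)) \<sigma> = (perm_tuple v \<sigma>)(i := a)"
proof -
  have \<sigma>': "\<sigma> permutes {..<n}" using \<sigma> by (simp add: perms_def)
  define i where "i = inv_into UNIV \<sigma> 0"
  have i: "i < n" using permutes_in_image[OF permutes_inv[OF \<sigma>'], of 0] n_pos by (simp add: i_def)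
  have "\<sigma> k = 0 \<longleftrightarrow> k = i" for k
    unfolding i_def using permutes_inverses[OF \<sigma>'] by metis
  then have "perm_tuple (v(0 := a)) \<sigma> = (perm_tuple v \<sigma>)(i := a)" for a
    using i by (auto simp: perm_tuple_def)
  then show ?thesis using that i by blast
qed

context
  fixes v :: "nat \<Rightarrow> 'l"
  assumes v: "\<And>i. i < n \<Longrightarrow> v i \<in> carrier L"
begin

lemma v_upd: "a \<in> carrier L \<Longrightarrow> i < n \<Longrightarrow> (v(0 := a)) i \<in> carrier L"
  using v by simp

lemma half_upd_closed: "a \<in> carrier L \<Longrightarrow> half b (v(0 := a)) \<in> carrier T.quot"
  by (rule half_closed) (rule v_upd)

lemma cls_perm_upd_closed:
  "a \<in> carrier L \<Longrightarrow> (\<lambda>\<sigma>. T.cls (perm_tuple (v(0 := a)) \<sigma>)) \<in> perms b \<rightarrow> carrier T.quot"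
  by (rule cls_perm_closed) (rule v_upd)

lemma half_add:
  assumes a: "a \<in> carrier L" "a' \<in> carrier L"
  shows "half b (v(0 := a \<oplus>\<^bsub>L\<^esub> a')) = half b (v(0 := a)) \<oplus>\<^bsub>T.quot\<^esub> half b (v(0 := a'))"
proof -
  have "half b (v(0 := a \<oplus>\<^bsub>L\<^esub> a')) = finsum T.quot
      (\<lambda>\<sigma>. T.cls (perm_tuple (v(0 := a)) \<sigma>) \<oplus>\<^bsub>T.quot\<^esub> T.cls (perm_tuple (v(0 := a')) \<sigma>)) (perms b)"
    unfolding half_def
  proof (rule T.Q.finsum_cong'[OF refl])
    show "(\<lambda>\<sigma>. T.cls (perm_tuple (v(0 := a)) \<sigma>) \<oplus>\<^bsub>T.quot\<^esub> T.cls (perm_tuple (v(0 := a')) \<sigma>)) \<in> perms b \<rightarrow> carrier T.quot"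
      using cls_perm_upd_closed[OF a(1)] cls_perm_upd_closed[OF a(2)] by (simp add: Pi_iff)
    fix \<sigma> assume \<sigma>: "\<sigma> \<in> perms b"
    obtain i where i: "i < n" "\<And>a. perm_tuple (v(0 := a)) \<sigma> = (perm_tuple v \<sigma>)(i := a)"
      using perm_tuple_upd[OF \<sigma>] by blast
    show "T.cls (perm_tuple (v(0 := a \<oplus>\<^bsub>L\<^esub> a')) \<sigma>)
        = T.cls (perm_tuple (v(0 := a)) \<sigma>) \<oplus>\<^bsub>T.quot\<^esub> T.cls (perm_tuple (v(0 := a')) \<sigma>)"
      unfolding i(2) by (rule cls_add[OF perm_tuple_tuples[OF v \<sigma>] i(1) a])
  qed
  also have "\<dots> = half b (v(0 := a)) \<oplus>\<^bsub>T.quot\<^esub> half b (v(0 := a'))"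
    unfolding half_def by (rule T.Q.finsum_addf[OF cls_perm_upd_closed[OF a(1)] cls_perm_upd_closed[OF a(2)]])
  finally show ?thesis .
qed

text \<open>The slot that receives the scalar depends on the permutation, but an element of
  \<open>F\<close> gives the same tensor in every slot; so it can be taken out of the sum through
  slot 0.\<close>

lemma half_smult:
  assumes a: "a \<in> carrier L" and c: "c \<in> F"
  shows "half b (v(0 := c \<otimes>\<^bsub>L\<^esub> a)) = slot 0 c \<otimes>\<^bsub>T.quot\<^esub> half b (v(0 := a))"
proof -
  have 0: "0 < n" using n_pos by simp
  have cc: "c \<in> carrier L" using c F_carrier by blast
  note sc = slot_closed[OF 0 cc]
  have "slot 0 c \<otimes>\<^bsub>T.quot\<^esub> half b (v(0 := a))
      = finsum T.quot (\<lambda>\<sigma>. slot 0 c \<otimes>\<^bsub>T.quot\<^esub> T.cls (perm_tuple (v(0 := a)) \<sigma>)) (perms b)"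
    unfolding half_def by (rule T.Q.finsum_rdistr[OF finite_perms sc cls_perm_upd_closed[OF a]])
  also have "\<dots> = half b (v(0 := c \<otimes>\<^bsub>L\<^esub> a))"
    unfolding half_def
  proof (rule T.Q.finsum_cong'[OF refl cls_perm_closed[OF v_upd]])
    show "c \<otimes>\<^bsub>L\<^esub> a \<in> carrier L" using cc a by simp
    fix \<sigma> assume \<sigma>: "\<sigma> \<in> perms b"
    obtain i where i: "i < n" "\<And>a. perm_tuple (v(0 := a)) \<sigma> = (perm_tuple v \<sigma>)(i := a)"
      using perm_tuple_upd[OF \<sigma>] by blast
    have t0: "perm_tuple v \<sigma> \<in> tuples" by (rule perm_tuple_tuples[OF v \<sigma>])
    have t: "(perm_tuple v \<sigma>)(i := a) \<in> tuples"
      by (rule tuples_upd[OF t0 i(1) a])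
    have "slot 0 c \<otimes>\<^bsub>T.quot\<^esub> T.cls ((perm_tuple v \<sigma>)(i := a)) = slot i c \<otimes>\<^bsub>T.quot\<^esub> T.cls ((perm_tuple v \<sigma>)(i := a))"
      by (simp only: slot_F[OF 0 i(1) c])
    also have "\<dots> = T.cls ((perm_tuple v \<sigma>)(i := c \<otimes>\<^bsub>L\<^esub> a))"
      unfolding slot_cls[OF i(1) cc t] by simp
    finally show "slot 0 c \<otimes>\<^bsub>T.quot\<^esub> T.cls (perm_tuple (v(0 := a)) \<sigma>) = T.cls (perm_tuple (v(0 := c \<otimes>\<^bsub>L\<^esub> a)) \<sigma>)"
      unfolding i(2) .
  qed
  finally show ?thesis by simp
qed

lemma antisym_add:
  assumes a: "a \<in> carrier L" "a' \<in> carrier L"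
  shows "antisym (v(0 := a \<oplus>\<^bsub>L\<^esub> a')) = antisym (v(0 := a)) \<oplus>\<^bsub>T.quot\<^esub> antisym (v(0 := a'))"
  unfolding antisym_def half_add[OF a]
  by (rule T.Q.add_diff_add) (intro half_upd_closed a)+

lemma antisym_smult:
  assumes a: "a \<in> carrier L" and c: "c \<in> F"
  shows "antisym (v(0 := c \<otimes>\<^bsub>L\<^esub> a)) = slot 0 c \<otimes>\<^bsub>T.quot\<^esub> antisym (v(0 := a))"
proof -
  have "slot 0 c \<in> carrier T.quot" using slot_closed[of 0 c] n_pos c F_carrier by auto
  then show ?thesis
    unfolding antisym_def half_smult[OF a c]
    using half_upd_closed[OF a] by (simp add: T.Q.r_diff_distr)
qed

text \<open>Composition with the transposition of 0 and \<open>j\<close> is a bijection between even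
  and odd permutations and leaves the permuted tuples unchanged. The two halves are thus equal, and
  the conclusion holds in characteristic 2 as well.\<close>

lemma antisym_repeated:
  assumes j: "j < n" "j \<noteq> 0" "v 0 = v j"
  shows "antisym v = \<zero>\<^bsub>T.quot\<^esub>"
proof -
  let ?\<tau> = "Transposition.transpose 0 j"
  have \<tau>: "?\<tau> permutes {..<n}" using j n_pos by (intro permutes_swap_id) auto
  have perm: "permutation \<sigma>" if "\<sigma> permutes {..<n}" for \<sigma>
    using permutes_imp_permutation[OF _ that] by simp
  have ev: "evenperm (?\<tau> \<circ> \<sigma>) \<longleftrightarrow> \<not> evenperm \<sigma>" if "\<sigma> permutes {..<n}" for \<sigma>
    using evenperm_comp[OF perm[OF \<tau>] perm[OF that]] j(2) by (simp add: evenperm_swap)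
  have inv: "?\<tau> \<circ> (?\<tau> \<circ> \<sigma>) = \<sigma>" for \<sigma> :: "nat \<Rightarrow> nat"
    by (simp add: fun_eq_iff)
  have maps: "?\<tau> \<circ> \<sigma> \<in> perms (\<not> b)" if "\<sigma> \<in> perms b" for \<sigma> b
    using that ev[of \<sigma>] permutes_compose[OF _ \<tau>, of \<sigma>] by (auto simp: perms_def)
  have img: "perms False = (\<lambda>\<sigma>. ?\<tau> \<circ> \<sigma>) ` perms True"
  proof
    show "(\<lambda>\<sigma>. ?\<tau> \<circ> \<sigma>) ` perms True \<subseteq> perms False" using maps[of _ True] by auto
    show "perms False \<subseteq> (\<lambda>\<sigma>. ?\<tau> \<circ> \<sigma>) ` perms True"
    proof
      fix \<sigma> assume "\<sigma> \<in> perms False"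
      then have "?\<tau> \<circ> \<sigma> \<in> perms True" using maps[of \<sigma> False] by simp
      then show "\<sigma> \<in> (\<lambda>\<sigma>. ?\<tau> \<circ> \<sigma>) ` perms True" using inv[of \<sigma>] by (metis imageI)
    qed
  qed
  have inj: "inj_on (\<lambda>\<sigma>. ?\<tau> \<circ> \<sigma>) (perms True)"
    by (rule inj_on_inverseI[of _ "\<lambda>\<sigma>. ?\<tau> \<circ> \<sigma>"]) (rule inv)
  have same: "perm_tuple v (?\<tau> \<circ> \<sigma>) = perm_tuple v \<sigma>" for \<sigma>
  proof -
    have "v (?\<tau> k) = v k" for k using j(3) by (cases "k = 0"; cases "k = j") auto
    then show ?thesis by (simp add: perm_tuple_def)
  qed
  have "(\<lambda>\<sigma>. T.cls (perm_tuple v \<sigma>)) \<in> perms False \<rightarrow> carrier T.quot"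
    by (rule cls_perm_closed[OF v])
  then have "half False v = finsum T.quot (\<lambda>\<sigma>. T.cls (perm_tuple v (?\<tau> \<circ> \<sigma>))) (perms True)"
    unfolding half_def img
    by (rule T.Q.finsum_reindex[OF _ inj])
  then have "half False v = half True v" by (simp add: same half_def)
  moreover have "half True v \<in> carrier T.quot" by (rule half_closed[OF v])
  ultimately show ?thesis
    unfolding antisym_def a_minus_def by (simp add: T.Q.r_neg)
qed

end

text \<open>By linearity, the values of \<open>v 0\<close> at which the antisymmetrisation vanishes
  form a subspace. It contains every later entry by \<open>antisym_repeated\<close>, and therefore
  their span.\<close>

lemma antisym_dependent:
  assumes v: "\<And>i. i < n \<Longrightarrow> v i \<in> carrier L"
    and ws: "set ws \<subseteq> v ` {1..<n}" and dep: "v 0 \<in> L.Span F ws"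
  shows "antisym v = \<zero>\<^bsub>T.quot\<^esub>"
proof -
  let ?U = "{a \<in> carrier L. antisym (v(0 := a)) = \<zero>\<^bsub>T.quot\<^esub>}"
  note Fs = subringE[OF subfieldE(1)[OF subfield_F]]
  have 0: "0 < n" using n_pos by simp
  have ac: "antisym (v(0 := a)) \<in> carrier T.quot" if "a \<in> carrier L" for a
    unfolding antisym_def using half_closed[of "v(0 := a)"] v that by (intro T.Q.minus_closed) auto
  have sc: "slot 0 c \<in> carrier T.quot" if "c \<in> F" for c using slot_closed[OF 0, of c] that F_carrier by blast
  interpret slot: ring_hom_ring L T.quot "slot 0"
    by (rule ring_hom_ringI2[OF L.ring_axioms T.Q.ring_axioms slot_hom[OF 0]])
  have sm: "antisym (v(0 := c \<otimes>\<^bsub>L\<^esub> a)) = slot 0 c \<otimes>\<^bsub>T.quot\<^esub> antisym (v(0 := a))"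
    if "a \<in> carrier L" "c \<in> F" for a c
    by (rule antisym_smult[OF v that])
  have sa: "antisym (v(0 := a \<oplus>\<^bsub>L\<^esub> a')) = antisym (v(0 := a)) \<oplus>\<^bsub>T.quot\<^esub> antisym (v(0 := a'))"
    if "a \<in> carrier L" "a' \<in> carrier L" for a a'
    by (rule antisym_add[OF v that])
  have "subalgebra F ?U L"
  proof (rule L.subalgebraI)
    have "antisym (v(0 := \<zero>\<^bsub>L\<^esub> \<otimes>\<^bsub>L\<^esub> \<zero>\<^bsub>L\<^esub>)) = \<zero>\<^bsub>T.quot\<^esub>"
      unfolding sm[OF L.zero_closed Fs(2)] using ac[of "\<zero>\<^bsub>L\<^esub>"] by simp
    then show "\<zero>\<^bsub>L\<^esub> \<in> ?U" by simp
    show "a \<oplus>\<^bsub>L\<^esub> a' \<in> ?U" if "a \<in> ?U" "a' \<in> ?U" for a a'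
      using that sa[of a a'] by simp
    show "c \<otimes>\<^bsub>L\<^esub> a \<in> ?U" if "c \<in> F" "a \<in> ?U" for c a
      using that sm[of a c] sc[OF that(1)] F_carrier by auto
  qed (use Fs F_carrier in auto)
  moreover have "set ws \<subseteq> ?U"
  proof
    fix a assume "a \<in> set ws"
    then obtain j where j: "a = v j" "1 \<le> j" "j < n" using ws by auto
    have "antisym (v(0 := v j)) = \<zero>\<^bsub>T.quot\<^esub>"
    proof (rule antisym_repeated[of _ j])
      show "(v(0 := v j)) i \<in> carrier L" if "i < n" for i using that v j by simp
    qed (use j in auto)
    then show "a \<in> ?U" using j v by simp
  qed
  ultimately have "v 0 \<in> ?U" using L.subalgebra_Span_incl[OF subfield_F] dep by blast
  then show ?thesis by simp
qed

end

section \<open>From reduced tensor powers to the criterion\<close>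

lemma (in ring) independent_drop: "independent K us \<Longrightarrow> independent K (drop i us)"
proof (induction us arbitrary: i rule: list.induct)
  case (Cons u us)
  then show ?case using independent_backwards(2)[OF Cons.prems] by (cases i) auto
qed simp

text \<open>The shortest tail with a dependent image: without its head the image is independent, so
  the image of the head lies in the span of the rest. This puts the dependence into entry 0, where
  \<open>antisym_dependent\<close> expects it.\<close>

lemma (in ring) independent_dependent_image:
  assumes "independent K us" "\<not> independent K (map g us)" "\<And>x. x \<in> carrier R \<Longrightarrow> g x \<in> carrier R"
  obtains u vs where "independent K (u # vs)" "g u \<in> Span K (map g vs)"
proof -
  have "\<exists>u vs. independent K (u # vs) \<and> g u \<in> Span K (map g vs)"
    using assms(1,2)
  proof (induction us rule: list.induct)
    case (Cons u us)
    show ?case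
    proof (cases "independent K (map g us)")
      case True
      have "g u \<in> carrier R" using independent_backwards(3)[OF Cons.prems(1)] assms(3) by blast
      then have "g u \<in> Span K (map g us)" using Cons.prems(2) True li_Cons[of "g u" K "map g us"] by auto
      then show ?thesis using Cons.prems(1) by blast
    next
      case False
      then show ?thesis using Cons.IH independent_backwards(2)[OF Cons.prems(1)] by blast
    qed
  qed simp
  then show ?thesis using that by blast
qed

theorem (in field_ext) tensor_powers_reduced_imp_maclane:
  assumes red: "\<And>n. n \<ge> 1 \<Longrightarrow> reduced_ring (tensor_power K L n)"
  shows maclane
  unfolding maclane_def
proof (intro allI impI)
  fix p :: nat and us
  assume p: "Factorial_Ring.prime p" "add_pow L p \<one>\<^bsub>L\<^esub> = \<zero>\<^bsub>L\<^esub>" and us: "L.independent F us"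
  show "L.independent F (map (\<lambda>x. x [^]\<^bsub>L\<^esub> p) us)"
  proof (rule ccontr)
    assume "\<not> L.independent F (map (\<lambda>x. x [^]\<^bsub>L\<^esub> p) us)"
    then obtain u vs where uvs: "L.independent F (u # vs)"
      "u [^]\<^bsub>L\<^esub> p \<in> L.Span F (map (\<lambda>x. x [^]\<^bsub>L\<^esub> p) vs)"
      using L.independent_dependent_image[OF us] by (metis L.nat_pow_closed)
    define ws where "ws = u # vs"
    define n where "n = length ws"
    have n: "n \<ge> 1" by (simp add: n_def ws_def)
    interpret tensor_powers K L n by unfold_locales (rule n)
    have wsc: "set ws \<subseteq> carrier L" using L.independent_in_carrier[OF uvs(1)] by (simp add: ws_def)
    have v: "ws ! i \<in> carrier L" if "i < n" for i
      using that wsc nth_mem[of i ws] by (auto simp: n_def)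
    \<comment> \<open>The functional for index \<open>i\<close> separates \<open>ws ! i\<close> from
      the span of the later entries, which is possible because every tail of \<open>ws\<close> is
      independent.\<close>
    have "\<exists>f. L.linear_on F f \<and> f (ws ! i) = \<one>\<^bsub>L\<^esub> \<and> (\<forall>j. i < j \<longrightarrow> j < n \<longrightarrow> f (ws ! j) = \<zero>\<^bsub>L\<^esub>)"
      if i: "i < n" for i
    proof -
      have "L.independent F (drop i ws)"
        using L.independent_drop uvs(1) unfolding ws_def .
      then have ind: "L.independent F (ws ! i # drop (Suc i) ws)"
        using Cons_nth_drop_Suc[of i ws] i by (simp add: n_def)
      have dc: "set (drop (Suc i) ws) \<subseteq> carrier L" using wsc set_drop_subset by fast
      obtain f where f: "L.linear_on F f" "f \<in> carrier L \<rightarrow> F"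
        "\<And>v. v \<in> L.Span F (drop (Suc i) ws) \<Longrightarrow> f v = \<zero>\<^bsub>L\<^esub>" "f (ws ! i) = \<one>\<^bsub>L\<^esub>"
        using L.exists_functional[OF subfield_F L.Span_is_subalgebra[OF subfield_F dc]
            v[OF i] L.independent_backwards(1)[OF ind]] by metis
      have "f (ws ! j) = \<zero>\<^bsub>L\<^esub>" if "i < j" "j < n" for j
      proof -
        have "ws ! j = drop (Suc i) ws ! (j - Suc i)" using that by (simp add: n_def)
        moreover have "j - Suc i < length (drop (Suc i) ws)" using that by (simp add: n_def)
        ultimately have "ws ! j \<in> set (drop (Suc i) ws)" using nth_mem by (simp only:)
        then show ?thesis using f(3) L.Span_base_incl[OF subfield_F dc] by blast
      qed
      then show ?thesis using f by blast
    qed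
    then obtain \<phi> where \<phi>: "\<And>i. i < n \<Longrightarrow> L.linear_on F (\<phi> i) \<and> \<phi> i (ws ! i) = \<one>\<^bsub>L\<^esub> \<and>
        (\<forall>j. i < j \<longrightarrow> j < n \<longrightarrow> \<phi> i (ws ! j) = \<zero>\<^bsub>L\<^esub>)"
      by metis
    have nonzero: "antisym (\<lambda>i. ws ! i) \<noteq> \<zero>\<^bsub>T.quot\<^esub>"
      by (rule antisym_nonzero[of _ \<phi>]) (use v \<phi> in auto)
    have "antisym (\<lambda>i. ws ! i) [^]\<^bsub>T.quot\<^esub> p = antisym (\<lambda>i. ws ! i [^]\<^bsub>L\<^esub> p)"
      by (rule antisym_pow[OF p v])
    also have "\<dots> = \<zero>\<^bsub>T.quot\<^esub>"
    proof (rule antisym_dependent)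
      show "ws ! i [^]\<^bsub>L\<^esub> p \<in> carrier L" if "i < n" for i using v[OF that] by simp
      show "ws ! 0 [^]\<^bsub>L\<^esub> p \<in> L.Span F (map (\<lambda>x. x [^]\<^bsub>L\<^esub> p) vs)" using uvs(2) by (simp add: ws_def)
      show "set (map (\<lambda>x. x [^]\<^bsub>L\<^esub> p) vs) \<subseteq> (\<lambda>i. ws ! i [^]\<^bsub>L\<^esub> p) ` {1..<n}"
      proof
        fix a assume "a \<in> set (map (\<lambda>x. x [^]\<^bsub>L\<^esub> p) vs)"
        then obtain k where k: "k < length vs" "a = (vs ! k) [^]\<^bsub>L\<^esub> p" by (auto simp: in_set_conv_nth)
        then show "a \<in> (\<lambda>i. ws ! i [^]\<^bsub>L\<^esub> p) ` {1..<n}"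
          by (intro image_eqI[of _ _ "Suc k"]) (auto simp: ws_def n_def)
      qed
    qed
    finally have "antisym (\<lambda>i. ws ! i) [^]\<^bsub>T.quot\<^esub> p = \<zero>\<^bsub>T.quot\<^esub>" .
    moreover have "antisym (\<lambda>i. ws ! i) \<in> carrier T.quot"
      unfolding antisym_def using half_closed[of "\<lambda>i. ws ! i"] v by (intro T.Q.minus_closed) auto
    moreover have "reduced_ring T.quot" using red[OF n] by (simp add: quot_eq)
    ultimately show False using nonzero by (auto simp: reduced_ring_def)
  qed
qed

section \<open>Algebraic extensions\<close>

text \<open>The cofactor is stated with its leading power of \<open>Y\<close> in evidence, since the
  nonvanishing of an annihilator will later be read off from it.\<close>

lemma (in cring) power_diff_factor:
  assumes B: "subring B R" and Y: "Y \<in> carrier R" and W: "W \<in> B"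
  shows "\<exists>r\<in>polys B Y k. Y [^] Suc k \<ominus> W [^] Suc k = (Y \<ominus> W) \<otimes> (Y [^] k \<oplus> r)"
proof (induction k)
  case 0
  have "W \<in> carrier R" using W subringE(1)[OF B] by blast
  then show ?case using Y by (intro bexI[of _ \<zero>]) (auto simp: zero_polys[OF B Y])
next
  case (Suc k)
  obtain r where r: "r \<in> polys B Y k" "Y [^] Suc k \<ominus> W [^] Suc k = (Y \<ominus> W) \<otimes> (Y [^] k \<oplus> r)"
    using Suc by blast
  have c: "Y \<in> carrier R" "W \<in> carrier R" "r \<in> carrier R" "Y [^] k \<in> carrier R" "Y [^] Suc k \<in> carrier R" "W [^] Suc k \<in> carrier R"
    using Y W subringE(1)[OF B] polys_carrier[OF B Y r(1)] by auto
  have "Y [^] Suc (Suc k) \<ominus> W [^] Suc (Suc k) = (Y \<ominus> W) \<otimes> Y [^] Suc k \<oplus> W \<otimes> (Y [^] Suc k \<ominus> W [^] Suc k)"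
    unfolding nat_pow_Suc[of _ "Suc k"] using c(1,2,5,6) by algebra
  also have "\<dots> = (Y \<ominus> W) \<otimes> (Y [^] Suc k \<oplus> (W \<otimes> Y [^] k \<oplus> W \<otimes> r))"
    unfolding r(2) using c(1-5) by algebra
  finally have "Y [^] Suc (Suc k) \<ominus> W [^] Suc (Suc k) = (Y \<ominus> W) \<otimes> (Y [^] Suc k \<oplus> (W \<otimes> Y [^] k \<oplus> W \<otimes> r))" .
  moreover have "W \<otimes> Y [^] k \<oplus> W \<otimes> r \<in> polys B Y (Suc k)"
    by (rule polys_SucI[OF B Y W polys_smult[OF B Y W r(1)]])
  ultimately show ?case by blast
qed

text \<open>In the application, \<open>h0\<close> and \<open>h1\<close> are the two coprojections
  into the tensor square, which agree on scalars. Two values of one polynomial differ by a multiple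
  of the difference of the arguments, and the cofactor has smaller degree.\<close>

lemma (in cring) polys_diff_factor:
  assumes L: "cring L" and h0: "ring_hom_ring L R h0" and h1: "ring_hom_ring L R h1"
    and F: "subring F L" and y: "y \<in> carrier L" and B: "subring B R" "h0 ` carrier L \<subseteq> B"
    and agree: "\<And>c. c \<in> F \<Longrightarrow> h1 c = h0 c" and q: "q \<in> ring.polys L F y (Suc k)"
  shows "\<exists>r\<in>polys B (h1 y) k. h1 q \<ominus> h0 q = (h1 y \<ominus> h0 y) \<otimes> r"
  using q
proof (induction k arbitrary: q)
  interpret L: cring L by (rule L)
  interpret h0: ring_hom_ring L R h0 by (rule h0)
  interpret h1: ring_hom_ring L R h1 by (rule h1)
  note Fc = subsetD[OF subringE(1)[OF F]]
  note Y = h1.hom_closed[OF y]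
  have W: "h0 y \<in> B" using B(2) y by blast
  {
    case 0
    then obtain c where c: "c \<in> F" "q = c \<otimes>\<^bsub>L\<^esub> \<one>\<^bsub>L\<^esub> \<oplus>\<^bsub>L\<^esub> \<zero>\<^bsub>L\<^esub>" by auto
    then have "q = c" using Fc by simp
    then have "h1 q \<ominus> h0 q = \<zero>" using agree[OF c(1)] Fc[OF c(1)] by (simp add: a_minus_def r_neg)
    then show ?case using Y y by (intro bexI[of _ \<zero>]) auto
  next
    case (Suc k)
    from Suc.prems obtain c q' where q: "q = c \<otimes>\<^bsub>L\<^esub> y [^]\<^bsub>L\<^esub> Suc k \<oplus>\<^bsub>L\<^esub> q'" "c \<in> F" "q' \<in> L.polys F y (Suc k)"
      by auto
    obtain r' where r': "r' \<in> polys B (h1 y) k" "h1 q' \<ominus> h0 q' = (h1 y \<ominus> h0 y) \<otimes> r'"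
      using Suc.IH[OF q(3)] by blast
    obtain r where r: "r \<in> polys B (h1 y) k" "h1 y [^] Suc k \<ominus> h0 y [^] Suc k = (h1 y \<ominus> h0 y) \<otimes> (h1 y [^] k \<oplus> r)"
      using power_diff_factor[OF B(1) Y W] by blast
    note cc = Fc[OF q(2)]
    note q'c = L.polys_carrier[OF F y q(3)]
    have yk: "y [^]\<^bsub>L\<^esub> Suc k \<in> carrier L" using y by (rule L.nat_pow_closed)
    have cB: "h0 c \<in> B" using B(2) cc by blast
    have cl: "h1 y \<in> carrier R" "h0 y \<in> carrier R" "h0 c \<in> carrier R" "h1 y [^] Suc k \<in> carrier R" "h0 y [^] Suc k \<in> carrier R"
        "h1 q' \<in> carrier R" "h0 q' \<in> carrier R" "h1 y [^] k \<in> carrier R" "r \<in> carrier R" "r' \<in> carrier R"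
      using y cc q'c polys_carrier[OF B(1) Y r(1)] polys_carrier[OF B(1) Y r'(1)] by auto
    have h1q: "h1 q = h0 c \<otimes> h1 y [^] Suc k \<oplus> h1 q'"
      unfolding q(1) using cc yk q'c h1.hom_pow[OF y, of "Suc k"] agree[OF q(2)] by (simp del: nat_pow_Suc L.nat_pow_Suc)
    have h0q: "h0 q = h0 c \<otimes> h0 y [^] Suc k \<oplus> h0 q'"
      unfolding q(1) using cc yk q'c h0.hom_pow[OF y, of "Suc k"] by (simp del: nat_pow_Suc L.nat_pow_Suc)
    have "h1 q \<ominus> h0 q = h0 c \<otimes> (h1 y [^] Suc k \<ominus> h0 y [^] Suc k) \<oplus> (h1 q' \<ominus> h0 q')"
      unfolding h1q h0q using cl(3-7) by algebra
    also have "\<dots> = (h1 y \<ominus> h0 y) \<otimes> (h0 c \<otimes> h1 y [^] k \<oplus> (h0 c \<otimes> r \<oplus> r'))"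
      unfolding r(2) r'(2) using cl(1-3,8-10) by algebra
    finally have "h1 q \<ominus> h0 q = (h1 y \<ominus> h0 y) \<otimes> (h0 c \<otimes> h1 y [^] k \<oplus> (h0 c \<otimes> r \<oplus> r'))" .
    moreover have "h0 c \<otimes> h1 y [^] k \<oplus> (h0 c \<otimes> r \<oplus> r') \<in> polys B (h1 y) (Suc k)"
      by (rule polys_SucI[OF B(1) Y cB polys_add[OF B(1) Y polys_smult[OF B(1) Y cB r(1)] r'(1)]])
    ultimately show ?case by blast
  }
qed

text \<open>A monic equation of degree \<open>k + 1\<close> for \<open>y\<close> holds for both
  images of \<open>y\<close>. Subtracting the two instances and dividing by the difference of the
  images leaves a cofactor of degree \<open>k\<close> that is still monic.\<close>

lemma (in cring) annihilator_of_difference: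
  assumes L: "cring L" and h0: "ring_hom_ring L R h0" and h1: "ring_hom_ring L R h1"
    and F: "subring F L" and y: "y \<in> carrier L" and B: "subring B R" "h0 ` carrier L \<subseteq> B"
    and agree: "\<And>c. c \<in> F \<Longrightarrow> h1 c = h0 c" and alg: "y [^]\<^bsub>L\<^esub> Suc k \<in> ring.polys L F y (Suc k)"
  shows "\<exists>r\<in>polys B (h1 y) k. (h1 y \<ominus> h0 y) \<otimes> (h1 y [^] k \<oplus> r) = \<zero>"
proof -
  interpret L: cring L by (rule L)
  interpret h0: ring_hom_ring L R h0 by (rule h0)
  interpret h1: ring_hom_ring L R h1 by (rule h1)
  note Y = h1.hom_closed[OF y]
  have W: "h0 y \<in> B" using B(2) y by blast
  obtain r where r: "r \<in> polys B (h1 y) k" "h1 (y [^]\<^bsub>L\<^esub> Suc k) \<ominus> h0 (y [^]\<^bsub>L\<^esub> Suc k) = (h1 y \<ominus> h0 y) \<otimes> r"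
    using polys_diff_factor[OF L h0 h1 F y B agree alg] by blast
  obtain r' where r': "r' \<in> polys B (h1 y) k" "h1 y [^] Suc k \<ominus> h0 y [^] Suc k = (h1 y \<ominus> h0 y) \<otimes> (h1 y [^] k \<oplus> r')"
    using power_diff_factor[OF B(1) Y W] by blast
  have eq: "(h1 y \<ominus> h0 y) \<otimes> (h1 y [^] k \<oplus> r') = (h1 y \<ominus> h0 y) \<otimes> r"
    using r(2) r'(2) h1.hom_pow[OF y, of "Suc k"] h0.hom_pow[OF y, of "Suc k"] by (simp only:)
  have cl: "h1 y \<in> carrier R" "h0 y \<in> carrier R" "h1 y [^] k \<in> carrier R" "r \<in> carrier R" "r' \<in> carrier R"
    using y polys_carrier[OF B(1) Y r(1)] polys_carrier[OF B(1) Y r'(1)] by auto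
  have "(h1 y \<ominus> h0 y) \<otimes> (h1 y [^] k \<oplus> (r' \<ominus> r)) = (h1 y \<ominus> h0 y) \<otimes> (h1 y [^] k \<oplus> r') \<ominus> (h1 y \<ominus> h0 y) \<otimes> r"
    using cl by algebra
  also have "\<dots> = \<zero>" unfolding eq using cl by (simp add: r_right_minus_eq)
  finally show ?thesis using polys_diff[OF B(1) Y r'(1) r(1)] by blast
qed

lemma (in cring) diff_times_sum:
  assumes "a \<in> carrier R" "b \<in> carrier R" "c \<in> carrier R" "d \<in> carrier R"
  shows "(a \<ominus> b) \<otimes> (c \<oplus> d) = (a \<otimes> c \<oplus> a \<otimes> d) \<oplus> (\<ominus> (b \<otimes> c \<oplus> b \<otimes> d))"
  using assms by algebra

lemma (in cring) frobenius_diff: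
  assumes p: "Factorial_Ring.prime (p::nat)" "add_pow R p \<one> = \<zero>" and ab: "a \<in> carrier R" "b \<in> carrier R"
  shows "(a \<ominus> b) [^] p = a [^] p \<ominus> b [^] p"
  using freshman[OF p, of a "\<ominus> b"] frobenius_minus[OF p ab(2)] ab by (simp add: a_minus_def)

section \<open>Simple algebraic extensions and spanning lists\<close>

lemma (in domain) polys_Union_eq_simple_extension:
  assumes "subring F R" "x \<in> carrier R"
  shows "(\<Union>k. polys F x k) = simple_extension F x"
proof
  show "simple_extension F x \<subseteq> (\<Union>k. polys F x k)"
    unfolding simple_extension_minimal[OF assms]
    using polys_Union_subring[OF assms] base_polys[OF assms] var_polys[OF assms] by blast
  note S = simple_extension_is_subring[OF assms]
  have x: "x \<in> simple_extension F x" by (rule simple_extension_mem[OF assms])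
  have Fs: "F \<subseteq> simple_extension F x" by (rule simple_extension_incl[OF subringE(1)[OF assms(1)] assms(2)])
  have pow: "x [^] (k::nat) \<in> simple_extension F x" for k
    by (induction k) (use x subringE(3,6)[OF S] in auto)
  have "polys F x k \<subseteq> simple_extension F x" for k
  proof (induction k)
    case (Suc k)
    show ?case
    proof
      fix t assume "t \<in> polys F x (Suc k)"
      then obtain b r where t: "t = b \<otimes> x [^] k \<oplus> r" "b \<in> F" "r \<in> polys F x k" by auto
      have "b \<in> simple_extension F x" "r \<in> simple_extension F x" using t Suc Fs by auto
      then show "t \<in> simple_extension F x"
        unfolding t(1) by (intro subringE(6,7)[OF S] pow)
    qed
  qed (use subringE(2)[OF S] in simp)
  then show "(\<Union>k. polys F x k) \<subseteq> simple_extension F x" by blast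
qed

lemma (in field) algebraic_power_in_polys:
  assumes F: "subfield F R" and x: "x \<in> carrier R" and alg: "(algebraic over F) x"
  shows "\<exists>d. x [^] d \<in> polys F x d"
proof -
  note Fs = subfieldE(1)[OF F]
  obtain q where q: "q \<in> carrier (univ_poly R F)" "q \<noteq> []" "eval q x = \<zero>"
    using algebraicE[OF Fs x alg] by blast
  then obtain c cs where cs: "q = c # cs" "c \<in> F" "c \<noteq> \<zero>" "set cs \<subseteq> F"
    by (cases q) (auto simp: univ_poly_def polynomial_def)
  have eval: "eval cs x \<in> polys F x (length cs)" if "set cs \<subseteq> F" for cs
    using that
  proof (induction cs)
    case (Cons a as)
    then show ?case using polys_SucI[OF Fs x, of a "eval as x" "length as"] by simp
  qed simp
  let ?d = "length cs"
  have cc: "c \<in> carrier R" using cs(2) subfieldE(3)[OF F] by blast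
  have inv: "inv c \<in> F" "inv c \<in> carrier R" "inv c \<otimes> c = \<one>"
    using subfield_m_inv[OF F, of c] cs(2,3) subfieldE(3)[OF F] by auto
  note ec = polys_carrier[OF Fs x eval[OF cs(4)]]
  have "c \<otimes> x [^] ?d \<oplus> eval cs x = \<zero>" using q(3) by (simp add: cs(1))
  then have "c \<otimes> x [^] ?d = \<ominus> eval cs x"
    using minus_equality[of "c \<otimes> x [^] ?d" "eval cs x"] cc x ec by simp
  then have "inv c \<otimes> (c \<otimes> x [^] ?d) \<in> polys F x ?d"
    using polys_smult[OF Fs x inv(1) polys_minus[OF Fs x eval[OF cs(4)]]] by simp
  moreover have "inv c \<otimes> (c \<otimes> x [^] ?d) = x [^] ?d"
    using m_assoc[OF inv(2) cc, of "x [^] ?d"] inv(3) x by simp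
  ultimately show ?thesis by auto
qed

text \<open>Discarding redundant entries of \<open>ws\<close> leaves an independent list with the
  same span, strictly shorter unless \<open>ws\<close> is already independent. It cannot be shorter
  than \<open>bs\<close>, which is independent and lies in that span.\<close>

lemma (in ring) spanning_list_independent:
  assumes K: "subfield K R" and ws: "set ws \<subseteq> carrier R" and bs: "independent K bs"
    and span: "set bs \<subseteq> Span K ws" and len: "length bs = length ws"
  shows "independent K ws"
proof -
  have "\<exists>vs. independent K vs \<and> Span K vs = Span K ws \<and> length vs \<le> length ws \<and>
      (independent K ws \<or> length vs < length ws)"
    using ws
  proof (induction ws)
    case (Cons w ws)
    then obtain vs where vs: "independent K vs" "Span K vs = Span K ws" "length vs \<le> length ws"
      "independent K ws \<or> length vs < length ws" by auto
    show ?case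
    proof (cases "w \<in> Span K ws")
      case True
      have "set (w # ws) \<subseteq> Span K ws"
        using True Span_base_incl[OF K, of ws] Cons.prems by auto
      then have "Span K (w # ws) \<subseteq> Span K ws"
        by (rule mono_Span_subset[OF K]) (use Cons.prems in auto)
      moreover have "Span K ws \<subseteq> Span K (w # ws)"
        using mono_Span[OF K, of ws w] Cons.prems by simp
      ultimately have "Span K vs = Span K (w # ws)" using vs(2) by blast
      then show ?thesis using vs(1,3) by (intro exI[of _ vs]) simp
    next
      case False
      have w: "w \<in> carrier R" using Cons.prems by simp
      have "independent K (w # vs)" using li_Cons[OF w _ vs(1)] False vs(2) by simp
      moreover have "Span K (w # vs) = Span K (w # ws)" using vs(2) by simp
      moreover have "independent K (w # ws) \<or> length (w # vs) < length (w # ws)"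
        using li_Cons[OF w False] vs(4) by auto
      ultimately show ?thesis using vs(3) by (intro exI[of _ "w # vs"]) simp
    qed
  qed simp
  then obtain vs where "independent K vs" "Span K vs = Span K ws"
    "independent K ws \<or> length vs < length ws" by blast
  then show ?thesis using independent_length_le[OF K bs, of vs] span len by auto
qed

section \<open>Tensor squares of algebraic extensions\<close>

context field_ext
begin

text \<open>
  If \<open>x \<notin> K(x\<^sup>p)\<close>, put \<open>y = x\<^sup>p\<close> and let \<open>u \<noteq> 0\<close> be annihilated by \<open>1 \<otimes> y - y \<otimes> 1\<close>. Then
  \<open>(1 \<otimes> x - x \<otimes> 1) u\<close> is nilpotent; it is nonzero as \<open>1, x\<close> are independent over \<open>K(y)\<close>.
\<close>

lemma tensor_square_reduced_imp_perfect:
  assumes red: "reduced_ring (tensor_power K L 2)"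
    and p: "Factorial_Ring.prime (p::nat)" "add_pow L p \<one>\<^bsub>L\<^esub> = \<zero>\<^bsub>L\<^esub>"
    and x: "x \<in> carrier L" and alg: "(L.algebraic over F) (x [^]\<^bsub>L\<^esub> p)"
  shows "x \<in> (\<Union>k. L.polys F (x [^]\<^bsub>L\<^esub> p) k)"
proof (rule ccontr)
  define y where "y = x [^]\<^bsub>L\<^esub> p"
  assume "x \<notin> (\<Union>k. L.polys F (x [^]\<^bsub>L\<^esub> p) k)"
  then have xE: "x \<notin> (\<Union>k. L.polys F y k)" by (simp add: y_def)
  have y: "y \<in> carrier L" using x by (simp add: y_def)
  note Fs = subfieldE(1)[OF subfield_F]
  have E: "subfield (\<Union>k. L.polys F y k) L"
    unfolding L.polys_Union_eq_simple_extension[OF Fs y]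
    using L.simple_extension_is_subfield[OF subfield_F y] alg by (simp add: y_def)
  have ex: "\<exists>d. y [^]\<^bsub>L\<^esub> d \<in> L.polys F y d"
    using L.algebraic_power_in_polys[OF subfield_F y] alg by (simp add: y_def)
  define d where "d = (LEAST d. y [^]\<^bsub>L\<^esub> d \<in> L.polys F y d)"
  have yd: "y [^]\<^bsub>L\<^esub> d \<in> L.polys F y d"
    unfolding d_def using ex by (rule LeastI_ex)
  have low: "y [^]\<^bsub>L\<^esub> j \<notin> L.polys F y j" if "j < d" for j
    using not_less_Least[of j "\<lambda>d. y [^]\<^bsub>L\<^esub> d \<in> L.polys F y d"] that by (simp add: d_def)
  obtain e where e: "d = Suc e" using yd by (cases d) auto
  note Pc = L.polys_carrier[OF Fs y]
  have ye: "y [^]\<^bsub>L\<^esub> (j::nat) \<in> carrier L" for j using y by simp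
  have y_pow: "y [^]\<^bsub>L\<^esub> j \<in> L.polys F y k" if "j < k" for j k
  proof -
    have "y [^]\<^bsub>L\<^esub> j \<in> L.polys F y (Suc j)"
      using L.monom_polys[OF Fs y subringE(3)[OF Fs], of j] y by simp
    then show ?thesis by (rule L.polys_mono[OF Fs y]) (use that in simp)
  qed
  \<comment> \<open>The span of all \<open>x y^j\<close> with \<open>j < e\<close> and all
    \<open>y^j\<close> with \<open>j < d\<close>. A functional that is zero on \<open>V\<close> and
    one at \<open>x y^e\<close> will detect the single term that makes the nilpotent
    nonzero.\<close>
  define V where "V = {w \<in> carrier L. \<exists>u\<in>L.polys F y e. \<exists>v\<in>L.polys F y d. w = x \<otimes>\<^bsub>L\<^esub> u \<oplus>\<^bsub>L\<^esub> v}"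
  have VI: "x \<otimes>\<^bsub>L\<^esub> u \<oplus>\<^bsub>L\<^esub> v \<in> V" if "u \<in> L.polys F y e" "v \<in> L.polys F y d" for u v
    unfolding V_def using that x Pc by blast
  have V: "subalgebra F V L"
  proof (rule L.subalgebraI)
    show "V \<subseteq> carrier L" by (auto simp: V_def)
    show "\<zero>\<^bsub>L\<^esub> \<in> V"
      using VI[OF L.zero_polys[OF Fs y] L.zero_polys[OF Fs y]] x by simp
    show "F \<subseteq> carrier L" "\<ominus>\<^bsub>L\<^esub> \<one>\<^bsub>L\<^esub> \<in> F" using subringE(1,3,5)[OF Fs] by auto
    fix a assume a: "a \<in> V"
    then obtain u v where uv: "u \<in> L.polys F y e" "v \<in> L.polys F y d" "a = x \<otimes>\<^bsub>L\<^esub> u \<oplus>\<^bsub>L\<^esub> v"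
      by (auto simp: V_def)
    note uvc = Pc[OF uv(1)] Pc[OF uv(2)]
    show "a \<oplus>\<^bsub>L\<^esub> b \<in> V" if b: "b \<in> V" for b
    proof -
      obtain u' v' where uv': "u' \<in> L.polys F y e" "v' \<in> L.polys F y d" "b = x \<otimes>\<^bsub>L\<^esub> u' \<oplus>\<^bsub>L\<^esub> v'"
        using b by (auto simp: V_def)
      have "a \<oplus>\<^bsub>L\<^esub> b = x \<otimes>\<^bsub>L\<^esub> (u \<oplus>\<^bsub>L\<^esub> u') \<oplus>\<^bsub>L\<^esub> (v \<oplus>\<^bsub>L\<^esub> v')"
        unfolding uv(3) uv'(3) using x uvc Pc[OF uv'(1)] Pc[OF uv'(2)] by algebra
      then show ?thesis
        using VI[OF L.polys_add[OF Fs y uv(1) uv'(1)] L.polys_add[OF Fs y uv(2) uv'(2)]] by simp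
    qed
    show "c \<otimes>\<^bsub>L\<^esub> a \<in> V" if c: "c \<in> F" for c
    proof -
      have cc: "c \<in> carrier L" using c F_carrier by blast
      have "c \<otimes>\<^bsub>L\<^esub> a = x \<otimes>\<^bsub>L\<^esub> (c \<otimes>\<^bsub>L\<^esub> u) \<oplus>\<^bsub>L\<^esub> (c \<otimes>\<^bsub>L\<^esub> v)"
        unfolding uv(3) using x uvc cc by algebra
      then show ?thesis
        using VI[OF L.polys_smult[OF Fs y c uv(1)] L.polys_smult[OF Fs y c uv(2)]] by simp
    qed
  qed
  \<comment> \<open>Otherwise \<open>x z = v\<close> with \<open>z = y^e - u\<close>. Here
    \<open>z\<close> is nonzero by minimality of \<open>d\<close>, so \<open>x = v / z\<close> would
    lie in the field generated by \<open>y\<close>.\<close>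
  have xV: "x \<otimes>\<^bsub>L\<^esub> y [^]\<^bsub>L\<^esub> e \<notin> V"
  proof
    assume "x \<otimes>\<^bsub>L\<^esub> y [^]\<^bsub>L\<^esub> e \<in> V"
    then obtain u v where uv: "u \<in> L.polys F y e" "v \<in> L.polys F y d"
      "x \<otimes>\<^bsub>L\<^esub> y [^]\<^bsub>L\<^esub> e = x \<otimes>\<^bsub>L\<^esub> u \<oplus>\<^bsub>L\<^esub> v" by (auto simp: V_def)
    note uvc = Pc[OF uv(1)] Pc[OF uv(2)]
    define z where "z = y [^]\<^bsub>L\<^esub> e \<ominus>\<^bsub>L\<^esub> u"
    have zc: "z \<in> carrier L" unfolding z_def using ye uvc by simp
    have "z \<noteq> \<zero>\<^bsub>L\<^esub>" using low[of e] uv(1) uvc ye L.r_right_minus_eq by (auto simp: z_def e)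
    moreover have "z \<in> L.polys F y d"
      unfolding z_def by (intro L.polys_diff[OF Fs y] y_pow L.polys_mono[OF Fs y uv(1)]) (simp_all add: e)
    ultimately have i: "inv\<^bsub>L\<^esub> z \<in> (\<Union>k. L.polys F y k)" "z \<otimes>\<^bsub>L\<^esub> inv\<^bsub>L\<^esub> z = \<one>\<^bsub>L\<^esub>"
      using L.subfield_m_inv[OF E, of z] by blast+
    have ic: "inv\<^bsub>L\<^esub> z \<in> carrier L" using i(1) subfieldE(3)[OF E] by blast
    have "x \<otimes>\<^bsub>L\<^esub> z = x \<otimes>\<^bsub>L\<^esub> y [^]\<^bsub>L\<^esub> e \<ominus>\<^bsub>L\<^esub> x \<otimes>\<^bsub>L\<^esub> u"
      unfolding z_def by (rule L.r_diff_distr[OF ye uvc(1) x])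
    also have "\<dots> = v"
      unfolding uv(3) using x uvc by algebra
    finally have "v \<otimes>\<^bsub>L\<^esub> inv\<^bsub>L\<^esub> z = x \<otimes>\<^bsub>L\<^esub> (z \<otimes>\<^bsub>L\<^esub> inv\<^bsub>L\<^esub> z)"
      using x zc ic by (simp add: L.m_assoc[symmetric])
    then have "v \<otimes>\<^bsub>L\<^esub> inv\<^bsub>L\<^esub> z = x" using i(2) x by simp
    moreover have "v \<otimes>\<^bsub>L\<^esub> inv\<^bsub>L\<^esub> z \<in> (\<Union>k. L.polys F y k)"
      using subringE(6)[OF subfieldE(1)[OF E] _ i(1)] uv(2) by blast
    ultimately show False using xE by simp
  qed
  obtain f where f: "L.linear_on F f" "f \<in> carrier L \<rightarrow> F" "\<And>v. v \<in> V \<Longrightarrow> f v = \<zero>\<^bsub>L\<^esub>"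
    "f (x \<otimes>\<^bsub>L\<^esub> y [^]\<^bsub>L\<^esub> e) = \<one>\<^bsub>L\<^esub>"
    using L.exists_functional[OF subfield_F V L.m_closed[OF x ye] xV] by metis
  have fx: "f (x \<otimes>\<^bsub>L\<^esub> y [^]\<^bsub>L\<^esub> j) = \<zero>\<^bsub>L\<^esub>" if "j < e" for j
    using f(3) VI[OF y_pow[OF that] L.zero_polys[OF Fs y]] x ye by simp
  have fy: "f (y [^]\<^bsub>L\<^esub> j) = \<zero>\<^bsub>L\<^esub>" if "j < d" for j
    using f(3) VI[OF L.zero_polys[OF Fs y] y_pow[OF that]] x ye by simp
  interpret tensor_powers K L 2 by unfold_locales simp
  define i1 :: nat where "i1 = 1"
  have n2: "0 < (2::nat)" "i1 < 2" "0 < i1" by (simp_all add: i1_def)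
  interpret s0: ring_hom_ring L T.quot "slot 0"
    by (rule ring_hom_ringI2[OF L.ring_axioms T.Q.ring_axioms slot_hom[OF n2(1)]])
  interpret LD: linearly_disjoint T.quot L F "slot i1" "part i1"
    by (rule linearly_disjoint_part[OF n2(2)])
  let ?Q = "T.quot"
  define B where "B = slot 0 ` carrier L"
  have B: "subring B ?Q" unfolding B_def by (rule s0.img_is_subring[OF L.carrier_is_subring])
  have B_part: "B \<subseteq> part i1" unfolding B_def using slot_part[of 0 i1] n2 by auto
  define Y where "Y = slot i1 y"
  define U where "U = slot i1 x"
  define Z where "Z = slot 0 x"
  have YUZ: "Y \<in> carrier ?Q" "U \<in> carrier ?Q" "Z \<in> carrier ?Q" "Z \<in> B"
    unfolding Y_def U_def Z_def B_def using x y by auto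
  \<comment> \<open>The annihilator of the difference of the two images of \<open>y\<close> is monic
    of degree \<open>e = d - 1\<close> in \<open>Y\<close>, with lower coefficients from slot
    0.\<close>
  obtain r where r: "r \<in> T.Q.polys B Y e" "(Y \<ominus>\<^bsub>?Q\<^esub> slot 0 y) \<otimes>\<^bsub>?Q\<^esub> (Y [^]\<^bsub>?Q\<^esub> e \<oplus>\<^bsub>?Q\<^esub> r) = \<zero>\<^bsub>?Q\<^esub>"
    using T.Q.annihilator_of_difference[OF L.is_cring s0.is_ring_hom_ring LD.\<iota>.is_ring_hom_ring Fs y B _ slot_F[OF n2(2,1)], of e]
      yd unfolding e Y_def B_def by auto
  have rc: "r \<in> carrier ?Q" by (rule T.Q.polys_carrier[OF B YUZ(1) r(1)])
  define u where "u = Y [^]\<^bsub>?Q\<^esub> e \<oplus>\<^bsub>?Q\<^esub> r"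
  have uc: "u \<in> carrier ?Q" unfolding u_def using YUZ rc by simp
  define s where "s = (U \<ominus>\<^bsub>?Q\<^esub> Z) \<otimes>\<^bsub>?Q\<^esub> u"
  have sc: "s \<in> carrier ?Q" unfolding s_def using YUZ uc by simp
  have "s [^]\<^bsub>?Q\<^esub> p = \<zero>\<^bsub>?Q\<^esub>"
  proof -
    have pT: "add_pow ?Q p \<one>\<^bsub>?Q\<^esub> = \<zero>\<^bsub>?Q\<^esub>"
      using s0.hom_add_pow_one[of p] p(2) by simp
    obtain q where q: "p = Suc q" using prime_gt_0_nat[OF p(1)] by (cases p) auto
    have "(U \<ominus>\<^bsub>?Q\<^esub> Z) [^]\<^bsub>?Q\<^esub> p = U [^]\<^bsub>?Q\<^esub> p \<ominus>\<^bsub>?Q\<^esub> Z [^]\<^bsub>?Q\<^esub> p"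
      by (rule T.Q.frobenius_diff[OF p(1) pT YUZ(2,3)])
    then have "(U \<ominus>\<^bsub>?Q\<^esub> Z) [^]\<^bsub>?Q\<^esub> p = Y \<ominus>\<^bsub>?Q\<^esub> slot 0 y"
      by (simp only: U_def Z_def Y_def y_def LD.\<iota>.hom_pow[OF x] s0.hom_pow[OF x])
    moreover have "s [^]\<^bsub>?Q\<^esub> p = (U \<ominus>\<^bsub>?Q\<^esub> Z) [^]\<^bsub>?Q\<^esub> p \<otimes>\<^bsub>?Q\<^esub> u [^]\<^bsub>?Q\<^esub> p"
      unfolding s_def using YUZ uc by (intro T.Q.nat_pow_distrib) auto
    \<comment> \<open>One factor \<open>u\<close> of \<open>u^p\<close> already annihilates the
      difference of the images of \<open>y\<close>, which is \<open>(U - Z)^p\<close>.\<close>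
    ultimately have "s [^]\<^bsub>?Q\<^esub> p = (Y \<ominus>\<^bsub>?Q\<^esub> slot 0 y) \<otimes>\<^bsub>?Q\<^esub> u \<otimes>\<^bsub>?Q\<^esub> u [^]\<^bsub>?Q\<^esub> q"
      unfolding q using YUZ uc s0.hom_closed[OF y] by (simp add: T.Q.m_ac)
    also have "\<dots> = \<zero>\<^bsub>?Q\<^esub>" using r(2) uc by (simp add: u_def)
    finally show ?thesis .
  qed
  then have s0: "s = \<zero>\<^bsub>?Q\<^esub>" using red sc unfolding quot_eq[symmetric] by (auto simp: reduced_ring_def)
  obtain T where T: "T \<in> carrier ?Q \<rightarrow> carrier ?Q"
    "\<And>s t. s \<in> carrier ?Q \<Longrightarrow> t \<in> carrier ?Q \<Longrightarrow> T (s \<oplus>\<^bsub>?Q\<^esub> t) = T s \<oplus>\<^bsub>?Q\<^esub> T t" "T \<zero>\<^bsub>?Q\<^esub> = \<zero>\<^bsub>?Q\<^esub>"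
    "\<And>l b. l \<in> carrier L \<Longrightarrow> b \<in> LD.compositum F \<Longrightarrow> T (b \<otimes>\<^bsub>?Q\<^esub> slot i1 l) = b \<otimes>\<^bsub>?Q\<^esub> slot i1 (f l)"
    using LD.contract_compositum[OF Fs order_refl f(1)] by metis
  have Tmin: "T (\<ominus>\<^bsub>?Q\<^esub> t) = \<ominus>\<^bsub>?Q\<^esub> T t" if "t \<in> carrier ?Q" for t
    by (rule additive_finsum(2)[OF T.Q.is_abelian_group T.Q.is_abelian_group T(1) _ that]) (use T(2) in blast)
  have Tb: "T (b \<otimes>\<^bsub>?Q\<^esub> slot i1 l) = \<zero>\<^bsub>?Q\<^esub>" if "b \<in> B" "l \<in> carrier L" "f l = \<zero>\<^bsub>L\<^esub>" for b l
  proof -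
    have "b \<in> LD.compositum F" using that(1) B_part LD.compositum_K by blast
    moreover have "b \<in> carrier ?Q" using that(1) subringE(1)[OF B] by blast
    ultimately show ?thesis using T(4)[OF that(2)] that(3) by simp
  qed
  have Upow: "U \<otimes>\<^bsub>?Q\<^esub> Y [^]\<^bsub>?Q\<^esub> j = slot i1 (x \<otimes>\<^bsub>L\<^esub> y [^]\<^bsub>L\<^esub> j)" for j :: nat
    unfolding U_def Y_def using x y by (simp add: LD.\<iota>.hom_pow)
  have Ypow: "Y [^]\<^bsub>?Q\<^esub> j = slot i1 (y [^]\<^bsub>L\<^esub> j)" for j :: nat
    unfolding Y_def using y by (simp add: LD.\<iota>.hom_pow)
  \<comment> \<open>The contraction acts in the second slot and treats elements of slot 0 as
    scalars; in degrees below \<open>e\<close> only elements of \<open>V\<close> occur in the second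
    slot.\<close>
  have TU: "T (U \<otimes>\<^bsub>?Q\<^esub> t) = \<zero>\<^bsub>?Q\<^esub> \<and> T (Z \<otimes>\<^bsub>?Q\<^esub> t) = \<zero>\<^bsub>?Q\<^esub>"
    if "t \<in> T.Q.polys B Y k" "k \<le> e" for t k
    using that
  proof (induction k arbitrary: t)
    case 0
    then show ?case using YUZ T(3) by simp
  next
    case (Suc k)
    from Suc.prems(1) obtain b t' where t: "t = b \<otimes>\<^bsub>?Q\<^esub> Y [^]\<^bsub>?Q\<^esub> k \<oplus>\<^bsub>?Q\<^esub> t'" "b \<in> B" "t' \<in> T.Q.polys B Y k" by auto
    have bc: "b \<in> carrier ?Q" using t(2) subringE(1)[OF B] by blast
    have t'c: "t' \<in> carrier ?Q" by (rule T.Q.polys_carrier[OF B YUZ(1) t(3)])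
    have Yk: "Y [^]\<^bsub>?Q\<^esub> k \<in> carrier ?Q" using YUZ by simp
    have IH: "T (U \<otimes>\<^bsub>?Q\<^esub> t') = \<zero>\<^bsub>?Q\<^esub>" "T (Z \<otimes>\<^bsub>?Q\<^esub> t') = \<zero>\<^bsub>?Q\<^esub>"
      using Suc.IH[OF t(3)] Suc.prems(2) by auto
    have "U \<otimes>\<^bsub>?Q\<^esub> t = b \<otimes>\<^bsub>?Q\<^esub> (U \<otimes>\<^bsub>?Q\<^esub> Y [^]\<^bsub>?Q\<^esub> k) \<oplus>\<^bsub>?Q\<^esub> U \<otimes>\<^bsub>?Q\<^esub> t'"
      unfolding t(1) using YUZ bc t'c Yk by (simp add: T.Q.r_distr T.Q.m_lcomm)
    moreover have "T (b \<otimes>\<^bsub>?Q\<^esub> (U \<otimes>\<^bsub>?Q\<^esub> Y [^]\<^bsub>?Q\<^esub> k)) = \<zero>\<^bsub>?Q\<^esub>"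
      unfolding Upow using x ye fx[of k] Suc.prems(2) by (intro Tb[OF t(2)]) auto
    ultimately have 1: "T (U \<otimes>\<^bsub>?Q\<^esub> t) = \<zero>\<^bsub>?Q\<^esub>"
      using T(2)[of "b \<otimes>\<^bsub>?Q\<^esub> (U \<otimes>\<^bsub>?Q\<^esub> Y [^]\<^bsub>?Q\<^esub> k)" "U \<otimes>\<^bsub>?Q\<^esub> t'"] IH bc YUZ Yk t'c by simp
    have "Z \<otimes>\<^bsub>?Q\<^esub> t = (Z \<otimes>\<^bsub>?Q\<^esub> b) \<otimes>\<^bsub>?Q\<^esub> Y [^]\<^bsub>?Q\<^esub> k \<oplus>\<^bsub>?Q\<^esub> Z \<otimes>\<^bsub>?Q\<^esub> t'"
      unfolding t(1) using YUZ bc t'c Yk by (simp add: T.Q.r_distr T.Q.m_assoc)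
    moreover have "T ((Z \<otimes>\<^bsub>?Q\<^esub> b) \<otimes>\<^bsub>?Q\<^esub> Y [^]\<^bsub>?Q\<^esub> k) = \<zero>\<^bsub>?Q\<^esub>"
      unfolding Ypow using ye fy[of k] Suc.prems(2) e by (intro Tb subringE(6)[OF B YUZ(4) t(2)]) auto
    ultimately have 2: "T (Z \<otimes>\<^bsub>?Q\<^esub> t) = \<zero>\<^bsub>?Q\<^esub>"
      using T(2)[of "(Z \<otimes>\<^bsub>?Q\<^esub> b) \<otimes>\<^bsub>?Q\<^esub> Y [^]\<^bsub>?Q\<^esub> k" "Z \<otimes>\<^bsub>?Q\<^esub> t'"] IH bc YUZ Yk t'c by simp
    show ?case using 1 2 by simp
  qed
  have Ye: "Y [^]\<^bsub>?Q\<^esub> e \<in> carrier ?Q" using YUZ by simp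
  have one: "T (U \<otimes>\<^bsub>?Q\<^esub> Y [^]\<^bsub>?Q\<^esub> e) = \<one>\<^bsub>?Q\<^esub>"
    unfolding Upow
    using T(4)[of "x \<otimes>\<^bsub>L\<^esub> y [^]\<^bsub>L\<^esub> e" "\<one>\<^bsub>?Q\<^esub>"] subringE(3)[OF part_subring[of i1]] LD.compositum_K
      f(4) x ye LD.\<iota>.hom_closed[of "x \<otimes>\<^bsub>L\<^esub> y [^]\<^bsub>L\<^esub> e"] by simp
  have zero: "T (Z \<otimes>\<^bsub>?Q\<^esub> Y [^]\<^bsub>?Q\<^esub> e) = \<zero>\<^bsub>?Q\<^esub>"
    unfolding Ypow using ye fy[of e] e by (intro Tb[OF YUZ(4)]) auto
  have "s = (U \<otimes>\<^bsub>?Q\<^esub> Y [^]\<^bsub>?Q\<^esub> e \<oplus>\<^bsub>?Q\<^esub> U \<otimes>\<^bsub>?Q\<^esub> r) \<oplus>\<^bsub>?Q\<^esub> (\<ominus>\<^bsub>?Q\<^esub> (Z \<otimes>\<^bsub>?Q\<^esub> Y [^]\<^bsub>?Q\<^esub> e \<oplus>\<^bsub>?Q\<^esub> Z \<otimes>\<^bsub>?Q\<^esub> r))"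
    unfolding s_def u_def by (rule T.Q.diff_times_sum[OF YUZ(2,3) Ye rc])
  \<comment> \<open>Of the four products in \<open>s\<close>, only \<open>U Y^e\<close> survives the
    contraction, with value one.\<close>
  then have "T s = \<one>\<^bsub>?Q\<^esub>"
    using TU[OF r(1) order_refl] one zero YUZ(2,3) Ye rc by (simp add: T(2) Tmin)
  then show False using s0 T(3) one_not_zero by simp
qed

text \<open>\<open>us\<close> is completed to a basis \<open>bs\<close> of a finite subextension
  \<open>V\<close>. The span \<open>V'\<close> of the \<open>p\<close>-th powers of
  \<open>bs\<close> contains all \<open>p\<close>-th powers of elements of \<open>V\<close>, and it
  is closed under multiplication. Hence it contains every polynomial in \<open>x^p\<close> for
  \<open>x\<close> in \<open>V\<close>, and by \<open>perf\<close> the element \<open>x\<close>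
  itself. As the powers are as numerous as \<open>bs\<close>, they are independent.\<close>

lemma perfect_imp_frobenius_independent:
  assumes alg: "algebraic_extension K L"
    and p: "Factorial_Ring.prime (p::nat)" "add_pow L p \<one>\<^bsub>L\<^esub> = \<zero>\<^bsub>L\<^esub>"
    and perf: "\<And>x. x \<in> carrier L \<Longrightarrow> x \<in> (\<Union>k. L.polys F (x [^]\<^bsub>L\<^esub> p) k)"
    and us: "L.independent F us"
  shows "L.independent F (map (\<lambda>x. x [^]\<^bsub>L\<^esub> p) us)"
proof -
  let ?g = "\<lambda>x. x [^]\<^bsub>L\<^esub> p"
  note Fs = subfieldE(1)[OF subfield_F]
  have usc: "set us \<subseteq> carrier L" by (rule L.independent_in_carrier[OF us])
  define V where "V = L.finite_extension F us"
  have Vs: "subring V L" unfolding V_def by (rule L.finite_extension_is_subring[OF Fs usc])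
  have usV: "set us \<subseteq> V" unfolding V_def by (rule L.finite_extension_mem[OF Fs usc])
  have "L.finite_dimension F V"
    unfolding V_def using alg usc
    by (intro L.finite_extension_finite_dimension(1)[OF subfield_F usc]) (auto simp: algebraic_extension_def)
  then obtain n where n: "L.dimension n F V" by (auto simp: L.finite_dimension_def)
  obtain ws where ws: "L.independent F (ws @ us)" "L.Span F (ws @ us) = V"
    using L.complete_base[OF subfield_F n us usV] by blast
  define bs where "bs = ws @ us"
  have bsc: "set bs \<subseteq> carrier L" using L.independent_in_carrier[OF ws(1)] by (simp add: bs_def)
  have gbsc: "set (map ?g bs) \<subseteq> carrier L" using bsc by auto
  define V' where "V' = L.Span F (map ?g bs)"
  have V': "subalgebra F V' L" unfolding V'_def by (rule L.Span_is_subalgebra[OF subfield_F gbsc])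
  note V'E = L.subalgebraE[OF V']
  have gF: "c [^]\<^bsub>L\<^esub> p \<in> F" if "c \<in> F" for c
  proof -
    have "c [^]\<^bsub>L\<^esub> (m::nat) \<in> F" for m by (induction m) (use that subringE(3,6)[OF Fs] in auto)
    then show ?thesis .
  qed
  have gV: "?g z \<in> V'" if z: "z \<in> V" for z
  proof -
    have "z \<in> L.Span F bs" using z ws(2) by (simp only: bs_def)
    then obtain ks where ks: "set ks \<subseteq> F" "z = L.combine ks bs"
      unfolding L.Span_mem_iff_length_version[OF subfield_F bsc] by blast
    have "?g z = L.combine (map ?g ks) (map ?g bs)"
      unfolding ks(2) using ks(1) F_carrier bsc by (intro L.frobenius_combine[OF p]) auto
    moreover have "set (map ?g ks) \<subseteq> F" using ks(1) gF by auto
    ultimately show ?thesis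
      unfolding V'_def using L.Span_eq_combine_set[OF subfield_F gbsc] by blast
  qed
  have bsV: "set bs \<subseteq> V"
    using L.Span_base_incl[OF subfield_F bsc] unfolding bs_def ws(2) .
  have mult_gen: "a \<otimes>\<^bsub>L\<^esub> b \<in> V'" if gab: "a \<in> set (map ?g bs)" "b \<in> set (map ?g bs)" for a b
  proof -
    obtain a' where a: "a' \<in> V" "a = ?g a'" using gab(1) bsV by auto
    obtain b' where b: "b' \<in> V" "b = ?g b'" using gab(2) bsV by auto
    note ab = a(1) b(1) a(2) b(2)
    have "a' \<in> carrier L" "b' \<in> carrier L" using ab subringE(1)[OF Vs] by auto
    then have "a \<otimes>\<^bsub>L\<^esub> b = ?g (a' \<otimes>\<^bsub>L\<^esub> b')" using ab by (simp add: L.nat_pow_distrib)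
    then show ?thesis using gV[OF subringE(6)[OF Vs ab(1,2)]] by simp
  qed
  have annihilate: "subalgebra F {b \<in> carrier L. a \<otimes>\<^bsub>L\<^esub> b \<in> V'} L" if a: "a \<in> carrier L" for a
  proof (rule L.subalgebraI)
    show "\<zero>\<^bsub>L\<^esub> \<in> {b \<in> carrier L. a \<otimes>\<^bsub>L\<^esub> b \<in> V'}" using V'E(2) a by simp
    show "F \<subseteq> carrier L" "\<ominus>\<^bsub>L\<^esub> \<one>\<^bsub>L\<^esub> \<in> F" using subringE(1,3,5)[OF Fs] by auto
    show "b \<oplus>\<^bsub>L\<^esub> b' \<in> {b \<in> carrier L. a \<otimes>\<^bsub>L\<^esub> b \<in> V'}"
      if "b \<in> {b \<in> carrier L. a \<otimes>\<^bsub>L\<^esub> b \<in> V'}" "b' \<in> {b \<in> carrier L. a \<otimes>\<^bsub>L\<^esub> b \<in> V'}" for b b'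
      using that V'E(3) a by (simp add: L.r_distr)
    show "c \<otimes>\<^bsub>L\<^esub> b \<in> {b \<in> carrier L. a \<otimes>\<^bsub>L\<^esub> b \<in> V'}"
      if "c \<in> F" "b \<in> {b \<in> carrier L. a \<otimes>\<^bsub>L\<^esub> b \<in> V'}" for c b
    proof -
      have c: "c \<in> carrier L" using that(1) F_carrier by blast
      have "a \<otimes>\<^bsub>L\<^esub> (c \<otimes>\<^bsub>L\<^esub> b) = c \<otimes>\<^bsub>L\<^esub> (a \<otimes>\<^bsub>L\<^esub> b)" using a c that(2) by (simp add: L.m_lcomm)
      then show ?thesis using V'E(6)[OF that(1)] that(2) c by simp
    qed
  qed blast
  \<comment> \<open>A product of two \<open>p\<close>-th powers from \<open>V\<close> is again such
    a power. Bilinear extension proceeds in one argument at a time, as the elements whose product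
    with a fixed one lies in \<open>V'\<close> form a subspace.\<close>
  have mult: "a \<otimes>\<^bsub>L\<^esub> b \<in> V'" if "a \<in> V'" "b \<in> V'" for a b
  proof -
    have gen: "a \<otimes>\<^bsub>L\<^esub> b \<in> V'" if a: "a \<in> set (map ?g bs)" and b: "b \<in> V'" for a b
    proof -
      have ac: "a \<in> carrier L" using a gbsc by blast
      have "L.Span F (map ?g bs) \<subseteq> {b \<in> carrier L. a \<otimes>\<^bsub>L\<^esub> b \<in> V'}"
        using mult_gen[OF a] gbsc by (intro L.subalgebra_Span_incl[OF subfield_F annihilate[OF ac]]) blast
      then show ?thesis using b by (auto simp: V'_def)
    qed
    have bc: "b \<in> carrier L" using that V'E(1) by blast
    have "set (map ?g bs) \<subseteq> {a \<in> carrier L. b \<otimes>\<^bsub>L\<^esub> a \<in> V'}"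
    proof
      fix a assume a: "a \<in> set (map ?g bs)"
      then have "a \<in> carrier L" using gbsc by blast
      then show "a \<in> {a \<in> carrier L. b \<otimes>\<^bsub>L\<^esub> a \<in> V'}" using gen[OF a that(2)] bc by (simp add: L.m_comm)
    qed
    then have "L.Span F (map ?g bs) \<subseteq> {a \<in> carrier L. b \<otimes>\<^bsub>L\<^esub> a \<in> V'}"
      by (rule L.subalgebra_Span_incl[OF subfield_F annihilate[OF bc]])
    then have "b \<otimes>\<^bsub>L\<^esub> a \<in> V'" "a \<in> carrier L" using that(1) by (auto simp: V'_def)
    then show ?thesis using bc by (simp add: L.m_comm)
  qed
  have one: "\<one>\<^bsub>L\<^esub> \<in> V'" using gV[OF subringE(3)[OF Vs]] by simp
  have polys: "L.polys F (?g x) k \<subseteq> V'" if x: "x \<in> V" for x k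
  proof (induction k)
    case (Suc k)
    have pow: "?g x [^]\<^bsub>L\<^esub> (m::nat) \<in> V'" for m
      by (induction m) (use one mult gV[OF x] in auto)
    show ?case using Suc V'E(3,6) pow by auto
  qed (use V'E(2) in simp)
  have "set bs \<subseteq> L.Span F (map ?g bs)"
  proof
    fix x assume "x \<in> set bs"
    then have "x \<in> V" "x \<in> carrier L" using bsV bsc by auto
    then show "x \<in> L.Span F (map ?g bs)" using perf[of x] polys[of x] unfolding V'_def by blast
  qed
  then have "L.independent F (map ?g bs)"
    using ws(1) by (intro L.spanning_list_independent[OF subfield_F gbsc, of bs]) (simp_all add: bs_def)
  then show ?thesis
    using L.independent_drop[of F "map ?g bs" "length ws"] by (simp add: bs_def)
qed

theorem tensor_square_reduced_imp_maclane:
  assumes alg: "algebraic_extension K L" and red: "reduced_ring (tensor_power K L 2)"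
  shows maclane
  unfolding maclane_def
proof (intro allI impI)
  fix p :: nat and us
  assume p: "Factorial_Ring.prime p" "add_pow L p \<one>\<^bsub>L\<^esub> = \<zero>\<^bsub>L\<^esub>" and us: "L.independent F us"
  show "L.independent F (map (\<lambda>x. x [^]\<^bsub>L\<^esub> p) us)"
  proof (rule perfect_imp_frobenius_independent[OF alg p _ us])
    fix x assume x: "x \<in> carrier L"
    show "x \<in> (\<Union>k. L.polys F (x [^]\<^bsub>L\<^esub> p) k)"
      using alg x by (intro tensor_square_reduced_imp_perfect[OF red p x]) (simp add: algebraic_extension_def)
  qed
qed

end

theorem theorem2p12:
  fixes K :: "'k ring" and L :: "('k, 'l) module"
  assumes "field_extension K L"
  shows "(separable_extension TYPE('u) K L \<longleftrightarrow> (\<forall>n\<ge>1. reduced_ring (tensor_power K L n)))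
    \<and> (fin_gen_extension K L \<longrightarrow>
         (\<exists>N\<ge>1. separable_extension TYPE('u) K L \<longleftrightarrow> reduced_ring (tensor_power K L N)))
    \<and> (algebraic_extension K L \<longrightarrow>
         (separable_extension TYPE('u) K L \<longleftrightarrow> reduced_ring (tensor_power K L 2)))"
proof -
  interpret field_ext K L by (rule field_extI[OF assms])
  have sep: "separable_extension TYPE('u) K L \<longleftrightarrow> maclane"
    using maclane_imp_separable separable_imp_maclane by blast
  have powers: "reduced_ring (tensor_power K L n)" if "maclane" "n \<ge> 1" for n
  proof -
    interpret tensor_powers K L n by unfold_locales (rule that(2))
    show ?thesis by (rule maclane_imp_reduced[OF that(1)])
  qed
  have 1: "separable_extension TYPE('u) K L \<longleftrightarrow> (\<forall>n\<ge>1. reduced_ring (tensor_power K L n))"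
    using sep powers tensor_powers_reduced_imp_maclane by blast
  \<comment> \<open>\<open>N\<close> may depend on the extension: if \<open>L\<close> is separable,
    every exponent will do; otherwise the first equivalence provides an exponent whose tensor power
    is not reduced.\<close>
  have 2: "\<exists>N\<ge>1. separable_extension TYPE('u) K L \<longleftrightarrow> reduced_ring (tensor_power K L N)"
    using 1 by (cases "separable_extension TYPE('u) K L") blast+
  have 3: "separable_extension TYPE('u) K L \<longleftrightarrow> reduced_ring (tensor_power K L 2)"
    if "algebraic_extension K L"
    using sep powers[of 2] tensor_square_reduced_imp_maclane[OF that] by auto
  show ?thesis using 1 2 3 by blast
qed

end
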